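(* Let $\beta>0$, $\mathbb{C}_+=\{z\in\mathbb{C}:\operatorname{Im}z>0\}$ and $\mathbb{S}_\beta=\{z\in\mathbb{C}:0<\operatorname{Im}z<\beta\}$. (i) Let $Q_w^{\mathbb{C}_+}$ ($w\in\mathbb{C}_+$) and $Q_w^{\mathbb{S}_\beta}$ ($w\in\mathbb{S}_\beta$) be the evaluation functionals (Szegő kernel functions) of the Hardy spaces $H^2(\mathbb{C}_+)$ and $H^2(\mathbb{S}_\beta)$. For $w\in\mathbb{S}_\beta$, the functions $Q_w^{\mathbb{C}_+}$ on $\mathbb{C}_+$ and $Q_w^{\mathbb{S}_\beta}$ on $\mathbb{S}_\beta$ extend meromorphically to $\mathbb{C}$, and in this sense $$Q_w^{\mathbb{S}_\beta}(z)=\sum_{k\in\mathbb{Z}}(-1)^kQ_w^{\mathbb{C}_+}(z+2ki\beta)$$ as an identity of meromorphic functions of $z$. (ii) For the Bergman spaces $B^2(\Omega)=L^2(\Omega)\cap\mathcal{O}(\Omega)$ with reproducing kernels $Q^{B,\Omega}(z,w)=Q^{B,\Omega}_w(z)$, $\Omega=\mathbb{C}_+,\mathbb{S}_\beta$, the Bergman kernel of $\mathbb{S}_\beta$ is a constant multiple of the corresponding series without sign changes: there is a constant $c$ such that, for $w\in\mathbb{S}_\beta$, $$Q^{B,\mathbb{S}_\beta}_w(z)=c\sum_{k\in\mathbb{Z}}Q^{B,\mathbb{C}_+}_w(z+2ki\beta),$$ where $Q^{B,\mathbb{C}_+}_w$ denotes the meromorphic extension to $\mathbb{C}$.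
   Context: $\mathcal{O}(\Omega)$ denotes the holomorphic functions on $\Omega$. For $\Omega=\mathbb{C}_+$ or $\mathbb{S}_\beta$, the Hardy space $H^2(\Omega)$ is the reproducing kernel Hilbert space of holomorphic functions $\sqrt{\psi'}\cdot(g\circ\psi)$, $g\in H^2(\mathbb{D})$, where $\psi:\Omega\to\mathbb{D}$ is biholomorphic onto the unit disc; its norm is the $L^2(\partial\Omega)$-norm of the non-tangential boundary values with respect to length measure (for $\mathbb{S}_\beta$ the boundary consists of the two lines $\mathbb{R}$ and $\mathbb{R}+i\beta$). With inner products linear in the second argument, $Q_w^\Omega\in H^2(\Omega)$ is determined by $f(w)=\langle Q_w^\Omega,f\rangle$ for all $f\in H^2(\Omega)$. $L^2(\Omega)$ refers to area measure, and $Q^{B,\Omega}_w\in B^2(\Omega)$ is determined by $f(w)=\langle Q^{B,\Omega}_w,f\rangle$ for $f\in B^2(\Omega)$. *)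

theory Defs
  imports "HOL-Complex_Analysis.Complex_Analysis"
begin

definition upper_half_plane :: "complex set" where
  "upper_half_plane = {z. 0 < Im z}"

definition strip :: "real \<Rightarrow> complex set" where
  "strip \<beta> = {z. 0 < Im z \<and> Im z < \<beta>}"

definition biholomorphic_map :: "(complex \<Rightarrow> complex) \<Rightarrow> complex set \<Rightarrow> complex set \<Rightarrow> bool" where
  "biholomorphic_map \<psi> \<Omega> D \<longleftrightarrow>
     \<psi> holomorphic_on \<Omega> \<and> bij_betw \<psi> \<Omega> D \<and> inv_into \<Omega> \<psi> holomorphic_on D"

definition hardy_disc :: "(complex \<Rightarrow> complex) set" where
  "hardy_disc = {g. g holomorphic_on ball 0 1 \<and>
     (\<exists>C. \<forall>r\<in>{0..<1}. integral {0..2*pi} (\<lambda>t. (norm (g (of_real r * cis t)))\<^sup>2) \<le> C)}"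

(* In all function spaces below, only the values of a function on \<Omega> matter; h is a holomorphic
   branch of the square root of the derivative of \<psi>. *)
definition hardy_space :: "complex set \<Rightarrow> (complex \<Rightarrow> complex) set" where
  "hardy_space \<Omega> = {f. \<exists>\<psi> h g. biholomorphic_map \<psi> \<Omega> (ball 0 1) \<and>
     h holomorphic_on \<Omega> \<and> (\<forall>z\<in>\<Omega>. (h z)\<^sup>2 = deriv \<psi> z) \<and>
     g \<in> hardy_disc \<and> (\<forall>z\<in>\<Omega>. f z = h z * g (\<psi> z))}"

(* For the half-plane this is the cone at p bounded by two rays; larger a means wider aperture. *)
definition nt_region :: "complex set \<Rightarrow> complex \<Rightarrow> real \<Rightarrow> complex set" where
  "nt_region \<Omega> p a = {z\<in>\<Omega>. dist z p < (1 + a) * infdist z (frontier \<Omega>)}"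

definition has_nt_limit :: "complex set \<Rightarrow> (complex \<Rightarrow> complex) \<Rightarrow> complex \<Rightarrow> complex \<Rightarrow> bool" where
  "has_nt_limit \<Omega> f p L \<longleftrightarrow> (\<forall>a>0. (f \<longlongrightarrow> L) (at p within nt_region \<Omega> p a))"

(* Boundary values exist only almost everywhere; where there is none, the value is arbitrary. *)
definition nt_boundary_value :: "complex set \<Rightarrow> (complex \<Rightarrow> complex) \<Rightarrow> complex \<Rightarrow> complex" where
  "nt_boundary_value \<Omega> f p = (THE L. has_nt_limit \<Omega> f p L)"

(* Inner product of L^2 of the boundary with respect to length measure, for domains whose boundary
   is a finite union of horizontal lines. The image Im ` frontier \<Omega> is the set of their heights:
   {0} for the upper half-plane and {0, \<beta>} for the strip. The completed measure lebesgue is used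
   because nt_boundary_value is determined only up to null sets. *)
definition hardy_inner ::
    "complex set \<Rightarrow> (complex \<Rightarrow> complex) \<Rightarrow> (complex \<Rightarrow> complex) \<Rightarrow> complex" where
  "hardy_inner \<Omega> f g = (\<Sum>y\<in>Im ` frontier \<Omega>.
     LINT x|lebesgue. cnj (nt_boundary_value \<Omega> f (Complex x y)) *
                      nt_boundary_value \<Omega> g (Complex x y))"

(* Determined on \<Omega> by the reproducing property. *)
definition szego_kernel :: "complex set \<Rightarrow> complex \<Rightarrow> complex \<Rightarrow> complex" where
  "szego_kernel \<Omega> w =
     (SOME Q. Q \<in> hardy_space \<Omega> \<and> (\<forall>f\<in>hardy_space \<Omega>. f w = hardy_inner \<Omega> Q f))"

definition bergman_space :: "complex set \<Rightarrow> (complex \<Rightarrow> complex) set" where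
  "bergman_space \<Omega> =
     {f. f holomorphic_on \<Omega> \<and> set_integrable lborel \<Omega> (\<lambda>z. (norm (f z))\<^sup>2)}"

definition bergman_inner ::
    "complex set \<Rightarrow> (complex \<Rightarrow> complex) \<Rightarrow> (complex \<Rightarrow> complex) \<Rightarrow> complex" where
  "bergman_inner \<Omega> f g = (LINT z:\<Omega>|lborel. cnj (f z) * g z)"

definition bergman_kernel :: "complex set \<Rightarrow> complex \<Rightarrow> complex \<Rightarrow> complex" where
  "bergman_kernel \<Omega> w =
     (SOME Q. Q \<in> bergman_space \<Omega> \<and> (\<forall>f\<in>bergman_space \<Omega>. f w = bergman_inner \<Omega> Q f))"

(* Removable singularities of F are excluded by nicely_meromorphic_on, so F is unique whenever
   \<Omega> is open and nonempty. *)
definition meromorphic_extension ::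
    "complex set \<Rightarrow> (complex \<Rightarrow> complex) \<Rightarrow> (complex \<Rightarrow> complex) \<Rightarrow> bool" where
  "meromorphic_extension \<Omega> f F \<longleftrightarrow> F nicely_meromorphic_on UNIV \<and> (\<forall>z\<in>\<Omega>. F z = f z)"

(* Convergence of a two-sided series of meromorphic functions to G, locally uniformly away from the
   poles of the terms. The series need not converge absolutely, so has_sum is not applicable; the
   two ends of the summation range tend to infinity independently. *)
definition has_meromorphic_sum ::
    "(int \<Rightarrow> complex \<Rightarrow> complex) \<Rightarrow> (complex \<Rightarrow> complex) \<Rightarrow> bool" where
  "has_meromorphic_sum f G \<longleftrightarrow>
     (\<forall>K. compact K \<and> (\<forall>k. \<forall>z\<in>K. \<not> is_pole (f k) z) \<longrightarrow>
        uniform_limit K (\<lambda>(M, N) z. \<Sum>k\<in>{- int M..int N}. f k z) G (at_top \<times>\<^sub>F at_top))"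

end

theory Submission
  imports Defs "HOL-Real_Asymp.Real_Asymp"
begin

text \<open>
  All kernels are explicit, and the two identities are the partial fraction expansions of
  1/sin and 1/sin^2.  Put s = (z - cnj w) / (2 i \<beta>).  The Szego and Bergman kernels of the
  half-plane are i / (2 pi (z - cnj w)) and - 1 / (pi (z - cnj w)^2), and the translation of z
  by 2 k i \<beta> replaces s by s + k; so the sums over k are multiples of
  \<Sum> (-1)^k / (s + k) = pi / sin (pi s) and of \<Sum> 1 / (s + k)^2 = (pi / sin (pi s))^2.
  Both expansions follow from the reflection formula of the Gamma function
  (\<open>uniform_limit_alternating\<close>, \<open>alternating_reflection\<close>, \<open>has_sum_inverse_square_int\<close>).
  On the other hand, exp (pi z / \<beta>) maps the strip conformally onto the half-plane, and the
  transformation rules turn the half-plane kernels into 1 / (4 \<beta> sin (pi s)) and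
  pi / (4 \<beta>^2 sin (pi s)^2).  These are the same functions, and c = 1.

  What has to be proved is that the explicit functions reproduce.  Hermitian symmetry of the inner
  product then identifies them with the kernels chosen in the definitions
  (\<open>reproducing_kernel_unique\<close>).  For Bergman spaces a holomorphic change of variables moves
  the reproducing property to the centre of the disc, where it is the mean value property
  (\<open>bergman_reproducing\<close>).

  For the Hardy space of the half-plane, the Schwarz lemma shows that every conformal map onto the
  disc is a Cayley transform up to rotation.  So each element of the space is a series
  f z = \<Sum> b n (z - p)^n / (z - cnj p)^(n+1) with square summable coefficients
  (\<open>hardy_space_upper_half_plane_series\<close>).  The finite partial sums are rational functions, for
  which the Cauchy and Poisson formulas on the real line are contour integrals, and the summands
  are orthogonal there.  The passage to the limit (\<open>hardy_boundary_values\<close>) cuts the series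
  into blocks d k whose squared norms decay like 16^-k, and studies the single integrable function
  \<Phi> = \<Sum> 4^k |d k|^2 on the real line.  At almost every x the maximal function of \<Phi> is
  finite (\<open>AE_maximal_function_finite\<close>), hence the Poisson integral of \<Phi> is bounded in every
  cone at x (\<open>poisson_integral_le_maximal\<close>), and |d k| is at most a constant times 2^-k there.
  The series of blocks converges uniformly in the cone, which gives the nontangential limit; and
  it is dominated by a multiple of the square root of \<Phi> on the line, which gives Cauchy's
  formula for the boundary values.

  The Hardy space of the strip is carried to that of the half-plane by the exponential map.  This
  map sends the two boundary lines to the two half-lines, cones into cones, and null sets to null
  sets, so the reproducing property in the half-plane yields that in the strip
  (\<open>strip_szego_reproducing\<close>).
\<close>

section \<open>Partial fractions of the reciprocal sine and its square\<close>

text \<open>The logarithmic derivative of the reflection formula.  It is written with the entire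
  function 1 / Gamma, for which the product rule applies directly.\<close>
lemma Digamma_reflection:
  fixes z :: complex
  assumes "z \<notin> \<int>"
  shows "Digamma (1 - z) - Digamma z = of_real pi * cot (of_real pi * z)"
proof -
  have z: "z \<notin> \<int>\<^sub>\<le>\<^sub>0" "1 - z \<notin> \<int>\<^sub>\<le>\<^sub>0"
    using assms nonpos_Ints_Int[of z] nonpos_Ints_Int[of "1 - z"] Ints_diff[of 1 "1 - z"] by auto
  have "((\<lambda>t. rGamma t * rGamma (1 - t)) has_field_derivative
          rGamma z * rGamma (1 - z) * (Digamma (1 - z) - Digamma z)) (at z)"
    using z by (auto intro!: derivative_eq_intros simp: algebra_simps)
  hence "((\<lambda>t. sin (of_real pi * t) / of_real pi) has_field_derivative
          sin (of_real pi * z) / of_real pi * (Digamma (1 - z) - Digamma z)) (at z)"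
    by (simp only: rGamma_reflection_complex)
  moreover have "((\<lambda>t. sin (of_real pi * t) / of_real pi) has_field_derivative cos (of_real pi * z)) (at z)"
    by (auto intro!: derivative_eq_intros)
  ultimately have eq: "sin (of_real pi * z) / of_real pi * (Digamma (1 - z) - Digamma z) = cos (of_real pi * z)"
    by (rule DERIV_unique)
  have "sin (of_real pi * z) \<noteq> 0"
    using assms by (auto simp: sin_eq_0)
  thus ?thesis using eq by (simp add: cot_def field_simps)
qed

lemma Polygamma_1_reflection:
  fixes z :: complex
  assumes "z \<notin> \<int>"
  shows "Polygamma 1 (1 - z) + Polygamma 1 z = (of_real pi)\<^sup>2 / (sin (of_real pi * z))\<^sup>2"
proof -
  have z: "z \<notin> \<int>\<^sub>\<le>\<^sub>0" "1 - z \<notin> \<int>\<^sub>\<le>\<^sub>0"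
    using assms nonpos_Ints_Int[of z] nonpos_Ints_Int[of "1 - z"] Ints_diff[of 1 "1 - z"] by auto
  have s: "sin (of_real pi * z) \<noteq> 0"
    using assms by (auto simp: sin_eq_0)
  have "((\<lambda>t. Digamma (1 - t) - Digamma t) has_field_derivative
          - Polygamma 1 (1 - z) - Polygamma 1 z) (at z)"
    using z by (auto intro!: derivative_eq_intros)
  moreover have "((\<lambda>t. Digamma (1 - t) - Digamma t) has_field_derivative
          - (of_real pi)\<^sup>2 / (sin (of_real pi * z))\<^sup>2) (at z)"
  proof (rule has_field_derivative_transform_within_open)
    have "((\<lambda>t. of_real pi * cot (of_real pi * t)) has_field_derivative
          of_real pi * (- inverse ((sin (of_real pi * z))\<^sup>2) * of_real pi)) (at z)"
      by (intro DERIV_cmult DERIV_chain2[where f = cot] DERIV_cot s) (auto intro!: derivative_eq_intros)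
    thus "((\<lambda>t. of_real pi * cot (of_real pi * t)) has_field_derivative
          - (of_real pi)\<^sup>2 / (sin (of_real pi * z))\<^sup>2) (at z)"
      by (simp add: power2_eq_square divide_inverse mult_ac)
    show "open (- \<int> :: complex set)" by auto
  qed (use assms Digamma_reflection in auto)
  ultimately have "- Polygamma 1 (1 - z) - Polygamma 1 z = - (of_real pi)\<^sup>2 / (sin (of_real pi * z))\<^sup>2"
    by (rule DERIV_unique)
  thus ?thesis by (simp add: algebra_simps)
qed

text \<open>The terms with \<open>k \<ge> 0\<close> form the trigamma series at s, the terms with
  \<open>k < 0\<close> the trigamma series at \<open>1 - s\<close>.\<close>
lemma has_sum_inverse_square_int:
  fixes s :: complex
  assumes "s \<notin> \<int>"
  shows "((\<lambda>k::int. 1 / (s + of_int k)\<^sup>2) has_sum (of_real pi)\<^sup>2 / (sin (of_real pi * s))\<^sup>2) UNIV"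
proof -
  have half: "((\<lambda>n::nat. 1 / (z + of_nat n)\<^sup>2) has_sum Polygamma 1 z) UNIV" if "z \<notin> \<int>" for z :: complex
  proof (rule norm_summable_imp_has_sum)
    have "z \<noteq> 0" using that by auto
    have "summable (\<lambda>n. norm (inverse ((z + of_nat n)^2)))"
    proof (rule summable_comparison_test_bigo)
      show "summable (\<lambda>n::nat. norm (1 / of_nat n ^ 2 :: real))"
        using inverse_power_summable[of 2, where 'a = real] by (simp add: field_simps)
      show "(\<lambda>n. norm (inverse ((z + of_nat n)^2))) \<in> O(\<lambda>n. 1 / of_nat n ^ 2 :: real)"
      proof (rule bigoI[of _ 4])
        have "eventually (\<lambda>n. real n \<ge> 2 * norm z + 1) at_top"
          using eventually_ge_at_top[of "nat \<lceil>2 * norm z + 1\<rceil>"] by eventually_elim linarith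
        thus "\<forall>\<^sub>F n in at_top. norm (norm (inverse ((z + of_nat n)^2))) \<le> 4 * norm (1 / of_nat n ^ 2 :: real)"
        proof eventually_elim
          case (elim n)
          have "norm (z + of_nat n) \<ge> real n / 2"
            using norm_triangle_ineq4[of "z + of_nat n" z] elim by simp
          hence "norm (z + of_nat n)^2 \<ge> (real n / 2)^2" by (intro power_mono) auto
          moreover have "real n > 0" using elim norm_ge_zero[of z] by linarith
          moreover have "norm (z + of_nat n) > 0"
            using \<open>real n > 0\<close> \<open>norm (z + of_nat n) \<ge> real n / 2\<close> by linarith
          ultimately show ?case
            by (simp add: norm_inverse norm_divide norm_power power_divide divide_simps)
        qed
      qed
    qed
    thus "summable (\<lambda>n. norm (1 / (z + of_nat n)\<^sup>2))" by (simp add: inverse_eq_divide)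
    hence "summable (\<lambda>n. 1 / (z + of_nat n)\<^sup>2)" by (rule summable_norm_cancel)
    moreover have "Polygamma 1 z = (\<Sum>n. 1 / (z + of_nat n)\<^sup>2)"
      by (simp add: Polygamma_def inverse_eq_divide numeral_2_eq_2)
    ultimately show "(\<lambda>n. 1 / (z + of_nat n)\<^sup>2) sums Polygamma 1 z" by (simp add: summable_sums)
  qed
  have "1 - s \<notin> \<int>" using assms Ints_diff[of 1 "1 - s"] by auto
  have "((\<lambda>k::int. 1 / (s + of_int k)\<^sup>2) has_sum Polygamma 1 s) (range int)"
    using half[OF assms] by (subst has_sum_reindex) (simp_all add: o_def)
  moreover have "((\<lambda>k::int. 1 / (s + of_int k)\<^sup>2) has_sum Polygamma 1 (1 - s)) (range (\<lambda>n. - int n - 1))"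
  proof (subst has_sum_reindex)
    show "inj (\<lambda>n. - int n - 1)" by (auto simp: inj_def)
    have "(\<lambda>n. 1 / (1 - s + of_nat n)\<^sup>2) = (\<lambda>k. 1 / (s + of_int k)\<^sup>2) \<circ> (\<lambda>n. - int n - 1)"
    proof
      fix n :: nat
      have "(1 - s + of_nat n)\<^sup>2 = (s + of_int (- int n - 1))\<^sup>2" by (simp add: power2_eq_square algebra_simps)
      thus "1 / (1 - s + of_nat n)\<^sup>2 = ((\<lambda>k. 1 / (s + of_int k)\<^sup>2) \<circ> (\<lambda>n. - int n - 1)) n" by simp
    qed
    thus "(((\<lambda>k. 1 / (s + of_int k)\<^sup>2) \<circ> (\<lambda>n. - int n - 1)) has_sum Polygamma 1 (1 - s)) UNIV"
      using half[OF \<open>1 - s \<notin> \<int>\<close>] by simp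
  qed
  ultimately have "((\<lambda>k::int. 1 / (s + of_int k)\<^sup>2) has_sum Polygamma 1 s + Polygamma 1 (1 - s))
      (range int \<union> range (\<lambda>n. - int n - 1))"
    by (rule has_sum_Un_disjoint) auto
  moreover have "range int \<union> range (\<lambda>n. - int n - 1) = UNIV"
  proof -
    have "k \<in> range int \<union> range (\<lambda>n. - int n - 1)" for k
    proof (cases "k \<ge> 0")
      case False
      hence "k = - int (nat (- k - 1)) - 1" by simp
      thus ?thesis by blast
    qed (auto simp: image_iff intro!: exI[of _ "nat k"])
    thus ?thesis by auto
  qed
  ultimately show ?thesis using Polygamma_1_reflection[OF assms] by (simp add: add.commute)
qed

text \<open>Combining the terms 2j and 2j + 1 gives 1 / ((s + 2j) (s + 2j + 1)), so the paired series
  converges uniformly by comparison with 1 / j^2; it is the difference of the digamma series at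
  s / 2 and (s + 1) / 2.  Partial sums with an odd number of terms differ from the paired ones by
  one term that tends to 0.\<close>
lemma uniform_limit_alternating:
  fixes K :: "complex set"
  assumes "bounded K" and nz: "\<And>s n. s \<in> K \<Longrightarrow> s + of_nat n \<noteq> 0"
  shows "uniform_limit K (\<lambda>N s. \<Sum>n<N. (-1)^n / (s + of_nat n))
           (\<lambda>s. (Digamma ((s + 1) / 2) - Digamma (s / 2)) / 2) at_top"
proof -
  obtain B where B: "\<And>s. s \<in> K \<Longrightarrow> norm s \<le> B" "B > 0"
    using assms(1) unfolding bounded_pos by auto
  define A where "A = (\<lambda>N s. \<Sum>n<N. (-1)^n / (s + of_nat n :: complex))"
  define L where "L = (\<lambda>s::complex. (Digamma ((s + 1) / 2) - Digamma (s / 2)) / 2)"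
  define t where "t = (\<lambda>j s. 1 / (s + 2 * of_nat j) - 1 / (s + 2 * of_nat j + 1) :: complex)"
  have nz': "s + 2 * of_nat j \<noteq> 0" "s + 2 * of_nat j + 1 \<noteq> 0" if "s \<in> K" for s j
    using nz[OF that, of "2 * j"] nz[OF that, of "2 * j + 1"] by (auto simp: add_ac)
  have big: "norm (s + of_nat n) \<ge> real n / 2" if "s \<in> K" "real n \<ge> 2 * B" for s n
    using norm_triangle_ineq4[of "s + of_nat n" s] B(1)[OF that(1)] that(2) by simp
  have even: "A (2 * n) s = (\<Sum>j<n. t j s)" for n s
    by (induction n) (auto simp: A_def t_def add_ac)
  have sumL: "(\<Sum>j. t j s) = L s" if "s \<in> K" for s
  proof -
    have 1: "(\<lambda>j. inverse (of_nat (Suc j)) - inverse (z + of_nat j)) sums (Digamma z + euler_mascheroni)"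
      if "z \<noteq> 0" for z :: complex
      using summable_sums[OF summable_Digamma[OF that]] by (simp add: Digamma_def)
    have "s / 2 \<noteq> 0" "(s + 1) / 2 \<noteq> 0" using nz'[OF that, of 0] by (auto simp: add_eq_0_iff)
    from sums_diff[OF 1[OF this(2)] 1[OF this(1)]]
    have "(\<lambda>j. (inverse (s / 2 + of_nat j) - inverse ((s + 1) / 2 + of_nat j)) / 2) sums L s"
      unfolding L_def by (drule_tac sums_divide[where c = 2]) simp
    also have "(\<lambda>j. (inverse (s / 2 + of_nat j) - inverse ((s + 1) / 2 + of_nat j)) / 2) = (\<lambda>j. t j s)"
    proof
      fix j
      have *: "s / 2 + of_nat j = (s + 2 * of_nat j) / 2" "(s + 1) / 2 + of_nat j = (s + 2 * of_nat j + 1) / 2"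
        by (simp_all add: field_simps)
      have "(inverse (x / 2) - inverse (y / 2)) / 2 = 1 / x - 1 / y" for x y :: complex
        by (simp add: diff_divide_distrib inverse_eq_divide)
      thus "(inverse (s / 2 + of_nat j) - inverse ((s + 1) / 2 + of_nat j)) / 2 = t j s"
        unfolding * t_def by blast
    qed
    finally show ?thesis by (simp add: sums_iff)
  qed
  have "uniform_limit K (\<lambda>n s. \<Sum>j<n. t j s) (\<lambda>s. \<Sum>j. t j s) sequentially"
  proof (rule Weierstrass_m_test_ev)
    have "eventually (\<lambda>j. real j \<ge> B + 1) at_top"
      using eventually_ge_at_top[of "nat \<lceil>B + 1\<rceil>"] by eventually_elim linarith
    thus "\<forall>\<^sub>F j in sequentially. \<forall>s\<in>K. norm (t j s) \<le> 1 / real j ^ 2"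
    proof eventually_elim
      case (elim j)
      show ?case
      proof
        fix s assume s: "s \<in> K"
        have "t j s = 1 / ((s + 2 * of_nat j) * (s + 2 * of_nat j + 1))"
          using nz'[OF s, of j] by (simp add: t_def field_simps)
        moreover have "norm (s + 2 * of_nat j) \<ge> real j"
          using big[OF s, of "2 * j"] elim by simp
        moreover have "norm (s + 2 * of_nat j + 1) \<ge> real j"
          using big[OF s, of "2 * j + 1"] elim by (simp add: add_ac)
        ultimately show "norm (t j s) \<le> 1 / real j ^ 2"
          using elim B(2) by (auto simp: norm_divide norm_mult power2_eq_square intro!: divide_left_mono mult_mono mult_pos_pos)
      qed
    qed
    show "summable (\<lambda>n::nat. 1 / real n ^ 2)"
      using inverse_power_summable[of 2, where 'a = real] by (simp add: field_simps)
  qed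
  hence unif: "uniform_limit K (\<lambda>n s. A (2 * n) s) L sequentially"
    unfolding even uniform_limit_iff using sumL by (simp cong: ball_cong)
  have "uniform_limit K A L sequentially"
    unfolding uniform_limit_iff
  proof (intro allI impI)
    fix e :: real assume e: "e > 0"
    from uniform_limitD[OF unif, of "e/2"] e obtain n0 where
      n0: "\<And>n s. n \<ge> n0 \<Longrightarrow> s \<in> K \<Longrightarrow> dist (A (2 * n) s) (L s) < e / 2"
      unfolding eventually_sequentially by auto
    define n1 where "n1 = 2 * n0 + nat \<lceil>2 * B + 4 / e\<rceil> + 2"
    show "\<forall>\<^sub>F N in sequentially. \<forall>s\<in>K. dist (A N s) (L s) < e"
      using eventually_ge_at_top[of n1]
    proof eventually_elim
      case (elim N)
      show ?case
      proof
        fix s assume s: "s \<in> K"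
        define n where "n = N div 2"
        have n: "n \<ge> n0" using elim by (auto simp: n_def n1_def)
        show "dist (A N s) (L s) < e"
        proof (cases "even N")
          case True
          thus ?thesis using n0[OF n s] e by (simp add: n_def)
        next
          case False
          hence N: "N = Suc (2 * n)" by (auto simp: n_def)
          have "dist (A N s) (L s) \<le> dist (A (2 * n) s) (L s) + norm (1 / (s + of_nat (2 * n)))"
          proof -
            have "A N s - L s = (A (2 * n) s - L s) + 1 / (s + of_nat (2 * n))"
              unfolding N A_def by simp
            thus ?thesis unfolding dist_norm by (simp only: norm_triangle_ineq)
          qed
          also have "norm (1 / (s + of_nat (2 * n))) \<le> e / 2"
          proof -
            have r: "real (2 * n) \<ge> 2 * B + 4 / e" 
              using elim N unfolding n1_def by linarith
            have "real (2 * n) / 2 \<ge> 2 / e" using r B(2) by simp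
            hence "norm (s + of_nat (2 * n)) \<ge> 2 / e" using big[OF s, of "2 * n"] r e
              by (smt (verit) divide_pos_pos)
            moreover have "2 / e > 0" using e by simp
            ultimately have "1 / norm (s + of_nat (2 * n)) \<le> 1 / (2 / e)" by (intro frac_le) auto
            thus ?thesis by (simp add: norm_divide)
          qed
          finally show ?thesis using n0[OF n s] by simp
        qed
      qed
    qed
  qed
  thus ?thesis by (simp add: A_def L_def)
qed

text \<open>The reflection formula at \<open>s / 2\<close> and at \<open>(1 - s) / 2\<close> gives cot u + tan u with
  u = pi s / 2, which is 2 / sin (2 u).\<close>
lemma alternating_reflection:
  fixes s :: complex
  assumes "s \<notin> \<int>"
  shows "(Digamma ((s + 1) / 2) - Digamma (s / 2)) / 2 + (Digamma ((1 - s + 1) / 2) - Digamma ((1 - s) / 2)) / 2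
           = of_real pi / sin (of_real pi * s)"
proof -
  have 1: "s / 2 \<notin> \<int>" using assms Ints_mult[of "2" "s / 2"] by auto
  have 2: "(1 - s) / 2 \<notin> \<int>" 
  proof
    assume "(1 - s) / 2 \<in> \<int>"
    hence "1 - 2 * ((1 - s) / 2) \<in> \<int>" by (intro Ints_diff Ints_mult) auto
    thus False using assms by (simp add: field_simps)
  qed
  define u where "u = of_real pi * s / 2"
  have u: "sin u \<noteq> 0" using 1 sin_eq_0[of u] unfolding u_def by (auto simp: field_simps)
  have su: "sin (of_real pi * s) = 2 * sin u * cos u" using sin_double[of u] by (simp add: u_def)
  have u2: "cos u \<noteq> 0" using su assms by (auto simp: sin_eq_0)
  have e1: "1 - s / 2 = (1 - s + 1) / 2" "1 - (1 - s) / 2 = (s + 1) / 2" by (simp_all add: field_simps)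
  have "of_real pi * ((1 - s) / 2) = of_real pi / 2 - u" by (simp add: u_def field_simps)
  hence c: "cot (of_real pi * ((1 - s) / 2)) = sin u / cos u"
    by (simp only: cot_def sin_cos_eq[of u] cos_sin_eq[of u])
  show ?thesis
  proof -
    have "cot (of_real pi * (s / 2)) = cos u / sin u" by (simp add: cot_def u_def)
    hence "(Digamma ((s + 1) / 2) - Digamma (s / 2)) / 2 + (Digamma ((1 - s + 1) / 2) - Digamma ((1 - s) / 2)) / 2
             = of_real pi / 2 * (cos u / sin u + sin u / cos u)"
      using Digamma_reflection[OF 1] Digamma_reflection[OF 2] unfolding e1 c
      by (simp add: algebra_simps diff_divide_distrib add_divide_distrib)
    also have "cos u / sin u + sin u / cos u = ((sin u)\<^sup>2 + (cos u)\<^sup>2) / (sin u * cos u)"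
      using u u2 by (simp add: field_simps power2_eq_square)
    also have "of_real pi / 2 * \<dots> = of_real pi / sin (of_real pi * s)"
      by (simp only: sin_cos_squared_add su) (simp add: field_simps)
    finally show ?thesis .
  qed
qed

section \<open>Area integrals under holomorphic maps\<close>

text \<open>Area integrals over the complex plane are transported to \<open>real^2\<close>, where the Jacobian of a
  holomorphic map is the determinant of an explicit 2 x 2 matrix.\<close>
definition of_vec2 :: "real^2 \<Rightarrow> complex" where
  "of_vec2 v = Complex (v $ 1) (v $ 2)"

definition to_vec2 :: "complex \<Rightarrow> real^2" where
  "to_vec2 z = (\<chi> i. if i = 1 then Re z else Im z)"

lemma of_vec2_to_vec2 [simp]: "of_vec2 (to_vec2 z) = z"
  by (simp add: of_vec2_def to_vec2_def)

lemma to_vec2_of_vec2 [simp]: "to_vec2 (of_vec2 v) = v"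
  by (simp add: of_vec2_def to_vec2_def vec_eq_iff forall_2)

lemma to_vec2_mult: "to_vec2 (of_real c * z) = c *\<^sub>R to_vec2 z"
  by (simp add: to_vec2_def vec_eq_iff)

lemma bounded_linear_of_vec2: "bounded_linear of_vec2"
  by (intro linear_conv_bounded_linear[THEN iffD1] linearI) (auto simp: of_vec2_def complex_eq_iff)

lemma bounded_linear_to_vec2: "bounded_linear to_vec2"
  by (intro linear_conv_bounded_linear[THEN iffD1] linearI) (auto simp: to_vec2_def vec_eq_iff)

lemma measurable_of_vec2 [measurable]: "of_vec2 \<in> borel \<rightarrow>\<^sub>M borel"
  by (intro borel_measurable_continuous_onI linear_continuous_on bounded_linear_of_vec2)

lemma distr_of_vec2: "distr lborel borel of_vec2 = lborel"
proof (rule lborel_eqI[symmetric])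
  fix l u :: complex
  assume le: "\<And>b. b \<in> Basis \<Longrightarrow> l \<bullet> b \<le> u \<bullet> b"
  have B: "(Basis :: (real^2) set) = {axis 1 1, axis 2 1}"
    by (auto simp: Basis_vec_def UNIV_2)
  have ne: "axis 1 1 \<noteq> (axis 2 1 :: real^2)" by (simp add: axis_eq_axis)
  have le': "Re l \<le> Re u" "Im l \<le> Im u" using le[of 1] le[of \<i>] by (simp_all add: Basis_complex_def)
  have "of_vec2 -` box l u = box (to_vec2 l) (to_vec2 u)"
    by (auto simp: box_def B Basis_complex_def of_vec2_def to_vec2_def inner_axis)
  hence "emeasure (distr lborel borel of_vec2) (box l u) = emeasure lborel (box (to_vec2 l) (to_vec2 u))"
    by (simp add: emeasure_distr)
  also have "\<dots> = ennreal (prod ((\<bullet>) (to_vec2 u - to_vec2 l)) Basis)"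
    using le' by (intro emeasure_lborel_box) (auto simp: B inner_axis to_vec2_def)
  also have "prod ((\<bullet>) (to_vec2 u - to_vec2 l)) Basis = prod ((\<bullet>) (u - l)) Basis"
    using ne by (simp add: B Basis_complex_def inner_axis to_vec2_def)
  finally show "emeasure (distr lborel borel of_vec2) (box l u) = ennreal (prod ((\<bullet>) (u - l)) Basis)"
    by simp
qed simp

lemma set_integral_vec2:
  fixes f :: "complex \<Rightarrow> complex"
  assumes "open S" "continuous_on S f"
  defines "T \<equiv> of_vec2 -` S"
  shows "set_integrable lborel S f \<longleftrightarrow> (to_vec2 \<circ> f \<circ> of_vec2) absolutely_integrable_on T"
    and "set_integrable lborel S f \<Longrightarrow>
           to_vec2 (LINT z:S|lborel. f z) = integral T (to_vec2 \<circ> f \<circ> of_vec2)"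
proof -
  have meas [measurable]: "(\<lambda>z. indicator S z *\<^sub>R f z) \<in> borel_measurable borel"
    using assms by (intro borel_measurable_continuous_on_indicator) auto
  have meas2: "(\<lambda>v. indicator T v *\<^sub>R f (of_vec2 v)) \<in> borel_measurable borel"
    using measurable_compose[OF measurable_of_vec2 meas] by (simp add: T_def indicator_def)
  have T: "(\<lambda>v. indicator T v *\<^sub>R f (of_vec2 v)) = (\<lambda>v. indicator S (of_vec2 v) *\<^sub>R f (of_vec2 v))"
    by (auto simp: T_def indicator_def)
  have "set_integrable lborel S f \<longleftrightarrow> integrable (distr lborel borel of_vec2) (\<lambda>z. indicator S z *\<^sub>R f z)"
    by (simp add: set_integrable_def distr_of_vec2)
  also have "\<dots> \<longleftrightarrow> integrable lborel (\<lambda>v. indicator T v *\<^sub>R f (of_vec2 v))"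
    unfolding T by (subst integrable_distr_eq) auto
  also have "\<dots> \<longleftrightarrow> (f \<circ> of_vec2) absolutely_integrable_on T"
    unfolding set_integrable_def by (subst integrable_completion) (use meas2 in auto)
  finally have 1: "set_integrable lborel S f \<longleftrightarrow> (f \<circ> of_vec2) absolutely_integrable_on T" .
  have 2: "\<dots> \<longleftrightarrow> (to_vec2 \<circ> f \<circ> of_vec2) absolutely_integrable_on T"
    using absolutely_integrable_linear[OF _ bounded_linear_to_vec2, of T "f \<circ> of_vec2"]
      absolutely_integrable_linear[OF _ bounded_linear_of_vec2, of T "to_vec2 \<circ> f \<circ> of_vec2"]
    by (auto simp: o_def)
  show "set_integrable lborel S f \<longleftrightarrow> (to_vec2 \<circ> f \<circ> of_vec2) absolutely_integrable_on T"
    using 1 2 by simp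
  assume "set_integrable lborel S f"
  hence i: "(f \<circ> of_vec2) absolutely_integrable_on T" using 1 by simp
  have "(LINT z:S|lborel. f z) = integral\<^sup>L (distr lborel borel of_vec2) (\<lambda>z. indicator S z *\<^sub>R f z)"
    by (simp add: set_lebesgue_integral_def distr_of_vec2)
  also have "\<dots> = integral\<^sup>L lborel (\<lambda>v. indicator T v *\<^sub>R f (of_vec2 v))"
    unfolding T by (subst integral_distr) auto
  also have "\<dots> = (LINT v:T|lebesgue. (f \<circ> of_vec2) v)"
    unfolding set_lebesgue_integral_def by (subst integral_completion) (use meas2 in auto)
  also have "\<dots> = integral T (f \<circ> of_vec2)"
    by (rule set_lebesgue_integral_eq_integral[OF i])
  finally show "to_vec2 (LINT z:S|lborel. f z) = integral T (to_vec2 \<circ> f \<circ> of_vec2)"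
    using integral_linear[OF set_lebesgue_integral_eq_integral(1)[OF i] bounded_linear_to_vec2]
    by (simp add: o_assoc)
qed

text \<open>By the Cauchy-Riemann equations the real Jacobian of a holomorphic map is the squared modulus
  of its derivative.\<close>
lemma holomorphic_change_of_variables:
  fixes f g :: "complex \<Rightarrow> complex"
  assumes S: "open S" and g: "g holomorphic_on S" "inj_on g S" and f: "continuous_on (g ` S) f"
  defines "h \<equiv> \<lambda>z. of_real ((norm (deriv g z))\<^sup>2) * f (g z)"
  shows "set_integrable lborel (g ` S) f \<longleftrightarrow> set_integrable lborel S h"
    and "set_integrable lborel S h \<Longrightarrow> (LINT w:g ` S|lborel. f w) = (LINT z:S|lborel. h z)"
proof -
  define T where "T = of_vec2 -` S"
  define G where "G = to_vec2 \<circ> g \<circ> of_vec2"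
  define G' where "G' = (\<lambda>v. to_vec2 \<circ> (\<lambda>t. deriv g (of_vec2 v) * t) \<circ> of_vec2)"
  have T: "open T" unfolding T_def
    by (intro open_vimage S linear_continuous_on bounded_linear_of_vec2)
  have "inj of_vec2" by (metis injI to_vec2_of_vec2)
  have oi: "open (g ` S)" using open_mapping_thm3 assms by blast
  have h: "continuous_on S h" unfolding h_def
    by (intro continuous_intros continuous_on_compose2[OF f] holomorphic_on_imp_continuous_on holomorphic_deriv g S) auto
  have img: "G ` T = of_vec2 -` (g ` S)"
  proof -
    have "v \<in> G ` T" if "of_vec2 v \<in> g ` S" for v
    proof -
      from that obtain z where "z \<in> S" "of_vec2 v = g z" by auto
      hence "v = G (to_vec2 z)" "to_vec2 z \<in> T"
        by (auto simp: G_def T_def) (metis to_vec2_of_vec2)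
      thus ?thesis by blast
    qed
    thus ?thesis by (auto simp: G_def T_def)
  qed
  have der: "(G has_derivative G' v) (at v within T)" if "v \<in> T" for v
  proof -
    have "(g has_derivative (\<lambda>t. deriv g (of_vec2 v) * t)) (at (of_vec2 v))"
      using that holomorphic_derivI[OF g(1) S] by (auto simp: T_def has_field_derivative_def)
    thus ?thesis unfolding G_def G'_def comp_assoc
      by (intro diff_chain_within has_derivative_at_withinI[OF bounded_linear_imp_has_derivative]
           bounded_linear_of_vec2 bounded_linear_to_vec2) (auto intro: has_derivative_at_withinI)
  qed
  have det: "det (matrix (G' v)) = (norm (deriv g (of_vec2 v)))\<^sup>2" for v
    unfolding cmod_power2
    by (simp add: det_2 matrix_def G'_def to_vec2_def of_vec2_def axis_def power2_eq_square)
  have inj: "inj_on G T"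
    using g(2) \<open>inj of_vec2\<close> unfolding inj_on_def G_def T_def
    by (auto, metis of_vec2_to_vec2)
  have cov: "(\<lambda>x. \<bar>det (matrix (G' x))\<bar> *\<^sub>R (to_vec2 \<circ> f \<circ> of_vec2) (G x)) absolutely_integrable_on T \<and>
           integral T (\<lambda>x. \<bar>det (matrix (G' x))\<bar> *\<^sub>R (to_vec2 \<circ> f \<circ> of_vec2) (G x)) = b
     \<longleftrightarrow> (to_vec2 \<circ> f \<circ> of_vec2) absolutely_integrable_on (G ` T) \<and>
         integral (G ` T) (to_vec2 \<circ> f \<circ> of_vec2) = b" for b
    by (rule has_absolute_integral_change_of_variables) (use T der inj in auto)
  have "(\<lambda>x. \<bar>det (matrix (G' x))\<bar> *\<^sub>R (to_vec2 \<circ> f \<circ> of_vec2) (G x)) = to_vec2 \<circ> h \<circ> of_vec2"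
    unfolding det
    by (simp add: h_def G_def fun_eq_iff to_vec2_mult del: of_real_power)
  note cov = cov[unfolded this img]
  show iff: "set_integrable lborel (g ` S) f \<longleftrightarrow> set_integrable lborel S h"
    using cov set_integral_vec2(1)[OF S h] set_integral_vec2(1)[OF oi f] by (auto simp: T_def)
  assume hi: "set_integrable lborel S h"
  hence fi: "set_integrable lborel (g ` S) f" using iff by simp
  have "to_vec2 (LINT w:g ` S|lborel. f w) = to_vec2 (LINT z:S|lborel. h z)"
    using cov set_integral_vec2[OF S h] set_integral_vec2[OF oi f] hi fi by (auto simp: T_def)
  thus "(LINT w:g ` S|lborel. f w) = (LINT z:S|lborel. h z)"
    by (metis of_vec2_to_vec2)
qed

lemma set_integrable_ball_continuous:
  fixes f :: "complex \<Rightarrow> complex"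
  assumes "continuous_on (cball 0 r) f"
  shows "set_integrable lborel (ball 0 r) f"
proof -
  have "set_integrable lborel (cball 0 r) f"
    unfolding set_integrable_def by (rule borel_integrable_compact) (use assms in auto)
  thus ?thesis by (rule set_integrable_subset) auto
qed

text \<open>Rotation by the angle pi / j preserves the disc and changes the sign of \<open>z ^ j\<close>.\<close>
lemma integral_ball_power:
  assumes "j > 0"
  shows "(LINT z:ball 0 r|lborel. z ^ j) = (0::complex)"
proof -
  \<comment> \<open>This choice makes \<open>c ^ j = -1\<close>.\<close>
  define c where "c = cis (pi / j)"
  have c: "norm c = 1" "c ^ j = -1" "c \<noteq> 0" using assms by (simp_all add: c_def Complex.DeMoivre)
  define g where "g = (\<lambda>z. c * z)"
  have img: "g ` ball 0 r = ball 0 r"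
  proof -
    have "z \<in> g ` ball 0 r" if "norm z < r" for z
      using that c by (intro image_eqI[of _ _ "z / c"]) (auto simp: g_def norm_divide)
    thus ?thesis using c by (auto simp: g_def norm_mult)
  qed
  have d: "deriv g z = c" for z unfolding g_def by (intro DERIV_imp_deriv) (auto intro!: derivative_eq_intros)
  have "(LINT z:g ` ball 0 r|lborel. z ^ j) = (LINT z:ball 0 r|lborel. of_real ((norm (deriv g z))\<^sup>2) * (g z) ^ j)"
  proof (rule holomorphic_change_of_variables(2))
    show "set_integrable lborel (ball 0 r) (\<lambda>z. of_real ((norm (deriv g z))\<^sup>2) * g z ^ j)"
      unfolding d unfolding g_def by (intro set_integrable_ball_continuous continuous_intros)
  qed (use c in \<open>auto simp: g_def inj_on_def intro!: holomorphic_intros continuous_intros\<close>)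
  also have "\<dots> = - (LINT z:ball 0 r|lborel. z ^ j)"
    unfolding d using c by (simp add: g_def power_mult_distrib set_lebesgue_integral_def)
  finally show ?thesis unfolding img by simp
qed

lemma area_ball: "r \<ge> 0 \<Longrightarrow> measure lborel (ball (0::complex) r) = pi * r\<^sup>2"
  using content_ball[of r "0::complex"] by (simp add: unit_ball_vol_2)

text \<open>Inside the unit disc the power series is dominated by a constant, so it can be integrated term
  by term, and only the constant term contributes.\<close>
lemma mean_value_small_ball:
  assumes F: "F holomorphic_on ball 0 1" and r: "0 < r" "r < 1"
  shows "(LINT z:ball 0 r|lborel. F z) = of_real (pi * r\<^sup>2) * F 0"
proof -
  define a where "a = (\<lambda>n. (deriv ^^ n) F 0 / fact n)"
  have sums: "(\<lambda>n. a n * z ^ n) sums F z" if "norm z < 1" for z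
    using holomorphic_power_series[OF F, of z] that by (simp add: a_def)
  obtain r' where r': "r < r'" "r' < 1" using r dense by blast
  have "summable (\<lambda>n. norm (a n * of_real r ^ n))"
    by (rule powser_insidea[OF sums_summable[OF sums[of "of_real r'"]]]) (use r r' in auto)
  hence sm: "summable (\<lambda>n. norm (a n) * r ^ n)" using r by (simp add: norm_mult norm_power)
  have "(\<lambda>N. LINT z:ball 0 r|lborel. (\<Sum>n<N. a n * z ^ n)) \<longlonglongrightarrow> (LINT z:ball 0 r|lborel. F z)"
    unfolding set_lebesgue_integral_def
  proof (rule integral_dominated_convergence)
    show "integrable lborel (\<lambda>z. indicator (ball (0::complex) r) z *\<^sub>R (\<Sum>n. norm (a n) * r ^ n))"
      by (intro integrable_scaleR_left integrable_real_indicator) (use emeasure_lborel_ball_finite[of "0::complex" r] in auto)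
    show "AE z in lborel. (\<lambda>N. indicator (ball 0 r) z *\<^sub>R (\<Sum>n<N. a n * z ^ n)) \<longlonglongrightarrow> indicator (ball 0 r) z *\<^sub>R F z"
    proof (intro AE_I2)
      fix z :: complex
      show "(\<lambda>N. indicator (ball 0 r) z *\<^sub>R (\<Sum>n<N. a n * z ^ n)) \<longlonglongrightarrow> indicator (ball 0 r) z *\<^sub>R F z"
        using sums[of z] r by (cases "norm z < r") (auto simp: sums_def)
    qed
    show "AE z in lborel. norm (indicator (ball 0 r) z *\<^sub>R (\<Sum>n<N. a n * z ^ n))
             \<le> indicator (ball 0 r) z *\<^sub>R (\<Sum>n. norm (a n) * r ^ n)" for N
    proof (intro AE_I2)
      fix z :: complex
      have "norm (\<Sum>n<N. a n * z ^ n) \<le> (\<Sum>n. norm (a n) * r ^ n)" if "norm z < r"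
      proof -
        have "norm (\<Sum>n<N. a n * z ^ n) \<le> (\<Sum>n<N. norm (a n) * r ^ n)"
          using that by (intro sum_norm_le) (auto simp: norm_mult norm_power intro!: mult_left_mono power_mono)
        also have "\<dots> \<le> (\<Sum>n. norm (a n) * r ^ n)" using r by (intro sum_le_suminf sm) auto
        finally show ?thesis .
      qed
      thus "norm (indicator (ball 0 r) z *\<^sub>R (\<Sum>n<N. a n * z ^ n)) \<le> indicator (ball 0 r) z *\<^sub>R (\<Sum>n. norm (a n) * r ^ n)"
        by (auto simp: indicator_def)
    qed
    have "continuous_on (ball 0 r) F"
      using holomorphic_on_imp_continuous_on[OF F] r by (rule_tac continuous_on_subset) auto
    thus "(\<lambda>z. indicator (ball 0 r) z *\<^sub>R F z) \<in> borel_measurable lborel"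
      by (simp add: borel_measurable_continuous_on_indicator)
    show "(\<lambda>z. indicator (ball 0 r) z *\<^sub>R (\<Sum>n<N. a n * z ^ n)) \<in> borel_measurable lborel" for N
      by (simp, intro borel_measurable_continuous_on_indicator continuous_intros) auto
  qed
  moreover have "(LINT z:ball 0 r|lborel. (\<Sum>n<N. a n * z ^ n)) = (if N = 0 then 0 else of_real (pi * r\<^sup>2) * F 0)" for N
  proof -
    have "(LINT z:ball 0 r|lborel. (\<Sum>n<N. a n * z ^ n)) = (\<Sum>n<N. LINT z:ball 0 r|lborel. a n * z ^ n)"
      unfolding set_lebesgue_integral_def scaleR_sum_right
      by (rule Bochner_Integration.integral_sum)
        (auto intro!: set_integrable_ball_continuous[unfolded set_integrable_def] continuous_intros)
    also have "\<dots> = (\<Sum>n<N. if n = 0 then of_real (pi * r\<^sup>2) * F 0 else 0)"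
    proof (intro sum.cong refl)
      fix n
      show "(LINT z:ball 0 r|lborel. a n * z ^ n) = (if n = 0 then of_real (pi * r\<^sup>2) * F 0 else 0)"
      proof (cases "n = 0")
        case True
        have "(LINT z:ball (0::complex) r|lborel. a 0) = measure lborel (ball (0::complex) r) *\<^sub>R a 0"
          using emeasure_lborel_ball_finite[of "0::complex" r]
          by (simp add: set_lebesgue_integral_def)
        thus ?thesis using True r by (simp add: area_ball a_def scaleR_conv_of_real)
      qed (use integral_ball_power[of n r] in simp)
    qed
    finally show ?thesis by (cases N) (auto simp: sum.If_cases)
  qed
  hence "(\<lambda>N. LINT z:ball 0 r|lborel. (\<Sum>n<N. a n * z ^ n)) \<longlonglongrightarrow> of_real (pi * r\<^sup>2) * F 0"
    by (intro tendsto_eventually eventually_sequentiallyI[of 1]) auto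
  ultimately show ?thesis by (rule LIMSEQ_unique)
qed

lemma mean_value_unit_disc:
  assumes F: "F holomorphic_on ball 0 1" and int: "set_integrable lborel (ball 0 1) F"
  shows "(LINT z:ball 0 1|lborel. F z) = of_real pi * F 0"
proof -
  define r where "r = (\<lambda>n::nat. 1 - 1 / (real n + 2))"
  have r: "0 < r n" "r n < 1" for n by (auto simp: r_def field_simps)
  have rl: "r \<longlonglongrightarrow> 1" unfolding r_def by real_asymp
  have "(\<lambda>n. LINT z:ball 0 (r n)|lborel. F z) \<longlonglongrightarrow> (LINT z:ball 0 1|lborel. F z)"
    unfolding set_lebesgue_integral_def
  proof (rule integral_dominated_convergence)
    show "integrable lborel (\<lambda>z. norm (indicator (ball 0 1) z *\<^sub>R F z))"
      using int unfolding set_integrable_def by (rule integrable_norm)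
    show "(\<lambda>z. indicator (ball 0 1) z *\<^sub>R F z) \<in> borel_measurable lborel"
      using int unfolding set_integrable_def by (rule borel_measurable_integrable)
    show "(\<lambda>z. indicator (ball 0 (r n)) z *\<^sub>R F z) \<in> borel_measurable lborel" for n
      using holomorphic_on_imp_continuous_on[OF F] r[of n]
      by (simp, intro borel_measurable_continuous_on_indicator) (auto intro: continuous_on_subset)
    show "AE z in lborel. (\<lambda>n. indicator (ball 0 (r n)) z *\<^sub>R F z) \<longlonglongrightarrow> indicator (ball 0 1) z *\<^sub>R F z"
    proof (intro AE_I2)
      fix z :: complex
      show "(\<lambda>n. indicator (ball 0 (r n)) z *\<^sub>R F z) \<longlonglongrightarrow> indicator (ball 0 1) z *\<^sub>R F z"
      proof (cases "norm z < 1")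
        case True
        hence "eventually (\<lambda>n. norm z < r n) sequentially" using rl by (rule order_tendstoD(1)[rotated])
        hence "eventually (\<lambda>n. indicator (ball 0 (r n)) z *\<^sub>R F z = indicator (ball 0 1) z *\<^sub>R F z) sequentially"
          by eventually_elim (use True in \<open>auto simp: indicator_def\<close>)
        thus ?thesis by (rule tendsto_eventually)
      next
        case False
        hence "\<not> norm z < r n" for n using r[of n] by linarith
        thus ?thesis using False by (auto simp: indicator_def)
      qed
    qed
    show "AE z in lborel. norm (indicator (ball 0 (r n)) z *\<^sub>R F z) \<le> norm (indicator (ball 0 1) z *\<^sub>R F z)" for n
      using r[of n] by (intro AE_I2) (auto simp: indicator_def)
  qed
  moreover have "(\<lambda>n. LINT z:ball 0 (r n)|lborel. F z) \<longlonglongrightarrow> of_real (pi * 1\<^sup>2) * F 0"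
    unfolding mean_value_small_ball[OF F r] by (intro tendsto_intros rl)
  ultimately show ?thesis using LIMSEQ_unique by fastforce
qed

section \<open>Conformal maps of the half-plane and the strip\<close>

lemma biholomorphic_mapI:
  assumes "f holomorphic_on A" "g holomorphic_on B"
    "\<And>z. z \<in> A \<Longrightarrow> f z \<in> B" "\<And>z. z \<in> B \<Longrightarrow> g z \<in> A"
    "\<And>z. z \<in> A \<Longrightarrow> g (f z) = z" "\<And>z. z \<in> B \<Longrightarrow> f (g z) = z"
  shows "biholomorphic_map f A B"
proof -
  have bij: "bij_betw f A B"
    using assms(3-6) by (intro bij_betwI[where g = g]) auto
  have "inv_into A f z = g z" if "z \<in> B" for z
    using that assms(4,6) bij by (intro inv_into_f_eq) (auto simp: bij_betw_def)
  hence "inv_into A f holomorphic_on B"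
    using assms(2) holomorphic_cong by blast
  thus ?thesis using assms(1) bij by (simp add: biholomorphic_map_def)
qed

lemma biholomorphic_map_inverse:
  assumes "biholomorphic_map f A B"
  shows "z \<in> A \<Longrightarrow> f z \<in> B" "z \<in> A \<Longrightarrow> inv_into A f (f z) = z"
    "u \<in> B \<Longrightarrow> inv_into A f u \<in> A" "u \<in> B \<Longrightarrow> f (inv_into A f u) = u"
  using assms unfolding biholomorphic_map_def bij_betw_def
  by (auto intro: inv_into_into f_inv_into_f)

lemma biholomorphic_map_comp:
  assumes "biholomorphic_map f A B" "biholomorphic_map g B C"
  shows "biholomorphic_map (\<lambda>z. g (f z)) A C"
proof (rule biholomorphic_mapI)
  note * = biholomorphic_map_inverse[OF assms(1)] biholomorphic_map_inverse[OF assms(2)]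
  show "(\<lambda>z. g (f z)) holomorphic_on A"
    using assms * holomorphic_on_compose_gen[of f A g B] by (auto simp: o_def biholomorphic_map_def)
  show "(\<lambda>u. inv_into A f (inv_into B g u)) holomorphic_on C"
    using assms * holomorphic_on_compose_gen[of "inv_into B g" C "inv_into A f" B]
    by (auto simp: o_def biholomorphic_map_def image_subset_iff)
qed (use biholomorphic_map_inverse[OF assms(1)] biholomorphic_map_inverse[OF assms(2)] in auto)

lemma biholomorphic_map_inv:
  assumes "biholomorphic_map f A B"
  shows "biholomorphic_map (inv_into A f) B A"
  using biholomorphic_map_inverse[OF assms] assms
  by (intro biholomorphic_mapI[where g = f]) (auto simp: biholomorphic_map_def)

lemma deriv_inv_into:
  assumes f: "biholomorphic_map f A B" and "open A" "open B" "u \<in> B"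
  shows "deriv f (inv_into A f u) * deriv (inv_into A f) u = 1"
proof -
  note inv = biholomorphic_map_inverse[OF f]
  have hol: "f holomorphic_on A" "inv_into A f holomorphic_on B"
    using f by (auto simp: biholomorphic_map_def)
  have "((\<lambda>u. f (inv_into A f u)) has_field_derivative deriv f (inv_into A f u) * deriv (inv_into A f) u) (at u)"
    by (rule DERIV_chain2[OF holomorphic_derivI[OF hol(1)] holomorphic_derivI[OF hol(2)]]) (use assms inv in auto)
  moreover have "((\<lambda>u. f (inv_into A f u)) has_field_derivative 1) (at u)"
    by (rule has_field_derivative_transform_within_open[OF DERIV_ident]) (use assms inv in auto)
  ultimately show ?thesis by (rule DERIV_unique)
qed

lemma open_upper_half_plane: "open upper_half_plane"
  unfolding upper_half_plane_def by (rule open_halfspace_Im_gt)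

lemma connected_upper_half_plane: "connected upper_half_plane"
  unfolding upper_half_plane_def by (intro convex_connected convex_halfspace_Im_gt)

lemma open_strip: "open (strip \<beta>)"
proof -
  have "strip \<beta> = {z. 0 < Im z} \<inter> {z. Im z < \<beta>}" by (auto simp: strip_def)
  thus ?thesis by (simp add: open_Int open_halfspace_Im_gt open_halfspace_Im_lt)
qed

lemma strip_subset_upper_half_plane: "w \<in> strip \<beta> \<Longrightarrow> w \<in> upper_half_plane"
  by (simp add: strip_def upper_half_plane_def)

lemma norm_minus_cnj_power2: "(norm (z - cnj w))\<^sup>2 = (norm (z - w))\<^sup>2 + 4 * (Im z * Im w)"
  unfolding cmod_power2 by (simp add: power2_eq_square algebra_simps)

text \<open>The real axis is the perpendicular bisector of w and its mirror image; this is why the Cayley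
  transform maps the half-plane into the disc.\<close>
lemma norm_less_norm_cnj_iff:
  assumes "Im w > 0"
  shows "norm (z - w) < norm (z - cnj w) \<longleftrightarrow> Im z > 0"
proof -
  have "norm (z - w) < norm (z - cnj w) \<longleftrightarrow> (norm (z - w))\<^sup>2 < (norm (z - cnj w))\<^sup>2"
    using power_strict_mono[of "norm (z - w)" "norm (z - cnj w)" 2]
      power_less_imp_less_base[of "norm (z - w)" 2 "norm (z - cnj w)"] by auto
  thus ?thesis using assms by (simp add: norm_minus_cnj_power2 zero_less_mult_iff)
qed

lemma norm_minus_le_norm_minus_cnj:
  assumes "Im p > 0" "Im z \<ge> 0"
  shows "norm (z - p) \<le> norm (z - cnj p)"
proof -
  have "(norm (z - p))\<^sup>2 \<le> (norm (z - cnj p))\<^sup>2"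
    using assms by (simp add: norm_minus_cnj_power2)
  thus ?thesis by (rule power2_le_imp_le) simp
qed

lemma Im_le_norm_minus_cnj: "Im p > 0 \<Longrightarrow> Im z \<ge> 0 \<Longrightarrow> Im p \<le> norm (z - cnj p)"
  using abs_Im_le_cmod[of "z - cnj p"] by simp

lemma biholomorphic_cayley:
  assumes w: "w \<in> upper_half_plane"
  shows "biholomorphic_map (\<lambda>z. (z - w) / (z - cnj w)) upper_half_plane (ball 0 1)"
proof (rule biholomorphic_mapI)
  have Im: "Im w > 0" using w by (simp add: upper_half_plane_def)
  have ne: "z - cnj w \<noteq> 0" if "z \<in> upper_half_plane" for z
    using that Im by (auto simp: upper_half_plane_def complex_eq_iff)
  have ww: "w - cnj w \<noteq> 0" using Im by (auto simp: complex_eq_iff)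
  show "(\<lambda>z. (z - w) / (z - cnj w)) holomorphic_on upper_half_plane"
    using ne by (intro holomorphic_intros) auto
  have n1: "1 - u \<noteq> 0" if "u \<in> ball (0::complex) 1" for u using that by auto
  show "(\<lambda>u. (w - cnj w * u) / (1 - u)) holomorphic_on ball 0 1"
    using n1 by (intro holomorphic_intros) auto
  show "(z - w) / (z - cnj w) \<in> ball 0 1" if "z \<in> upper_half_plane" for z
    using that ne[OF that] norm_less_norm_cnj_iff[OF Im, of z] by (simp add: norm_divide upper_half_plane_def)
  have *: "((w - cnj w * u) / (1 - u) - w) / ((w - cnj w * u) / (1 - u) - cnj w) = u"
    "(w - cnj w * u) / (1 - u) - cnj w = (w - cnj w) / (1 - u)" if "u \<in> ball 0 1" for u
  proof -
    have 1: "(w - cnj w * u) / (1 - u) - w = u * (w - cnj w) / (1 - u)"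
      using n1[OF that] by (simp add: field_simps)
    show 2: "(w - cnj w * u) / (1 - u) - cnj w = (w - cnj w) / (1 - u)"
      using n1[OF that] by (simp add: field_simps)
    show "((w - cnj w * u) / (1 - u) - w) / ((w - cnj w * u) / (1 - u) - cnj w) = u"
      unfolding 1 2 using n1[OF that] ww by simp
  qed
  show "((w - cnj w * u) / (1 - u) - w) / ((w - cnj w * u) / (1 - u) - cnj w) = u" if "u \<in> ball 0 1" for u
    by (rule *[OF that])
  show "(w - cnj w * u) / (1 - u) \<in> upper_half_plane" if "u \<in> ball 0 1" for u
  proof -
    define z where "z = (w - cnj w * u) / (1 - u)"
    have "z - cnj w \<noteq> 0" using *(2)[OF that] ww n1[OF that] by (simp add: z_def)
    moreover have "norm ((z - w) / (z - cnj w)) < 1" using *(1)[OF that] that by (simp add: z_def)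
    ultimately have "norm (z - w) < norm (z - cnj w)" by (simp add: norm_divide)
    thus ?thesis using norm_less_norm_cnj_iff[OF Im, of z] by (simp add: z_def upper_half_plane_def)
  qed
  show "(w - cnj w * ((z - w) / (z - cnj w))) / (1 - (z - w) / (z - cnj w)) = z" if "z \<in> upper_half_plane" for z
  proof -
    have "1 - (z - w) / (z - cnj w) = (w - cnj w) / (z - cnj w)"
      using ne[OF that] by (simp add: field_simps)
    moreover have "w - cnj w * ((z - w) / (z - cnj w)) = z * (w - cnj w) / (z - cnj w)"
      using ne[OF that] by (simp add: field_simps)
    ultimately show ?thesis using ne[OF that] ww by simp
  qed
qed

lemma deriv_cayley:
  assumes "w \<in> upper_half_plane" "z \<in> upper_half_plane"
  shows "deriv (\<lambda>z. (z - w) / (z - cnj w)) z = (w - cnj w) / (z - cnj w)\<^sup>2"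
proof -
  have "z - cnj w \<noteq> 0" using assms by (auto simp: upper_half_plane_def complex_eq_iff)
  thus ?thesis
    by (intro DERIV_imp_deriv) (auto intro!: derivative_eq_intros simp: power2_eq_square)
qed

text \<open>Compared with the Cayley transform centred at its zero, the map becomes an automorphism of the
  disc that fixes 0.  The Schwarz lemma for this automorphism and for its inverse forces equality,
  so it is a rotation.\<close>
lemma biholomorphic_map_upper_half_plane:
  assumes "biholomorphic_map \<psi> upper_half_plane (ball 0 1)"
  obtains p \<alpha> where "p \<in> upper_half_plane" "norm \<alpha> = 1"
    "\<And>z. z \<in> upper_half_plane \<Longrightarrow> \<psi> z = \<alpha> * ((z - p) / (z - cnj p))"
proof -
  define \<phi> where "\<phi> = inv_into upper_half_plane \<psi>"
  define p where "p = \<phi> 0"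
  note i1 = biholomorphic_map_inverse[OF assms, folded \<phi>_def]
  have p: "p \<in> upper_half_plane" "\<psi> p = 0" using i1 by (auto simp: p_def)
  define c where "c = (\<lambda>z. (z - p) / (z - cnj p))"
  define c' where "c' = inv_into upper_half_plane c"
  have bc: "biholomorphic_map c upper_half_plane (ball 0 1)"
    unfolding c_def by (rule biholomorphic_cayley[OF p(1)])
  note i2 = biholomorphic_map_inverse[OF bc, folded c'_def]
  have c0: "c p = 0" "c' 0 = p" using i2(2)[OF p(1)] by (auto simp: c_def)
  have hol: "\<psi> holomorphic_on upper_half_plane" "\<phi> holomorphic_on ball 0 1"
    "c holomorphic_on upper_half_plane" "c' holomorphic_on ball 0 1"
    using assms bc by (auto simp: biholomorphic_map_def \<phi>_def c'_def)
  define F where "F = \<psi> \<circ> c'"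
  define G where "G = c \<circ> \<phi>"
  have F: "F holomorphic_on ball 0 1" "F 0 = 0" "norm (F u) < 1" if "norm u < 1" for u
    unfolding F_def using i1 i2 that p c0 by (auto intro!: holomorphic_on_compose_gen[OF hol(4,1)])
  have G: "G holomorphic_on ball 0 1" "G 0 = 0" "norm (G u) < 1" if "norm u < 1" for u
    unfolding G_def using i1 i2 that p c0
    by (auto intro!: holomorphic_on_compose_gen[OF hol(2,3)] simp flip: p_def)
  have z0: "norm (0::complex) < 1" by simp
  have half: "norm (1 / 2 :: complex) < 1" by simp
  \<comment> \<open>The point 1/2 is an arbitrary nonzero point at which equality in the Schwarz lemma is tested.\<close>
  have GF: "G (F (1 / 2)) = 1 / 2" using i1 i2 half by (simp add: F_def G_def)
  have "norm (F (1/2)) \<le> norm (1/2 :: complex)"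
    by (rule Schwarz_Lemma(1)[OF F(1)[OF z0] F(2)[OF z0] F(3) half])
  moreover have "norm (G (F (1/2))) \<le> norm (F (1/2))"
    by (rule Schwarz_Lemma(1)[OF G(1)[OF z0] G(2)[OF z0] G(3) F(3)[OF half]])
  ultimately have "norm (F (1/2)) = norm (1/2 :: complex)" using GF by simp
  hence "\<exists>z. norm z < 1 \<and> z \<noteq> 0 \<and> norm (F z) = norm z" using half by (intro exI[of _ "1/2"]) auto
  hence "\<exists>\<alpha>. (\<forall>z. norm z < 1 \<longrightarrow> F z = \<alpha> * z) \<and> norm \<alpha> = 1"
    using Schwarz_Lemma(3)[OF F(1)[OF z0] F(2)[OF z0] F(3) half] by blast
  then obtain \<alpha> where \<alpha>: "norm \<alpha> = 1" "\<And>z. norm z < 1 \<Longrightarrow> F z = \<alpha> * z" by blast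
  have "\<psi> z = \<alpha> * c z" if "z \<in> upper_half_plane" for z
    using \<alpha>(2)[of "c z"] i2(1,2)[OF that] by (simp add: F_def)
  thus ?thesis using that p(1) \<alpha>(1) by (auto simp: c_def)
qed

lemma biholomorphic_strip_exp:
  assumes "\<beta> > 0"
  shows "biholomorphic_map (\<lambda>z. exp (of_real (pi / \<beta>) * z)) (strip \<beta>) upper_half_plane"
proof (rule biholomorphic_mapI)
  show "(\<lambda>z. exp (of_real (pi / \<beta>) * z)) holomorphic_on strip \<beta>"
    by (intro holomorphic_intros)
  show "(\<lambda>u. of_real (\<beta> / pi) * Ln u) holomorphic_on upper_half_plane"
    by (intro holomorphic_intros) (auto simp: upper_half_plane_def complex_nonpos_Reals_iff)
  have s: "0 < pi * Im z / \<beta>" "pi * Im z / \<beta> < pi" if "z \<in> strip \<beta>" for z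
    using that assms by (auto simp: strip_def field_simps)
  show "exp (of_real (pi / \<beta>) * z) \<in> upper_half_plane" if "z \<in> strip \<beta>" for z
    using s[OF that] sin_gt_zero by (auto simp: upper_half_plane_def Im_exp)
  show "of_real (\<beta> / pi) * Ln (exp (of_real (pi / \<beta>) * z)) = z" if "z \<in> strip \<beta>" for z
    using s[OF that] assms by (subst Ln_exp) auto
  show "of_real (\<beta> / pi) * Ln u \<in> strip \<beta>" if "u \<in> upper_half_plane" for u
  proof -
    have "u \<noteq> 0" "Im u > 0" using that by (auto simp: upper_half_plane_def)
    thus ?thesis using Im_Ln_pos_lt[of u] assms by (auto simp: strip_def field_simps)
  qed
  show "exp (of_real (pi / \<beta>) * (of_real (\<beta> / pi) * Ln u)) = u" if "u \<in> upper_half_plane" for u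
  proof -
    have "u \<noteq> 0" using that by (auto simp: upper_half_plane_def)
    moreover have "of_real (pi / \<beta>) * (of_real (\<beta> / pi) * Ln u) = Ln u" using assms by simp
    ultimately show ?thesis by simp
  qed
qed

text \<open>Factoring out the exponential of the mean exponent leaves exp u - exp (- u), a sine at an
  imaginary multiple of u; this is how the conformal map to the half-plane produces the sine of the
  periodized series.\<close>
lemma exp_strip_diff:
  assumes "\<beta> > 0"
  shows "exp (of_real (pi / \<beta>) * z) - cnj (exp (of_real (pi / \<beta>) * w))
           = exp (of_real (pi / (2 * \<beta>)) * z) * cnj (exp (of_real (pi / (2 * \<beta>)) * w))
             * (2 * \<i> * sin (of_real pi * ((z - cnj w) / (2 * \<i> * of_real \<beta>))))"
proof -
  define a where "a = of_real (pi / (2 * \<beta>)) * z"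
  define b where "b = of_real (pi / (2 * \<beta>)) * cnj w"
  have 1: "of_real (pi / \<beta>) * z = a + a" "cnj (of_real (pi / \<beta>) * w) = b + b"
    using assms by (simp_all add: a_def b_def)
  have 2: "\<i> * (of_real pi * ((z - cnj w) / (2 * \<i> * of_real \<beta>))) = a - b"
    using assms by (simp add: a_def b_def field_simps)
  have "2 * \<i> * sin (of_real pi * ((z - cnj w) / (2 * \<i> * of_real \<beta>))) = exp (a - b) - exp (- (a - b))"
    unfolding sin_exp_eq 2[symmetric] by simp
  moreover have "cnj (exp (of_real (pi / (2 * \<beta>)) * w)) = exp b"
    by (simp add: b_def exp_cnj)
  moreover have "exp (a + a) - exp (b + b) = exp a * exp b * (exp (a - b) - exp (- (a - b)))"
    unfolding minus_diff_eq exp_add exp_diff by (simp add: field_simps)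
  ultimately show ?thesis unfolding exp_cnj 1 unfolding a_def[symmetric] by (simp only: exp_cnj)
qed

section \<open>Bergman kernels\<close>

text \<open>If Q reproduces at w, then Q z = \<langle>K z, Q\<rangle> = cnj \<langle>Q, K z\<rangle> = cnj (K z w), a value that
  does not depend on Q.\<close>
lemma reproducing_kernel_unique:
  fixes ip :: "(complex \<Rightarrow> complex) \<Rightarrow> (complex \<Rightarrow> complex) \<Rightarrow> complex"
  assumes comm: "\<And>f g. ip f g = cnj (ip g f)"
    and K: "\<And>z. z \<in> \<Omega> \<Longrightarrow> K z \<in> H"
    and rep: "\<And>z f. z \<in> \<Omega> \<Longrightarrow> f \<in> H \<Longrightarrow> f z = ip (K z) f"
    and "w \<in> \<Omega>" "z \<in> \<Omega>"
  shows "(SOME Q. Q \<in> H \<and> (\<forall>f\<in>H. f w = ip Q f)) z = K w z"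
proof -
  let ?P = "\<lambda>Q. Q \<in> H \<and> (\<forall>f\<in>H. f w = ip Q f)"
  have Q: "?P (SOME Q. ?P Q)"
    by (rule someI[of ?P "K w"]) (intro conjI ballI K rep assms)
  have "Q z = cnj (K z w)" if "?P Q" for Q
  proof -
    have "Q z = ip (K z) Q" using that by (intro rep assms) auto
    also have "\<dots> = cnj (ip Q (K z))" by (rule comm)
    also have "ip Q (K z) = K z w" using that K[OF \<open>z \<in> \<Omega>\<close>] by metis
    finally show ?thesis .
  qed
  note * = this
  have "?P (K w)" by (intro conjI ballI K rep assms)
  thus ?thesis using *[OF Q] *[of "K w"] by simp
qed

lemma bergman_inner_commute: "bergman_inner \<Omega> f g = cnj (bergman_inner \<Omega> g f)"
proof -
  have "bergman_inner \<Omega> f g = (LINT z|lborel. cnj (indicator \<Omega> z *\<^sub>R (cnj (g z) * f z)))"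
    unfolding bergman_inner_def set_lebesgue_integral_def by (simp add: mult.commute)
  thus ?thesis unfolding bergman_inner_def set_lebesgue_integral_def by (simp only: Bochner_Integration.integral_cnj)
qed

text \<open>After the substitution \<open>z = \<phi> u\<close> with the inverse map \<open>\<phi>\<close>, the factor cnj (\<psi>') combines with
  the Jacobian |\<phi>'|^2 to \<phi>', because \<psi>' (\<phi> u) \<phi>' u = 1.  What remains is the integral over the disc
  of the holomorphic function (f \<circ> \<phi>) \<phi>', which is square integrable, hence integrable, and the mean
  value property evaluates it at 0.\<close>
lemma bergman_reproducing:
  assumes \<Omega>: "open \<Omega>" and \<psi>: "biholomorphic_map \<psi> \<Omega> (ball 0 1)" and w: "w \<in> \<Omega>" "\<psi> w = 0"
  defines "K \<equiv> \<lambda>z. cnj (deriv \<psi> w) * deriv \<psi> z / of_real pi"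
  shows "K \<in> bergman_space \<Omega>"
    and "f \<in> bergman_space \<Omega> \<Longrightarrow> f w = bergman_inner \<Omega> K f"
proof -
  define \<phi> where "\<phi> = inv_into \<Omega> \<psi>"
  note inv = biholomorphic_map_inverse[OF \<psi>, folded \<phi>_def]
  have hol: "\<psi> holomorphic_on \<Omega>" "\<phi> holomorphic_on ball 0 1"
    using \<psi> by (auto simp: biholomorphic_map_def \<phi>_def)
  have img: "\<psi> ` \<Omega> = ball 0 1" "\<phi> ` ball 0 1 = \<Omega>"
    using inv by (force simp: image_iff set_eq_iff)+
  have inj: "inj_on \<psi> \<Omega>" "inj_on \<phi> (ball 0 1)"
    using inv by (metis inj_onI)+
  note d = deriv_inv_into[OF \<psi> \<Omega> open_ball, folded \<phi>_def]
  have hd: "deriv \<psi> holomorphic_on \<Omega>" "deriv \<phi> holomorphic_on ball 0 1"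
    using hol \<Omega> by (auto intro: holomorphic_deriv)
  note cts = holomorphic_on_imp_continuous_on[OF hd(1)] holomorphic_on_imp_continuous_on[OF hd(2)]
    holomorphic_on_imp_continuous_on[OF hol(1)] holomorphic_on_imp_continuous_on[OF hol(2)]
  have one: "set_integrable lborel (ball (0::complex) 1) (\<lambda>_. 1 :: complex)"
    by (intro set_integrable_ball_continuous continuous_intros)
  have "set_integrable lborel \<Omega> (\<lambda>z. of_real ((norm (deriv \<psi> z))\<^sup>2) * 1 :: complex)"
    using holomorphic_change_of_variables(1)[OF \<Omega> hol(1) inj(1), of "\<lambda>_. 1"] one img by simp
  hence "set_integrable lborel \<Omega> (\<lambda>z. (norm (deriv \<psi> z))\<^sup>2)"
    using set_integrable_norm[of lborel \<Omega> "\<lambda>z. of_real ((norm (deriv \<psi> z))\<^sup>2) * 1 :: complex"]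
    by (simp add: norm_power)
  hence "set_integrable lborel \<Omega> (\<lambda>z. (norm (cnj (deriv \<psi> w)) / pi)\<^sup>2 * (norm (deriv \<psi> z))\<^sup>2)"
    by simp
  thus "K \<in> bergman_space \<Omega>"
    using hd unfolding bergman_space_def K_def
    by (auto intro!: holomorphic_intros simp: norm_mult norm_divide power_mult_distrib power_divide field_simps)
  assume f: "f \<in> bergman_space \<Omega>"
  hence holf: "f holomorphic_on \<Omega>" and intf: "set_integrable lborel \<Omega> (\<lambda>z. (norm (f z))\<^sup>2)"
    by (auto simp: bergman_space_def)
  define F where "F = (\<lambda>u. deriv \<phi> u * f (\<phi> u))"
  have holF: "F holomorphic_on ball 0 1"
    unfolding F_def using holomorphic_on_compose_gen[OF hol(2) holf] img
    by (intro holomorphic_intros hd) (auto simp: o_def)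
  have cf: "continuous_on \<Omega> f" using holf by (rule holomorphic_on_imp_continuous_on)
  have "set_integrable lborel \<Omega> (\<lambda>z. of_real ((norm (f z))\<^sup>2) :: complex)"
    using intf unfolding set_integrable_def
    by (subst (asm) complex_of_real_integrable_eq[symmetric]) (simp add: scaleR_conv_of_real)
  hence "set_integrable lborel (ball 0 1) (\<lambda>u. of_real ((norm (deriv \<phi> u))\<^sup>2) * of_real ((norm (f (\<phi> u)))\<^sup>2) :: complex)"
    by (subst holomorphic_change_of_variables(1)[OF open_ball hol(2) inj(2), of "\<lambda>z. of_real ((norm (f z))\<^sup>2)", symmetric])
       (auto simp: img intro!: continuous_intros cf)
  hence F2: "set_integrable lborel (ball 0 1) (\<lambda>u. of_real ((norm (F u))\<^sup>2) + 1 :: complex)"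
    by (intro set_integral_add(1) one) (simp add: F_def norm_mult power_mult_distrib)
  have F1: "set_integrable lborel (ball 0 1) F"
  proof (rule set_integrable_bound[OF F2])
    show "set_borel_measurable lborel (ball 0 1) F"
      unfolding set_borel_measurable_def
      by (simp, intro borel_measurable_continuous_on_indicator holomorphic_on_imp_continuous_on holF) auto
    show "AE u in lborel. u \<in> ball 0 1 \<longrightarrow> norm (F u) \<le> norm (of_real ((norm (F u))\<^sup>2) + 1 :: complex)"
    proof (intro AE_I2 impI)
      fix u :: complex
      have "2 * norm (F u) \<le> (norm (F u))\<^sup>2 + 1" using sum_squares_bound[of "norm (F u)" 1] by simp
      hence "norm (F u) \<le> (norm (F u))\<^sup>2 + 1" using norm_ge_zero[of "F u"] by linarith
      also have "\<dots> = norm (of_real ((norm (F u))\<^sup>2 + 1) :: complex)" by (subst norm_of_real) simp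
      finally show "norm (F u) \<le> norm (of_real ((norm (F u))\<^sup>2) + 1 :: complex)" by simp
    qed
  qed
  have pull: "of_real ((norm (deriv \<phi> u))\<^sup>2) * (cnj (deriv \<psi> (\<phi> u)) * f (\<phi> u)) = F u" if "u \<in> ball 0 1" for u
  proof -
    have "of_real ((norm (deriv \<phi> u))\<^sup>2) = deriv \<phi> u * cnj (deriv \<phi> u)"
      by (rule complex_norm_square)
    hence "of_real ((norm (deriv \<phi> u))\<^sup>2) * (cnj (deriv \<psi> (\<phi> u)) * f (\<phi> u))
       = deriv \<phi> u * f (\<phi> u) * cnj (deriv \<psi> (\<phi> u) * deriv \<phi> u)" by simp
    thus ?thesis by (simp only: d[OF that] F_def) simp
  qed
  have "(LINT z:\<phi> ` ball 0 1|lborel. cnj (deriv \<psi> z) * f z)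
          = (LINT u:ball 0 1|lborel. of_real ((norm (deriv \<phi> u))\<^sup>2) * (cnj (deriv \<psi> (\<phi> u)) * f (\<phi> u)))"
  proof (rule holomorphic_change_of_variables(2)[OF open_ball hol(2) inj(2)])
    show "set_integrable lborel (ball 0 1) (\<lambda>u. of_real ((norm (deriv \<phi> u))\<^sup>2) * (cnj (deriv \<psi> (\<phi> u)) * f (\<phi> u)))"
      using F1 by (subst set_integrable_cong[OF refl refl pull])
  qed (auto simp: img intro!: continuous_intros cts cf)
  also have "\<dots> = (LINT u:ball 0 1|lborel. F u)"
    by (rule set_lebesgue_integral_cong) (use pull in auto)
  also have "\<dots> = of_real pi * F 0" by (rule mean_value_unit_disc[OF holF F1])
  finally have I: "(LINT z:\<Omega>|lborel. cnj (deriv \<psi> z) * f z) = of_real pi * F 0" by (simp add: img)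
  have "\<phi> 0 = w" using w inv by metis
  have "bergman_inner \<Omega> K f = (LINT z:\<Omega>|lborel. (deriv \<psi> w / of_real pi) * (cnj (deriv \<psi> z) * f z))"
    unfolding bergman_inner_def K_def by (simp add: mult_ac)
  also have "\<dots> = (deriv \<psi> w / of_real pi) * (of_real pi * F 0)"
    by (simp only: set_integral_mult_right I)
  also have "\<dots> = f w" using d[of 0] \<open>\<phi> 0 = w\<close> by (simp add: F_def)
  finally show "f w = bergman_inner \<Omega> K f" ..
qed

lemma bergman_kernel_upper_half_plane:
  assumes "w \<in> upper_half_plane" "z \<in> upper_half_plane"
  shows "bergman_kernel upper_half_plane w z = - 1 / (of_real pi * (z - cnj w)\<^sup>2)"
proof -
  let ?\<psi> = "\<lambda>w z. (z - w) / (z - cnj w)"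
  note rep = bergman_reproducing[OF open_upper_half_plane biholomorphic_cayley]
  have "bergman_kernel upper_half_plane w z = cnj (deriv (?\<psi> w) w) * deriv (?\<psi> w) z / of_real pi"
    unfolding bergman_kernel_def
    by (rule reproducing_kernel_unique[OF bergman_inner_commute, where K = "\<lambda>w z. cnj (deriv (?\<psi> w) w) * deriv (?\<psi> w) z / of_real pi"])
       (use assms in \<open>auto intro!: rep\<close>)
  also have "\<dots> = - 1 / (of_real pi * (z - cnj w)\<^sup>2)"
  proof -
    define d where "d = w - cnj w"
    have "d \<noteq> 0" using assms by (auto simp: upper_half_plane_def complex_eq_iff d_def)
    moreover have "cnj d = - d" by (simp add: d_def)
    ultimately show ?thesis
      unfolding deriv_cayley[OF assms(1) assms(1)] deriv_cayley[OF assms] d_def[symmetric]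
      by (simp add: power2_eq_square)
  qed
  finally show ?thesis .
qed

lemma bergman_kernel_strip:
  assumes "\<beta> > 0" "w \<in> strip \<beta>" "z \<in> strip \<beta>"
  shows "bergman_kernel (strip \<beta>) w z
           = of_real pi / (4 * (of_real \<beta>)\<^sup>2 * (sin (of_real pi * ((z - cnj w) / (2 * \<i> * of_real \<beta>))))\<^sup>2)"
proof -
  define E where "E = (\<lambda>z::complex. exp (of_real (pi / \<beta>) * z))"
  define \<psi> where "\<psi> = (\<lambda>w z. (E z - E w) / (E z - cnj (E w)))"
  note bE = biholomorphic_strip_exp[OF assms(1), folded E_def]
  have E: "E v \<in> upper_half_plane" if "v \<in> strip \<beta>" for v
    using biholomorphic_map_inverse(1)[OF bE that] by (simp add: E_def)
  have b: "biholomorphic_map (\<psi> v) (strip \<beta>) (ball 0 1)" if "v \<in> strip \<beta>" for v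
    using biholomorphic_map_comp[OF bE biholomorphic_cayley[OF E[OF that]]] by (simp add: \<psi>_def)
  have \<psi>0: "\<psi> v v = 0" for v by (simp add: \<psi>_def)
  note rep = bergman_reproducing[OF open_strip b]
  have "bergman_kernel (strip \<beta>) w z = cnj (deriv (\<psi> w) w) * deriv (\<psi> w) z / of_real pi"
    unfolding bergman_kernel_def
    by (rule reproducing_kernel_unique[OF bergman_inner_commute, where K = "\<lambda>w z. cnj (deriv (\<psi> w) w) * deriv (\<psi> w) z / of_real pi"])
       (use assms in \<open>auto intro!: rep \<psi>0\<close>)
  moreover have "deriv (\<psi> w) v = (E w - cnj (E w)) * (of_real (pi / \<beta>) * E v) / (E v - cnj (E w))\<^sup>2"
    if "v \<in> strip \<beta>" for v
  proof (rule DERIV_imp_deriv)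
    have nz: "E v - cnj (E w) \<noteq> 0"
      using E[OF that] E[OF assms(2)] by (auto simp: upper_half_plane_def complex_eq_iff)
    have dE: "(E has_field_derivative of_real (pi / \<beta>) * E v) (at v)"
      unfolding E_def using assms(1) by (auto intro!: derivative_eq_intros)
    have num: "(c - 0) * (x - y) - (x - x') * (c - 0) = (x' - y) * c" for c x x' y :: complex
      by (simp add: algebra_simps)
    show "(\<psi> w has_field_derivative (E w - cnj (E w)) * (of_real (pi / \<beta>) * E v) / (E v - cnj (E w))\<^sup>2) (at v)"
      using DERIV_divide[OF DERIV_diff[OF dE DERIV_const] DERIV_diff[OF dE DERIV_const] nz, of "E w"]
      unfolding \<psi>_def power2_eq_square num .
  qed
  ultimately have "bergman_kernel (strip \<beta>) w z
      = cnj ((E w - cnj (E w)) * (of_real (pi / \<beta>) * E w) / (E w - cnj (E w))\<^sup>2)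
          * ((E w - cnj (E w)) * (of_real (pi / \<beta>) * E z) / (E z - cnj (E w))\<^sup>2) / of_real pi"
    using assms by simp
  also have "\<dots> = - (of_real (pi / \<beta>))\<^sup>2 / of_real pi * (E z * cnj (E w) / (E z - cnj (E w))\<^sup>2)"
  proof -
    define d where "d = E w - cnj (E w)"
    have "d \<noteq> 0" using E[OF assms(2)] by (auto simp: upper_half_plane_def complex_eq_iff d_def)
    moreover have "cnj d = - d" by (simp add: d_def)
    ultimately show ?thesis unfolding d_def[symmetric] by (simp add: power2_eq_square mult_ac)
  qed
  also have "E z * cnj (E w) / (E z - cnj (E w))\<^sup>2
      = 1 / (2 * \<i> * sin (of_real pi * ((z - cnj w) / (2 * \<i> * of_real \<beta>))))\<^sup>2"
  proof -
    define e where "e = (\<lambda>z::complex. exp (of_real (pi / (2 * \<beta>)) * z))"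
    have e: "E v = (e v)\<^sup>2" "e v \<noteq> 0" for v
      using assms(1) by (simp_all add: E_def e_def flip: exp_double)
    have "E z - cnj (E w) = e z * cnj (e w) * (2 * \<i> * sin (of_real pi * ((z - cnj w) / (2 * \<i> * of_real \<beta>))))"
      unfolding E_def e_def by (rule exp_strip_diff[OF assms(1)])
    moreover have "E z * cnj (E w) = (e z * cnj (e w))\<^sup>2" by (simp add: e(1) power_mult_distrib)
    moreover have "e z * cnj (e w) \<noteq> 0" using e(2) by simp
    ultimately show ?thesis by (simp only: power_mult_distrib) simp
  qed
  also have "- (of_real (pi / \<beta>))\<^sup>2 / of_real pi * (1 / (2 * \<i> * sin (of_real pi * ((z - cnj w) / (2 * \<i> * of_real \<beta>))))\<^sup>2)
     = of_real pi / (4 * (of_real \<beta>)\<^sup>2 * (sin (of_real pi * ((z - cnj w) / (2 * \<i> * of_real \<beta>))))\<^sup>2)"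
  proof -
    have "(2 * \<i> * S)\<^sup>2 = - (4 * S\<^sup>2)" for S :: complex by (simp add: power_mult_distrib)
    thus ?thesis by (simp only:) (simp add: power2_eq_square)
  qed
  finally show ?thesis .
qed

section \<open>The Cauchy and Poisson formulas on the real line\<close>

lemma has_bochner_integral_cauchy_density:
  fixes a b :: real
  assumes "b > 0"
  shows "has_bochner_integral lborel (\<lambda>x. b / ((x - a)\<^sup>2 + b\<^sup>2)) pi"
proof -
  define F where "F = (\<lambda>x. arctan ((x - a) / b))"
  define f where "f = (\<lambda>x. b / ((x - a)\<^sup>2 + b\<^sup>2))"
  have pos: "(x - a)\<^sup>2 + b\<^sup>2 > 0" for x using assms by (intro add_nonneg_pos) auto
  have 1: "DERIV F x :> f x" for x
  proof -
    have "DERIV F x :> inverse (1 + ((x - a) / b)\<^sup>2) * (1 / b)"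
      unfolding F_def using assms by (auto intro!: derivative_eq_intros)
    also have "inverse (1 + ((x - a) / b)\<^sup>2) * (1 / b) = f x"
      using assms pos[of x] by (simp add: f_def field_simps power2_eq_square)
    finally show ?thesis .
  qed
  have 2: "isCont f x" for x
    unfolding f_def using pos[of x] by (intro continuous_intros) auto
  have 3: "(F \<longlongrightarrow> - pi / 2) at_bot" "(F \<longlongrightarrow> pi / 2) at_top"
    unfolding F_def using assms by real_asymp+
  note FTC = interval_integral_FTC_nonneg[of "-\<infinity>" \<infinity> F f "- pi / 2" "pi / 2"]
  have "set_integrable lborel (einterval (-\<infinity>) \<infinity>) f" "(LBINT x=-\<infinity>..\<infinity>. f x) = pi / 2 - - pi / 2"
    by (rule FTC; use 1 2 3 assms in \<open>simp add: ereal_tendsto_simps f_def\<close>)+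
  hence "integrable lborel f" "(LBINT x. f x) = pi"
    by (simp_all add: set_integrable_def interval_lebesgue_integral_def set_lebesgue_integral_def)
  thus ?thesis unfolding f_def by (simp add: has_bochner_integral_iff)
qed

lemma norm_of_real_minus_power2: "(norm (of_real x - z))\<^sup>2 = (x - Re z)\<^sup>2 + (Im z)\<^sup>2"
  by (simp add: cmod_power2)

lemma has_bochner_integral_inverse_norm:
  assumes "Im p > 0"
  shows "has_bochner_integral lborel (\<lambda>x. 1 / (norm (of_real x - p))\<^sup>2) (pi / Im p)"
proof -
  have "has_bochner_integral lborel (\<lambda>x. (1 / Im p) * (Im p / ((x - Re p)\<^sup>2 + (Im p)\<^sup>2))) ((1 / Im p) * pi)"
    by (rule has_bochner_integral_mult_right[OF has_bochner_integral_cauchy_density[OF assms]])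
  thus ?thesis using assms by (simp add: norm_of_real_minus_power2)
qed

lemma norm_of_real_minus_pos: "Im w > 0 \<Longrightarrow> norm (of_real x - w) > 0"
  by (auto simp: complex_eq_iff)

lemma integrable_real_line_decay:
  fixes f :: "real \<Rightarrow> complex"
  assumes cont: "continuous_on UNIV f" and bd: "\<And>x. \<bar>x\<bar> \<ge> R \<Longrightarrow> norm (f x) \<le> C / x\<^sup>2" and "R > 0"
  shows "integrable lborel f"
proof -
  have "compact (f ` {-R..R})" using cont by (intro compact_continuous_image continuous_on_subset[OF cont]) auto
  then obtain B where B: "\<And>x. x \<in> {-R..R} \<Longrightarrow> norm (f x) \<le> B"
    using compact_imp_bounded[of "f ` {-R..R}"] unfolding bounded_iff by blast
  define D where "D = \<bar>B\<bar> * (1 + R\<^sup>2) + \<bar>C\<bar> * (1 + 1 / R\<^sup>2)"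
  have int: "integrable lborel (\<lambda>x::real. D * (1 / ((x - 0)\<^sup>2 + 1\<^sup>2)))"
    using has_bochner_integral_cauchy_density[of 1 0] by (intro integrable_mult_right) (auto simp: has_bochner_integral_iff)
  show ?thesis
  proof (rule Bochner_Integration.integrable_bound[OF int])
    show "f \<in> borel_measurable lborel" using cont by (simp add: borel_measurable_continuous_onI)
    have "norm (f x) \<le> D / (x\<^sup>2 + 1)" for x
    proof (cases "\<bar>x\<bar> \<le> R")
      case True
      hence 1: "norm (f x) \<le> \<bar>B\<bar>" using B[of x] by (auto simp: abs_le_iff intro: order_trans[OF _ abs_ge_self])
      have "x\<^sup>2 \<le> R\<^sup>2" using True by (metis abs_ge_zero power2_abs power_mono)
      hence "\<bar>B\<bar> * (x\<^sup>2 + 1) \<le> \<bar>B\<bar> * (1 + R\<^sup>2)" by (intro mult_left_mono) auto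
      moreover have "\<bar>C\<bar> * (1 + 1 / R\<^sup>2) \<ge> 0" by simp
      ultimately have "\<bar>B\<bar> * (x\<^sup>2 + 1) \<le> D" unfolding D_def by linarith
      hence "\<bar>B\<bar> \<le> D / (x\<^sup>2 + 1)" by (simp add: pos_le_divide_eq add_nonneg_pos)
      with 1 show ?thesis by linarith
    next
      case False
      hence "R\<^sup>2 \<le> \<bar>x\<bar>\<^sup>2" using assms(3) by (intro power_mono) auto
      hence x: "x\<^sup>2 \<ge> R\<^sup>2" "x \<noteq> 0" using assms(3) by auto
      have "norm (f x) \<le> C / x\<^sup>2" using bd[of x] False by auto
      also have "\<dots> \<le> \<bar>C\<bar> / x\<^sup>2" by (intro divide_right_mono) auto
      also have "\<dots> \<le> \<bar>C\<bar> * (1 + 1 / R\<^sup>2) / (x\<^sup>2 + 1)"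
      proof -
        have "x\<^sup>2 + 1 \<le> (1 + 1 / R\<^sup>2) * x\<^sup>2" using x assms(3) by (simp add: field_simps)
        hence "\<bar>C\<bar> * (x\<^sup>2 + 1) \<le> \<bar>C\<bar> * ((1 + 1 / R\<^sup>2) * x\<^sup>2)" by (intro mult_left_mono) auto
        thus ?thesis using x by (simp add: divide_simps add_nonneg_pos mult_ac)
      qed
      also have "\<dots> \<le> D / (x\<^sup>2 + 1)" unfolding D_def by (intro divide_right_mono) auto
      finally show ?thesis .
    qed
    moreover have "D \<ge> 0" using assms(3) by (auto simp: D_def)
    ultimately show "AE x in lborel. norm (f x) \<le> norm (D * (1 / ((x - 0)\<^sup>2 + 1\<^sup>2)))" by simp
  qed
qed

text \<open>Closing the segment from -r to r by a half-circle: on the arc the integrand is O(1 / r^2), so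
  the contribution of the arc is O(1 / r).\<close>
lemma integral_real_line_zero:
  fixes F :: "complex \<Rightarrow> complex"
  assumes hol: "F holomorphic_on {z. Im z > -d}" and "d > 0"
    and bd: "\<And>z. Im z \<ge> 0 \<Longrightarrow> norm z \<ge> R \<Longrightarrow> norm (F z) \<le> C / (norm z)\<^sup>2" and "R > 0"
  shows "has_bochner_integral lborel (\<lambda>x. F (of_real x)) 0"
proof -
  define S where "S = {z. Im z > -d}"
  have S: "open S" "convex S" unfolding S_def by (rule open_halfspace_Im_gt convex_halfspace_Im_gt)+
  have cont: "continuous_on S F" using hol by (auto simp: S_def intro: holomorphic_on_imp_continuous_on)
  have contR: "continuous_on UNIV (\<lambda>x. F (of_real x))"
    by (rule continuous_on_compose2[OF cont]) (use assms(2) in \<open>auto intro!: continuous_intros simp: S_def\<close>)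
  have int: "integrable lborel (\<lambda>x. F (of_real x))"
  proof (rule integrable_real_line_decay[OF contR _ assms(4), where C = C])
    show "norm (F (of_real x)) \<le> C / x\<^sup>2" if "R \<le> \<bar>x\<bar>" for x
      using bd[of "of_real x"] that by simp
  qed
  have "C / R\<^sup>2 \<ge> norm (F (of_real R))" using bd[of "of_real R"] assms(4) by simp
  hence "C \<ge> 0" using assms(4) norm_ge_zero[of "F (of_real R)"]
    by (meson divide_nonneg_pos divide_neg_pos le_less_trans not_le zero_less_power order.trans)
  have small: "norm (integral {-r..r} (\<lambda>x. F (of_real x))) \<le> C * pi / r" if r: "r \<ge> R" for r
  proof -
    have "r > 0" using r assms(4) by linarith
    define g where "g = linepath (of_real (-r)) (of_real r) +++ part_circlepath 0 r 0 pi"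
    have seg: "path_image (linepath (of_real (-r)) (of_real r)) \<subseteq> S"
      using assms(2) by (auto simp: S_def closed_segment_def)
    have arc: "Im z \<ge> 0 \<and> norm z = r" if "z \<in> path_image (part_circlepath 0 r 0 pi)" for z
      using that \<open>r > 0\<close> unfolding path_image_part_circlepath[OF pi_ge_zero]
      by (auto simp: Im_exp norm_mult sin_ge_zero)
    hence arcS: "path_image (part_circlepath 0 r 0 pi) \<subseteq> S" using assms(2) by (force simp: S_def)
    have gS: "valid_path g" "path_image g \<subseteq> S" "pathfinish g = pathstart g"
      using seg arcS by (auto simp: g_def subset_path_image_join exp_Euler)
    have "(F has_contour_integral 0) g"
      by (rule Cauchy_theorem_convex_simple[OF _ S(2) gS]) (use hol in \<open>simp add: S_def\<close>)
    moreover have ci: "F contour_integrable_on linepath (of_real (-r)) (of_real r)"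
        "F contour_integrable_on part_circlepath 0 r 0 pi"
      using cont seg arcS by (auto intro!: contour_integrable_continuous_linepath contour_integrable_continuous_part_circlepath elim: continuous_on_subset)
    ultimately have "contour_integral (linepath (of_real (-r)) (of_real r)) F + contour_integral (part_circlepath 0 r 0 pi) F = 0"
      by (simp add: g_def contour_integral_unique exp_Euler flip: contour_integral_join)
    moreover have "contour_integral (linepath (of_real (-r)) (of_real r)) F = integral {-r..r} (\<lambda>x. F (of_real x))"
      using \<open>r > 0\<close> by (subst contour_integral_linepath_Reals_eq) auto
    moreover have "norm (contour_integral (part_circlepath 0 r 0 pi) F) \<le> C / r\<^sup>2 * r * \<bar>pi - 0\<bar>"
      by (rule contour_integral_bound_part_circlepath[OF ci(2)])
        (use \<open>C \<ge> 0\<close> \<open>r > 0\<close> arc bd r in fastforce)+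
    ultimately show ?thesis using \<open>r > 0\<close> by (simp add: add_eq_0_iff power2_eq_square)
  qed
  have "(\<lambda>n. LINT x|lborel. indicator {- real n..real n} x *\<^sub>R F (of_real x)) \<longlonglongrightarrow> (LINT x|lborel. F (of_real x))"
  proof (rule integral_dominated_convergence)
    show "integrable lborel (\<lambda>x. norm (F (of_real x)))" using int by (rule integrable_norm)
    show "AE x in lborel. (\<lambda>n. indicator {- real n..real n} x *\<^sub>R F (of_real x)) \<longlonglongrightarrow> F (of_real x)"
    proof (intro AE_I2 tendsto_eventually)
      fix x :: real
      show "\<forall>\<^sub>F n in sequentially. indicator {- real n..real n} x *\<^sub>R F (of_real x) = F (of_real x)"
        using eventually_ge_at_top[of "nat \<lceil>\<bar>x\<bar>\<rceil>"]
      proof eventually_elim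
        case (elim n)
        hence "\<bar>x\<bar> \<le> real n" by linarith
        thus ?case by (auto simp: indicator_def)
      qed
    qed
    show "AE x in lborel. norm (indicator {- real n..real n} x *\<^sub>R F (of_real x)) \<le> norm (F (of_real x))" for n
      by (auto simp: indicator_def)
    show mF: "(\<lambda>x. F (of_real x)) \<in> borel_measurable lborel"
      using int by (rule borel_measurable_integrable)
    show "(\<lambda>x. indicator {- real n..real n} x *\<^sub>R F (of_real x)) \<in> borel_measurable lborel" for n
      using mF by (intro borel_measurable_scaleR) auto
  qed
  moreover have "(\<lambda>n. LINT x|lborel. indicator {- real n..real n} x *\<^sub>R F (of_real x)) \<longlonglongrightarrow> 0"
  proof (rule tendsto_norm_zero_cancel, rule tendsto_sandwich[OF _ _ tendsto_const])
    have eq: "(LINT x|lborel. indicator {-r..r} x *\<^sub>R F (of_real x)) = integral {-r..r} (\<lambda>x. F (of_real x))" for r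
      using set_borel_integral_eq_integral(2)[of "{-r..r}" "\<lambda>x. F (of_real x)"]
        integrable_mult_indicator[OF _ int, of "{-r..r}"]
      by (simp add: set_integrable_def set_lebesgue_integral_def)
    show "\<forall>\<^sub>F n in sequentially. norm (LINT x|lborel. indicator {- real n..real n} x *\<^sub>R F (of_real x)) \<le> C * pi / real n"
      using eventually_ge_at_top[of "nat \<lceil>R\<rceil>"] by eventually_elim (unfold eq, rule small, linarith)
    show "(\<lambda>n. C * pi / real n) \<longlonglongrightarrow> 0" by real_asymp
  qed auto
  ultimately have "(LINT x|lborel. F (of_real x)) = 0" by (rule LIMSEQ_unique)
  thus ?thesis using int by (simp add: has_bochner_integral_iff)
qed

text \<open>The function (G z - G w) / ((z - w) (z - cnj w)) has a removable singularity at w and decays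
  like 1 / |z|^2, so its integral over the real line vanishes.  There the denominator is |x - w|^2.\<close>
lemma poisson_formula:
  fixes G :: "complex \<Rightarrow> complex"
  assumes hol: "G holomorphic_on {z. Im z > -d}" and "d > 0"
    and bd: "\<And>z. Im z \<ge> 0 \<Longrightarrow> norm (G z) \<le> C" and w: "Im w > 0"
  shows "has_bochner_integral lborel (\<lambda>x. of_real (Im w / (norm (of_real x - w))\<^sup>2) * G (of_real x)) (of_real pi * G w)"
proof -
  define q where "q = (\<lambda>z. if z = w then deriv G w else (G z - G w) / (z - w))"
  define H where "H = (\<lambda>z. q z / (z - cnj w))"
  define e where "e = min d (Im w)"
  have e: "e > 0" "e \<le> d" "e \<le> Im w" using assms by (auto simp: e_def)
  have "(\<lambda>z. G z - G w) holomorphic_on {z. Im z > -d}" by (intro holomorphic_intros hol)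
  hence "q holomorphic_on {z. Im z > -d}"
  proof (rule pole_theorem_open_0[where a = w])
    have "(G has_field_derivative deriv G w) (at w)"
      by (rule holomorphic_derivI[OF hol open_halfspace_Im_gt]) (use w assms(2) in auto)
    hence "((\<lambda>z. G z - G w) has_field_derivative deriv G w) (at w)"
      by (auto intro!: derivative_eq_intros)
    thus "q w = deriv (\<lambda>z. G z - G w) w" by (simp add: q_def DERIV_imp_deriv)
  qed (auto simp: q_def open_halfspace_Im_gt)
  hence holH: "H holomorphic_on {z. Im z > -e}"
    unfolding H_def using e w by (intro holomorphic_intros) (auto elim!: holomorphic_on_subset)
  have bdH: "norm (H z) \<le> 8 * C / (norm z)\<^sup>2" if "Im z \<ge> 0" "norm z \<ge> 2 * norm w + 1" for z
  proof -
    have "norm z > norm w" using that(2) norm_ge_zero[of w] by linarith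
    hence zw: "z \<noteq> w" by auto
    have "norm (z - w) \<ge> norm z / 2" "norm (z - cnj w) \<ge> norm z / 2"
      using norm_triangle_ineq2[of z w] norm_triangle_ineq2[of z "cnj w"] that(2) by auto
    hence "norm (z - w) * norm (z - cnj w) \<ge> norm z / 2 * (norm z / 2)"
      by (intro mult_mono) auto
    moreover have "norm (G z - G w) \<le> 2 * C" 
      using bd[OF that(1)] bd[of w] w norm_triangle_ineq4[of "G z" "G w"] by simp
    moreover have "C \<ge> 0" using bd[of w] w norm_ge_zero[of "G w"] by linarith
    moreover have "norm z > 0" using that(2) norm_ge_zero[of w] by linarith
    ultimately have "norm (G z - G w) / (norm (z - w) * norm (z - cnj w)) \<le> 2 * C / (norm z / 2 * (norm z / 2))"
      by (intro frac_le) auto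
    thus ?thesis using zw by (simp add: H_def q_def norm_divide norm_mult power2_eq_square)
  qed
  have 0: "has_bochner_integral lborel (\<lambda>x. H (of_real x)) 0"
    by (rule integral_real_line_zero[OF holH e(1) bdH]) (auto intro!: add_nonneg_pos)
  have Hx: "of_real (Im w) * H (of_real x) = of_real (Im w / (norm (of_real x - w))\<^sup>2) * G (of_real x) - of_real (Im w / (norm (of_real x - w))\<^sup>2) * G w" for x
  proof -
    have "of_real x \<noteq> w" using w by (auto simp: complex_eq_iff)
    moreover have "(of_real x - w) * (of_real x - cnj w) = of_real ((norm (of_real x - w))\<^sup>2)"
      using complex_norm_square[of "of_real x - w"] by simp
    ultimately have "H (of_real x) = (G (of_real x) - G w) / of_real ((norm (of_real x - w))\<^sup>2)"
      by (simp add: H_def q_def del: of_real_power)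
    thus ?thesis by (simp add: diff_divide_distrib right_diff_distrib del: of_real_power)
  qed
  have 1: "has_bochner_integral lborel (\<lambda>x. of_real (Im w / (norm (of_real x - w))\<^sup>2) * G w) (of_real pi * G w)"
  proof (intro has_bochner_integral_mult_left has_bochner_integral_of_real)
    show "has_bochner_integral lborel (\<lambda>x. Im w / (norm (of_real x - w))\<^sup>2) pi"
      using has_bochner_integral_cauchy_density[OF w, of "Re w"] by (simp add: norm_of_real_minus_power2)
  qed
  have "has_bochner_integral lborel (\<lambda>x. of_real (Im w) * H (of_real x)) (of_real (Im w) * 0)"
    by (rule has_bochner_integral_mult_right[OF 0])
  from has_bochner_integral_add[OF this 1] show ?thesis unfolding Hx by simp
qed

section \<open>Maximal functions and Poisson integrals\<close>

lemma emeasure_UN_le_count_space: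
  assumes [measurable]: "\<And>i. i \<in> I \<Longrightarrow> X i \<in> sets M" and [simp]: "countable I"
  shows "emeasure M (\<Union>(X ` I)) \<le> (\<integral>\<^sup>+i. emeasure M (X i) \<partial>count_space I)"
proof -
  note sets.countable_UN'[unfolded subset_eq, measurable]
  have "emeasure M (\<Union>(X ` I)) = (\<integral>\<^sup>+x. indicator (\<Union>(X ` I)) x \<partial>M)"
    by simp
  also have "\<dots> \<le> (\<integral>\<^sup>+x. \<integral>\<^sup>+i. indicator (X i) x \<partial>count_space I \<partial>M)"
  proof (rule nn_integral_mono)
    fix x
    show "(indicator (\<Union>(X ` I)) x :: ennreal) \<le> (\<integral>\<^sup>+i. indicator (X i) x \<partial>count_space I)"
    proof (cases "x \<in> \<Union>(X ` I)")
      case True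
      then obtain j where "j \<in> I" "x \<in> X j" by auto
      thus ?thesis using nn_integral_ge_point[of j I "\<lambda>i. indicator (X i) x"] True by simp
    qed auto
  qed
  also have "\<dots> = (\<integral>\<^sup>+i. \<integral>\<^sup>+x. indicator (X i) x \<partial>M \<partial>count_space I)"
    by (simp add: nn_integral_count_space_nn_integral)
  also have "\<dots> = (\<integral>\<^sup>+i. emeasure M (X i) \<partial>count_space I)"
    by (simp cong: nn_integral_cong_simp)
  finally show ?thesis .
qed

text \<open>Where the mean of \<open>\<Phi>\<close> over some interval about x exceeds a given L, Vitali's covering lemma
  selects disjoint intervals of this kind whose fivefold enlargements still cover.  The total length
  of the enlargements is O(1 / L), and so the points that are bad for every L form a null set.\<close>
lemma AE_maximal_function_finite:
  fixes \<Phi> :: "real \<Rightarrow> ennreal"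
  assumes [measurable]: "\<Phi> \<in> borel_measurable borel" and fin: "(\<integral>\<^sup>+x. \<Phi> x \<partial>lborel) < \<infinity>"
  shows "AE x in lborel. \<exists>L\<ge>0. \<forall>r>0. (\<integral>\<^sup>+t. \<Phi> t * indicator (cball x r) t \<partial>lborel) \<le> ennreal (L * r)"
proof -
  define \<mu> where "\<mu> = density lborel \<Phi>"
  define M where "M = enn2real (\<integral>\<^sup>+x. \<Phi> x \<partial>lborel)"
  have M: "(\<integral>\<^sup>+x. \<Phi> x \<partial>lborel) = ennreal M" "M \<ge> 0" using fin by (simp_all add: M_def)
  have em: "emeasure \<mu> A = (\<integral>\<^sup>+t. \<Phi> t * indicator A t \<partial>lborel)" if "A \<in> sets borel" for A
    unfolding \<mu>_def using that by (subst emeasure_density) auto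
  have le: "emeasure \<mu> A \<le> ennreal M" if "A \<in> sets borel" for A
    unfolding em[OF that] M(1)[symmetric] by (intro nn_integral_mono) (auto simp: indicator_def)
  define E where "E = {x. \<forall>L\<ge>0. \<exists>r>0. emeasure \<mu> (cball x r) > ennreal (L * r)}"
  have cover: "\<exists>T\<in>sets borel. E \<subseteq> T \<and> emeasure lborel T \<le> ennreal (10 * M / L)" if L: "L > 0" for L
  proof -
    have "\<forall>x\<in>E. \<exists>r>0. emeasure \<mu> (cball x r) > ennreal (L * r)" using L by (auto simp: E_def)
    then obtain r where r: "\<And>x. x \<in> E \<Longrightarrow> r x > 0" "\<And>x. x \<in> E \<Longrightarrow> emeasure \<mu> (cball x (r x)) > ennreal (L * r x)"
      by metis
    \<comment> \<open>The covering lemma needs bounded radii; here they are bounded because the measure is finite.\<close>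
    have rb: "r x \<le> M / L" if "x \<in> E" for x
    proof -
      have "ennreal (L * r x) < ennreal M" using r(2)[OF that] le[of "cball x (r x)"] by auto
      thus ?thesis using L M(2) by (simp add: ennreal_less_iff r(1)[OF that] less_imp_le field_simps)
    qed
    obtain C where C: "countable C" "C \<subseteq> E"
       "pairwise (\<lambda>i j. disjnt (cball i (r i)) (cball j (r j))) C"
       "E \<subseteq> (\<Union>i\<in>C. cball i (5 * r i))"
      by (rule Vitali_covering_lemma_cballs[where S = E and K = E and a = "\<lambda>x. x" and r = r and B = "M / L"]) (use r rb in \<open>force intro: less_imp_le\<close>)+
    have "emeasure lborel (\<Union>i\<in>C. cball i (5 * r i)) \<le> (\<integral>\<^sup>+i. emeasure lborel (cball i (5 * r i)) \<partial>count_space C)"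
      by (rule emeasure_UN_le_count_space) (use C in auto)
    also have "\<dots> \<le> (\<integral>\<^sup>+i. ennreal (10 / L) * emeasure \<mu> (cball i (r i)) \<partial>count_space C)"
    proof (intro nn_integral_mono)
      fix i assume "i \<in> space (count_space C)"
      hence i: "i \<in> E" using C by auto
      have "emeasure lborel (cball i (5 * r i)) = ennreal (10 * r i)"
        using r(1)[OF i] by (simp add: cball_eq_atLeastAtMost)
      also have "\<dots> = ennreal (10 / L) * ennreal (L * r i)"
        using L r(1)[OF i] by (subst ennreal_mult[symmetric]) auto
      also have "\<dots> \<le> ennreal (10 / L) * emeasure \<mu> (cball i (r i))"
        using r(2)[OF i] by (intro mult_left_mono) auto
      finally show "emeasure lborel (cball i (5 * r i)) \<le> \<dots>" .
    qed
    also have "\<dots> = ennreal (10 / L) * (\<integral>\<^sup>+i. emeasure \<mu> (cball i (r i)) \<partial>count_space C)"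
      by (rule nn_integral_cmult) auto
    also have "(\<integral>\<^sup>+i. emeasure \<mu> (cball i (r i)) \<partial>count_space C) = emeasure \<mu> (\<Union>i\<in>C. cball i (r i))"
      by (rule emeasure_UN_countable[symmetric])
         (use C in \<open>auto simp: \<mu>_def disjoint_family_on_def pairwise_def disjnt_def\<close>)
    also have "\<dots> \<le> ennreal M" by (rule le) (use C in \<open>auto intro!: sets.countable_UN'\<close>)
    also have "ennreal (10 / L) * ennreal M = ennreal (10 * M / L)"
      using L M(2) by (subst ennreal_mult[symmetric]) auto
    finally have "emeasure lborel (\<Union>i\<in>C. cball i (5 * r i)) \<le> ennreal (10 * M / L)"
      by (simp add: mult_left_mono)
    moreover have "(\<Union>i\<in>C. cball i (5 * r i)) \<in> sets borel" using C by (auto intro!: sets.countable_UN')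
    ultimately show ?thesis using C(4) by blast
  qed
  have "\<forall>n::nat. \<exists>T\<in>sets borel. E \<subseteq> T \<and> emeasure lborel T \<le> ennreal (10 * M / real (Suc n))"
    by (intro allI cover) auto
  then obtain T where T: "\<And>n. T n \<in> sets borel" "\<And>n. E \<subseteq> T n" "\<And>n. emeasure lborel (T n) \<le> ennreal (10 * M / real (Suc n))"
    by metis
  have "(\<Inter>n. T n) \<in> null_sets lborel"
  proof (rule null_setsI)
    have "emeasure lborel (\<Inter>n. T n) \<le> ennreal (10 * M / real (Suc n))" for n
      using T(3)[of n] by (rule order_trans[rotated]) (intro emeasure_mono, use T in auto)
    moreover have "(\<lambda>n. ennreal (10 * M / real (Suc n))) \<longlonglongrightarrow> ennreal 0"
      by (intro tendsto_ennrealI) real_asymp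
    ultimately have "emeasure lborel (\<Inter>n. T n) \<le> ennreal 0"
      by (intro LIMSEQ_le_const) auto
    thus "emeasure lborel (\<Inter>n. T n) = 0" by simp
  qed (use T in auto)
  hence "AE x in lborel. x \<notin> (\<Inter>n. T n)" by (rule AE_not_in)
  thus ?thesis
  proof eventually_elim
    case (elim x)
    hence "x \<notin> E" using T(2) by auto
    then obtain L where L: "L \<ge> 0" "\<And>r. r > 0 \<Longrightarrow> emeasure \<mu> (cball x r) \<le> ennreal (L * r)"
      unfolding E_def by force
    thus ?case by (intro exI[of _ L]) (auto simp: em)
  qed
qed

text \<open>In a cone at x the Poisson kernel is dominated by a sum of multiples of the indicators of the
  intervals of radius \<open>2 ^ k * Im z\<close> about x; the multiples decay like \<open>4 ^ - k\<close> while the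
  integrals over the intervals grow at most like \<open>2 ^ k\<close>.\<close>
lemma poisson_integral_le_maximal:
  fixes \<Phi> :: "real \<Rightarrow> ennreal"
  assumes [measurable]: "\<Phi> \<in> borel_measurable borel"
    and L: "L \<ge> 0" "\<And>r. r > 0 \<Longrightarrow> (\<integral>\<^sup>+t. \<Phi> t * indicator (cball x r) t \<partial>lborel) \<le> ennreal (L * r)"
    and z: "Im z > 0" "norm (z - of_real x) < (1 + a) * Im z" and "a > 0"
  shows "(\<integral>\<^sup>+t. ennreal (Im z / (norm (of_real t - z))\<^sup>2) * \<Phi> t \<partial>lborel) \<le> ennreal (8 * (2 + a)\<^sup>2 * L)"
proof -
  have [measurable]: "cball x r \<in> sets borel" for r by simp
  define y where "y = Im z"
  \<comment> \<open>Points t with |t - x| > 2^(k - 1) y satisfy |t - z| \<ge> 2^(k - 1) y / (2 + a), whence this constant.\<close>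
  define A where "A = 4 * (2 + a)\<^sup>2"
  have y: "y > 0" using z by (simp add: y_def)
  have A: "A > 0" "A \<ge> 4" 
  proof -
    have "(2 + a)\<^sup>2 \<ge> 1" using \<open>a > 0\<close> by (intro one_le_power) auto
    thus "A > 0" "A \<ge> 4" by (auto simp: A_def)
  qed
  have bd: "ennreal (y / (norm (of_real t - z))\<^sup>2) \<le> (\<Sum>k. ennreal (A / (4 ^ k * y)) * indicator (cball x (2 ^ k * y)) t)" for t
  proof -
    define v where "v = norm (of_real t - z)"
    have v1: "v \<ge> y" unfolding v_def y_def using abs_Im_le_cmod[of "of_real t - z"] z(1) by simp
    have "\<bar>t - x\<bar> = norm ((of_real t - z) + (z - of_real x))" by (simp flip: of_real_diff)
    also have "\<dots> \<le> v + (1 + a) * y" unfolding v_def y_def using z(2) norm_triangle_ineq[of "of_real t - z" "z - of_real x"] by linarith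
    also have "\<dots> \<le> v + (1 + a) * v" using v1 \<open>a > 0\<close> by (intro add_left_mono mult_left_mono) auto
    finally have v2: "\<bar>t - x\<bar> \<le> (2 + a) * v" by (simp add: algebra_simps)
    have "\<exists>k. \<bar>t - x\<bar> \<le> 2 ^ k * y"
    proof -
      obtain k where "\<bar>t - x\<bar> / y < 2 ^ k" using real_arch_pow[of 2] by auto
      thus ?thesis using y by (intro exI[of _ k]) (simp add: field_simps)
    qed
    define k where "k = (LEAST k. \<bar>t - x\<bar> \<le> 2 ^ k * y)"
    have k: "\<bar>t - x\<bar> \<le> 2 ^ k * y" unfolding k_def by (rule LeastI_ex) fact
    have "y / v\<^sup>2 \<le> A / (4 ^ k * y)"
    proof (cases k)
      case 0
      have "y / v\<^sup>2 \<le> y / y\<^sup>2" using v1 y by (intro divide_left_mono power_mono) auto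
      also have "\<dots> = 1 / y" using y by (simp add: power2_eq_square)
      also have "\<dots> \<le> A / y" using y A by (intro divide_right_mono) auto
      finally show ?thesis using 0 by simp
    next
      case (Suc j)
      have "(4::real) ^ j = 2 ^ j * 2 ^ j" by (simp flip: power_mult_distrib)
      hence four: "(2 ^ j)\<^sup>2 = (4::real) ^ j" by (simp add: power2_eq_square)
      have "\<not> \<bar>t - x\<bar> \<le> 2 ^ j * y" unfolding k_def using not_less_Least[of j "\<lambda>k. \<bar>t - x\<bar> \<le> 2 ^ k * y"] Suc by (auto simp: k_def)
      hence "2 ^ j * y \<le> (2 + a) * v" using v2 by linarith
      hence "(2 ^ j * y)\<^sup>2 \<le> ((2 + a) * v)\<^sup>2" using y by (intro power_mono) auto
      hence "4 ^ k * y\<^sup>2 \<le> A * v\<^sup>2" unfolding Suc A_def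
        by (simp add: power_mult_distrib four mult_ac)
      moreover have "v > 0" using v1 y by linarith
      ultimately show ?thesis using y by (simp add: field_simps power2_eq_square)
    qed
    hence "ennreal (y / v\<^sup>2) \<le> ennreal (A / (4 ^ k * y)) * indicator (cball x (2 ^ k * y)) t"
      using k by (auto simp: dist_real_def abs_minus_commute intro: ennreal_leI)
    also have "\<dots> \<le> (\<Sum>k. ennreal (A / (4 ^ k * y)) * indicator (cball x (2 ^ k * y)) t)"
    proof -
      have "f k \<le> suminf f" for f :: "nat \<Rightarrow> ennreal" using sum_le_suminf[of f "{k}"] by simp
      from this[of "\<lambda>k. ennreal (A / (4 ^ k * y)) * indicator (cball x (2 ^ k * y)) t"] show ?thesis .
    qed
    finally show ?thesis by (simp add: v_def)
  qed
  have "(\<integral>\<^sup>+t. ennreal (y / (norm (of_real t - z))\<^sup>2) * \<Phi> t \<partial>lborel)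
      \<le> (\<integral>\<^sup>+t. (\<Sum>k. ennreal (A / (4 ^ k * y)) * (\<Phi> t * indicator (cball x (2 ^ k * y)) t)) \<partial>lborel)"
  proof (intro nn_integral_mono)
    fix t
    have "ennreal (y / (norm (of_real t - z))\<^sup>2) * \<Phi> t \<le> (\<Sum>k. ennreal (A / (4 ^ k * y)) * indicator (cball x (2 ^ k * y)) t) * \<Phi> t"
      by (intro mult_right_mono bd) auto
    also have "\<dots> = (\<Sum>k. ennreal (A / (4 ^ k * y)) * (\<Phi> t * indicator (cball x (2 ^ k * y)) t))"
      by (subst ennreal_suminf_multc[symmetric]) (simp add: mult_ac)
    finally show "ennreal (y / (norm (of_real t - z))\<^sup>2) * \<Phi> t \<le> \<dots>" .
  qed
  also have "\<dots> = (\<Sum>k. \<integral>\<^sup>+t. ennreal (A / (4 ^ k * y)) * (\<Phi> t * indicator (cball x (2 ^ k * y)) t) \<partial>lborel)"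
    by (rule nn_integral_suminf) measurable
  also have "\<dots> = (\<Sum>k. ennreal (A / (4 ^ k * y)) * (\<integral>\<^sup>+t. \<Phi> t * indicator (cball x (2 ^ k * y)) t \<partial>lborel))"
    by (intro suminf_cong nn_integral_cmult) measurable
  also have "\<dots> \<le> (\<Sum>k. ennreal (A * L * (1 / 2) ^ k))"
  proof (rule suminf_le)
    fix k
    have "ennreal (A / (4 ^ k * y)) * (\<integral>\<^sup>+t. \<Phi> t * indicator (cball x (2 ^ k * y)) t \<partial>lborel) \<le> ennreal (A / (4 ^ k * y)) * ennreal (L * (2 ^ k * y))"
      using y by (intro mult_left_mono L(2)) auto
    also have "\<dots> = ennreal (A * L * (1 / 2) ^ k)"
    proof -
      have "(4::real) ^ k = 2 ^ k * 2 ^ k" by (simp flip: power_mult_distrib)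
      thus ?thesis using y A L(1) by (subst ennreal_mult[symmetric]) (auto simp: field_simps)
    qed
    finally show "ennreal (A / (4 ^ k * y)) * (\<integral>\<^sup>+t. \<Phi> t * indicator (cball x (2 ^ k * y)) t \<partial>lborel) \<le> \<dots>" .
  qed auto
  also have "\<dots> = ennreal (\<Sum>k. A * L * (1 / 2) ^ k)"
    using A L(1) by (intro suminf_ennreal2) (auto intro!: summable_mult)
  also have "(\<Sum>k. A * L * (1 / 2) ^ k) = A * L * 2"
    by (subst suminf_mult) (auto simp: suminf_geometric)
  finally show ?thesis by (simp add: y_def A_def mult_ac)
qed

section \<open>Finite sums of the orthogonal basis\<close>

text \<open>The functions (z - p)^n / (z - cnj p)^(n + 1) are, up to a common constant, the images of the
  monomials under the isometry of Hardy spaces given by the Cayley transform at p.\<close>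
definition hardy_block :: "complex \<Rightarrow> (nat \<Rightarrow> complex) \<Rightarrow> nat set \<Rightarrow> complex \<Rightarrow> complex" where
  "hardy_block p b A z = (\<Sum>n\<in>A. b n * ((z - p) ^ n / (z - cnj p) ^ Suc n))"

lemma neq_cnj: "Im z > - Im p \<Longrightarrow> z \<noteq> cnj p"
  by auto

lemma holomorphic_hardy_block: "hardy_block p b A holomorphic_on {z. Im z > - Im p}"
  unfolding hardy_block_def by (intro holomorphic_intros) (auto dest: neq_cnj)

lemma norm_hardy_block_le:
  assumes "Im p > 0" "Im z \<ge> 0"
  shows "norm (hardy_block p b A z) \<le> (\<Sum>n\<in>A. norm (b n)) / norm (z - cnj p)"
proof -
  have pos: "norm (z - cnj p) > 0" using Im_le_norm_minus_cnj[OF assms] assms(1) by linarith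
  have "norm (b n * ((z - p) ^ n / (z - cnj p) ^ Suc n)) \<le> norm (b n) / norm (z - cnj p)" for n
  proof -
    have "norm (z - p) ^ n \<le> norm (z - cnj p) ^ n"
      by (intro power_mono norm_minus_le_norm_minus_cnj assms) auto
    hence "norm ((z - p) ^ n / (z - cnj p) ^ Suc n) \<le> 1 / norm (z - cnj p)"
      using pos by (simp add: norm_divide norm_power norm_mult divide_simps)
    hence "norm (b n) * norm ((z - p) ^ n / (z - cnj p) ^ Suc n) \<le> norm (b n) * (1 / norm (z - cnj p))"
      by (intro mult_left_mono) auto
    also have "\<dots> = norm (b n) / norm (z - cnj p)" by simp
    finally show ?thesis unfolding norm_mult[of "b n"] .
  qed
  thus ?thesis unfolding hardy_block_def sum_divide_distrib by (intro sum_norm_le)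
qed

text \<open>On the real line conjugation interchanges z - p and z - cnj p.  Hence the product is the
  restriction of a rational function whose only pole is at cnj p and which is O(1 / |z|^2).\<close>
lemma hardy_basis_orthogonal:
  assumes p: "Im p > 0" and "m < n"
  shows "has_bochner_integral lborel (\<lambda>x. ((of_real x - p) ^ n / (of_real x - cnj p) ^ Suc n) *
            cnj ((of_real x - p) ^ m / (of_real x - cnj p) ^ Suc m)) 0"
proof -
  define F where "F = (\<lambda>z. (z - p) ^ (n - m - 1) / (z - cnj p) ^ (n - m + 1))"
  have "has_bochner_integral lborel (\<lambda>x. F (of_real x)) 0"
  proof (rule integral_real_line_zero[of F "Im p" "2 * norm p" 4])
    show "F holomorphic_on {z. Im z > - Im p}"
      unfolding F_def by (intro holomorphic_intros) (auto dest: neq_cnj)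
    show "norm (F z) \<le> 4 / (norm z)\<^sup>2" if z: "Im z \<ge> 0" "norm z \<ge> 2 * norm p" for z
    proof -
      have "p \<noteq> 0" using p by auto
      hence "norm z > 0" using z(2) by (smt (verit) zero_less_norm_iff)
      have h: "norm (z - cnj p) \<ge> norm z / 2" using norm_triangle_ineq2[of z "cnj p"] z(2) by simp
      hence pos: "norm (z - cnj p) > 0" using \<open>norm z > 0\<close> by linarith
      have nm: "n - m + 1 = (n - m - 1) + 2" using assms(2) by simp
      have "norm (z - p) ^ (n - m - 1) \<le> norm (z - cnj p) ^ (n - m - 1)"
        by (intro power_mono norm_minus_le_norm_minus_cnj p z) auto
      hence "norm (F z) \<le> 1 / (norm (z - cnj p))\<^sup>2"
        using pos unfolding F_def nm power_add by (simp add: norm_divide norm_power norm_mult divide_simps)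
      also have "\<dots> \<le> 1 / (norm z / 2)\<^sup>2" using h pos \<open>norm z > 0\<close>
        by (intro divide_left_mono power_mono mult_pos_pos zero_less_power) auto
      finally show ?thesis by (simp add: power_divide)
    qed
  qed (use p in auto)
  moreover have "((of_real x - p) ^ n / (of_real x - cnj p) ^ Suc n) *
            cnj ((of_real x - p) ^ m / (of_real x - cnj p) ^ Suc m) = F (of_real x)" for x
  proof -
    define u v where "u = of_real x - p" and "v = of_real x - cnj p"
    have "u \<noteq> 0" "v \<noteq> 0" using p by (auto simp: u_def v_def complex_eq_iff)
    moreover have "cnj u = v" "cnj v = u" by (auto simp: u_def v_def)
    moreover obtain k where k: "n = m + Suc k" using assms(2) less_imp_Suc_add by auto
    ultimately show ?thesis unfolding F_def u_def[symmetric] v_def[symmetric] 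
      by (simp add: power_add field_simps)
  qed
  ultimately show ?thesis by simp
qed

lemma hardy_block_norm:
  assumes p: "Im p > 0" and fin: "finite A"
  shows "has_bochner_integral lborel (\<lambda>x. (norm (hardy_block p b A (of_real x)))\<^sup>2) (pi / Im p * (\<Sum>n\<in>A. (norm (b n))\<^sup>2))"
proof -
  define e where "e = (\<lambda>n x. (of_real x - p) ^ n / (of_real x - cnj p) ^ Suc n)"
  have orth: "has_bochner_integral lborel (\<lambda>x. e n x * cnj (e m x)) (if n = m then of_real (pi / Im p) else 0)" for m n
  proof -
    consider "m < n" | "n < m" | "n = m" by linarith
    thus ?thesis
    proof cases
      case 1
      thus ?thesis using hardy_basis_orthogonal[OF p 1] by (simp add: e_def)
    next
      case 2
      have "has_bochner_integral lborel (\<lambda>x. cnj (e m x * cnj (e n x))) (cnj 0)"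
        by (rule has_bochner_integral_cnj) (use hardy_basis_orthogonal[OF p 2] in \<open>simp add: e_def\<close>)
      thus ?thesis using 2 by (simp add: mult.commute)
    next
      case 3
      have "e n x * cnj (e n x) = of_real (1 / (norm (of_real x - p))\<^sup>2)" for x
      proof -
        have "norm (of_real x - cnj p) = norm (of_real x - p)"
          using complex_mod_cnj[of "of_real x - p"] by simp
        moreover have "norm (of_real x - p) > 0" by (rule norm_of_real_minus_pos[OF p])
        ultimately have "norm (e n x) = 1 / norm (of_real x - p)"
          by (simp add: e_def norm_divide norm_power norm_mult)
        thus ?thesis using complex_norm_square[of "e n x"] by (simp add: power_divide)
      qed
      thus ?thesis using has_bochner_integral_of_real[OF has_bochner_integral_inverse_norm[OF p], where 'a = complex] 3
        by simp
    qed
  qed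
  have "has_bochner_integral lborel (\<lambda>x. \<Sum>n\<in>A. \<Sum>m\<in>A. (b n * cnj (b m)) * (e n x * cnj (e m x)))
          (\<Sum>n\<in>A. \<Sum>m\<in>A. (b n * cnj (b m)) * (if n = m then of_real (pi / Im p) else 0))"
    by (intro has_bochner_integral_sum has_bochner_integral_mult_right orth)
  moreover have blk: "hardy_block p b A (of_real x) = (\<Sum>n\<in>A. b n * e n x)" for x
    by (simp add: hardy_block_def e_def)
  have "(\<Sum>n\<in>A. \<Sum>m\<in>A. (b n * cnj (b m)) * (e n x * cnj (e m x))) = of_real ((norm (hardy_block p b A (of_real x)))\<^sup>2)" for x
    unfolding complex_norm_square blk cnj_sum sum_product
    by (intro sum.cong refl) (simp add: mult_ac)
  moreover have "(\<Sum>n\<in>A. \<Sum>m\<in>A. (b n * cnj (b m)) * (if n = m then of_real (pi / Im p) else 0))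
      = complex_of_real (pi / Im p * (\<Sum>n\<in>A. (norm (b n))\<^sup>2))"
    using fin by (simp add: if_distrib[of "\<lambda>x. _ * x"] sum.delta sum_distrib_left complex_norm_square mult_ac
       flip: complex_norm_square cong: if_cong)
  ultimately have "has_bochner_integral lborel (\<lambda>x. complex_of_real ((norm (hardy_block p b A (of_real x)))\<^sup>2))
       (complex_of_real (pi / Im p * (\<Sum>n\<in>A. (norm (b n))\<^sup>2)))" by simp
  from has_bochner_integral_Re[OF this] show ?thesis by simp
qed

text \<open>Poisson's formula for the bounded function \<open>f z * (z - cnj w)\<close>: on the real line the extra
  factor cancels one of the two factors of |x - w|^2.\<close>
lemma hardy_block_cauchy:
  assumes p: "Im p > 0" and w: "Im w > 0"
  shows "has_bochner_integral lborel (\<lambda>x. hardy_block p b A (of_real x) / (of_real x - w)) (2 * of_real pi * \<i> * hardy_block p b A w)"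
proof -
  let ?f = "hardy_block p b A"
  define B where "B = (\<Sum>n\<in>A. norm (b n))"
  have B: "B \<ge> 0" unfolding B_def by (intro sum_nonneg) auto
  define G where "G = (\<lambda>z. ?f z * (z - cnj w))"
  have "has_bochner_integral lborel (\<lambda>x. of_real (Im w / (norm (of_real x - w))\<^sup>2) * G (of_real x)) (of_real pi * G w)"
  proof (rule poisson_formula[of G "Im p" "B * (1 + norm (p - w) / Im p)"])
    show "G holomorphic_on {z. Im z > - Im p}"
      unfolding G_def by (intro holomorphic_intros holomorphic_hardy_block)
    fix z :: complex assume z: "Im z \<ge> 0"
    have ge: "norm (z - cnj p) \<ge> Im p" by (rule Im_le_norm_minus_cnj[OF p z])
    have "norm (z - cnj w) \<le> norm (z - cnj p) + norm (p - w)"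
      using norm_triangle_ineq[of "z - cnj p" "cnj (p - w)"] by (subst complex_mod_cnj[symmetric, of "p - w"]) simp
    also have "\<dots> \<le> norm (z - cnj p) * (1 + norm (p - w) / Im p)"
    proof -
      have "norm (p - w) * 1 \<le> norm (p - w) * (norm (z - cnj p) / Im p)"
        using ge p by (intro mult_left_mono) auto
      thus ?thesis by (simp add: algebra_simps)
    qed
    finally have "norm (G z) \<le> B / norm (z - cnj p) * (norm (z - cnj p) * (1 + norm (p - w) / Im p))"
      unfolding G_def norm_mult using norm_hardy_block_le[OF p z, of b A] B
      by (intro mult_mono) (auto simp: B_def)
    thus "norm (G z) \<le> B * (1 + norm (p - w) / Im p)" using ge p by (auto split: if_splits)
  qed (use p w in auto)
  moreover have "of_real (Im w / (norm (of_real x - w))\<^sup>2) * G (of_real x) = of_real (Im w) * (?f (of_real x) / (of_real x - w))" for x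
  proof -
    have "of_real x - w \<noteq> 0" "of_real x - cnj w \<noteq> 0" using w by (auto simp: complex_eq_iff)
    moreover have "of_real ((norm (of_real x - w))\<^sup>2) = (of_real x - w) * (of_real x - cnj w)"
      using complex_norm_square[of "of_real x - w"] by simp
    ultimately show ?thesis by (simp add: G_def del: of_real_power)
  qed
  moreover have "G w = of_real (Im w) * (2 * \<i> * ?f w)"
    using complex_diff_cnj[of w] by (simp add: G_def mult_ac)
  ultimately have "has_bochner_integral lborel (\<lambda>x. of_real (Im w) * (?f (of_real x) / (of_real x - w))) (of_real (Im w) * (2 * of_real pi * \<i> * ?f w))"
    by (simp add: mult_ac)
  from has_bochner_integral_mult_right[OF this, of "1 / of_real (Im w)"] show ?thesis using w by simp
qed

lemma measurable_hardy_block [measurable]: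
  assumes "Im p > 0"
  shows "(\<lambda>x::real. hardy_block p b A (of_real x)) \<in> borel_measurable borel"
proof -
  have "continuous_on UNIV (\<lambda>x::real. hardy_block p b A (of_real x))"
    using holomorphic_on_imp_continuous_on[OF holomorphic_hardy_block[of p b A]] assms
    by (rule_tac continuous_on_compose2) (auto intro!: continuous_intros)
  thus ?thesis by (rule borel_measurable_continuous_onI)
qed

text \<open>The square of the rational function is again holomorphic and bounded, so Poisson's formula
  applies to it; taking absolute values gives the
  subharmonicity of |f|^2 up to the boundary.\<close>
lemma hardy_block_le_poisson:
  assumes p: "Im p > 0" and z: "Im z > 0"
  shows "ennreal (pi * (norm (hardy_block p b A z))\<^sup>2)
     \<le> (\<integral>\<^sup>+t. ennreal (Im z / (norm (of_real t - z))\<^sup>2) * ennreal ((norm (hardy_block p b A (of_real t)))\<^sup>2) \<partial>lborel)"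
proof -
  let ?f = "hardy_block p b A"
  define B where "B = (\<Sum>n\<in>A. norm (b n))"
  have B: "B \<ge> 0" unfolding B_def by (intro sum_nonneg) auto
  have P: "has_bochner_integral lborel (\<lambda>x. of_real (Im z / (norm (of_real x - z))\<^sup>2) * (?f (of_real x))\<^sup>2) (of_real pi * (?f z)\<^sup>2)"
  proof (rule poisson_formula[of "\<lambda>z. (?f z)\<^sup>2" "Im p" "(B / Im p)\<^sup>2"])
    show "(\<lambda>z. (?f z)\<^sup>2) holomorphic_on {z. Im z > - Im p}"
      by (intro holomorphic_intros holomorphic_hardy_block)
    fix z :: complex assume z: "Im z \<ge> 0"
    have "norm (?f z) \<le> B / norm (z - cnj p)" unfolding B_def by (rule norm_hardy_block_le[OF p z])
    also have "\<dots> \<le> B / Im p" using Im_le_norm_minus_cnj[OF p z] p B by (intro divide_left_mono mult_pos_pos) auto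
    finally show "norm ((?f z)\<^sup>2) \<le> (B / Im p)\<^sup>2" unfolding norm_power by (intro power_mono) auto
  qed (use p z in auto)
  have "pi * (norm (?f z))\<^sup>2 = norm (of_real pi * (?f z)\<^sup>2)" by (simp add: norm_mult norm_power)
  also have "\<dots> = norm (LINT x|lborel. of_real (Im z / (norm (of_real x - z))\<^sup>2) * (?f (of_real x))\<^sup>2)"
    using P by (simp add: has_bochner_integral_iff)
  finally have "ennreal (pi * (norm (?f z))\<^sup>2) = ennreal (norm (LINT x|lborel. of_real (Im z / (norm (of_real x - z))\<^sup>2) * (?f (of_real x))\<^sup>2))"
    by simp
  also have "\<dots> \<le> (\<integral>\<^sup>+x. ennreal (norm (of_real (Im z / (norm (of_real x - z))\<^sup>2) * (?f (of_real x))\<^sup>2)) \<partial>lborel)"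
    using P by (intro integral_norm_bound_ennreal) (simp add: has_bochner_integral_iff)
  also have "\<dots> = (\<integral>\<^sup>+t. ennreal (Im z / (norm (of_real t - z))\<^sup>2) * ennreal ((norm (?f (of_real t)))\<^sup>2) \<partial>lborel)"
    using z by (intro nn_integral_cong, subst ennreal_mult[symmetric]) (auto simp: norm_mult norm_power norm_divide)
  finally show ?thesis .
qed

section \<open>Boundary values in the half-plane\<close>

lemma frontier_upper_half_plane: "frontier upper_half_plane = {z. Im z = 0}"
proof -
  have "frontier {z. \<i> \<bullet> z > 0} = {z. \<i> \<bullet> z = 0}"
    by (rule frontier_halfspace_gt) auto
  thus ?thesis by (simp add: upper_half_plane_def)
qed

lemma infdist_frontier_upper_half_plane:
  assumes "Im z > 0"
  shows "infdist z (frontier upper_half_plane) = Im z"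
proof (rule antisym)
  have "infdist z {z. Im z = 0} \<le> dist z (of_real (Re z))" by (rule infdist_le) simp
  also have "\<dots> = Im z" using assms by (simp add: dist_complex_def cmod_def)
  finally show "infdist z (frontier upper_half_plane) \<le> Im z" by (simp add: frontier_upper_half_plane)
  have ne: "{z. Im z = 0} \<noteq> {}" by (auto intro: exI[of _ 0])
  have "Im z \<le> dist z u" if "Im u = 0" for u
    using abs_Im_le_cmod[of "z - u"] that by (simp add: dist_norm)
  thus "Im z \<le> infdist z (frontier upper_half_plane)"
    unfolding frontier_upper_half_plane infdist_notempty[OF ne] by (intro cINF_greatest ne) auto
qed

lemma nt_region_upper_half_plane:
  "nt_region upper_half_plane p a = {z. Im z > 0 \<and> norm (z - p) < (1 + a) * Im z}"
  by (auto simp: nt_region_def dist_norm upper_half_plane_def infdist_frontier_upper_half_plane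
      dest: infdist_frontier_upper_half_plane)

lemma geometric_blocks:
  fixes c :: "nat \<Rightarrow> real"
  assumes "summable c" "\<And>n. c n \<ge> 0"
  obtains N :: "nat \<Rightarrow> nat" where "strict_mono N" "\<And>k. sum c {N k..<N (Suc k)} \<le> (1 / 16) ^ k"
proof -
  have "\<forall>k. \<exists>M. \<forall>m\<ge>M. \<forall>n. norm (sum c {m..<n}) < (1 / 16) ^ k"
    using assms(1) unfolding summable_Cauchy by simp
  then obtain M where M: "\<And>k m n. m \<ge> M k \<Longrightarrow> norm (sum c {m..<n}) < (1 / 16) ^ k" by metis
  define N where "N = (\<lambda>k. k + (\<Sum>j\<le>k. M j))"
  have "strict_mono N" by (rule strict_monoI_Suc) (simp add: N_def)
  moreover have "N k \<ge> M k" for k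
    unfolding N_def by (intro trans_le_add2 member_le_sum) auto
  hence "sum c {N k..<N (Suc k)} \<le> (1 / 16) ^ k" for k
    using M[of k "N k" "N (Suc k)"] by simp
  ultimately show ?thesis using that by blast
qed

text \<open>The tail of a convergent series of squares can be cut into blocks as small as desired.  The weights
  \<open>4 ^ k\<close> in \<open>\<Phi>\<close> are heavy enough to turn a bound for \<open>\<Phi>\<close>, or for its Poisson integral, into the
  bound \<open>2 ^ - k\<close> for the block \<open>d k\<close>, and light enough for \<open>\<Phi>\<close> to be integrable.  A bound for the
  Poisson integral gives uniform convergence in cones; a bound for \<open>\<Phi>\<close> itself gives the limit
  function and the domination on the line.  One exceptional null set serves all apertures.\<close>
lemma hardy_boundary_values:
  fixes b :: "nat \<Rightarrow> complex"
  assumes p: "Im p > 0" and sm: "summable (\<lambda>n. (norm (b n))\<^sup>2)"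
    and f: "\<And>z. Im z > 0 \<Longrightarrow> (\<lambda>n. b n * ((z - p) ^ n / (z - cnj p) ^ Suc n)) sums f z"
  obtains fs where "fs \<in> borel_measurable borel"
    "AE x in lborel. has_nt_limit upper_half_plane f (of_real x) (fs x)"
    "\<And>w. Im w > 0 \<Longrightarrow> has_bochner_integral lborel (\<lambda>x. fs x / (of_real x - w)) (2 * of_real pi * \<i> * f w)"
proof -
  obtain N where N: "strict_mono N" "\<And>k. (\<Sum>n=N k..<N (Suc k). (norm (b n))\<^sup>2) \<le> (1 / 16) ^ k"
    using geometric_blocks[OF sm] by auto
  define A where "A = (\<lambda>k. case k of 0 \<Rightarrow> {0..<N 0} | Suc j \<Rightarrow> {N j..<N (Suc j)})"
  define d where "d = (\<lambda>k. hardy_block p b (A k))"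
  \<comment> \<open>The 16 compensates the shift of the index in \<open>A\<close>; the sum covers the initial block, which need not be small.\<close>
  define C where "C = pi / Im p * (16 + (\<Sum>n=0..<N 0. (norm (b n))\<^sup>2))"
  have C: "C \<ge> 0" unfolding C_def using p by (intro mult_nonneg_nonneg add_nonneg_nonneg sum_nonneg) auto
  have finA: "finite (A k)" for k by (cases k) (auto simp: A_def)
  have norm_d: "has_bochner_integral lborel (\<lambda>x. (norm (d k (of_real x)))\<^sup>2) (pi / Im p * (\<Sum>n\<in>A k. (norm (b n))\<^sup>2))" for k
    unfolding d_def by (rule hardy_block_norm[OF p finA])
  have le_d: "pi / Im p * (\<Sum>n\<in>A k. (norm (b n))\<^sup>2) \<le> C * (1 / 16) ^ k" for k
  proof (cases k)
    case 0
    thus ?thesis using p unfolding C_def A_def by (auto intro!: divide_right_mono mult_left_mono)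
  next
    case (Suc j)
    have "(\<Sum>n\<in>A k. (norm (b n))\<^sup>2) \<le> 16 * (1 / 16) ^ k" using N(2)[of j] by (simp add: A_def Suc)
    also have "\<dots> \<le> (16 + (\<Sum>n=0..<N 0. (norm (b n))\<^sup>2)) * (1 / 16) ^ k"
      by (intro mult_right_mono) (auto intro!: sum_nonneg)
    finally have "pi / Im p * (\<Sum>n\<in>A k. (norm (b n))\<^sup>2) \<le> pi / Im p * ((16 + (\<Sum>n=0..<N 0. (norm (b n))\<^sup>2)) * (1 / 16) ^ k)"
      using p by (intro mult_left_mono) auto
    thus ?thesis by (simp add: C_def mult_ac)
  qed
  have partial: "(\<Sum>k\<le>K. d k z) = hardy_block p b {0..<N K} z" for K z
  proof (induction K)
    case (Suc K)
    have "N K \<le> N (Suc K)" using N(1) by (simp add: strict_mono_less_eq)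
    thus ?case unfolding sum.atMost_Suc Suc
      by (simp add: d_def A_def hardy_block_def sum.atLeastLessThan_concat)
  qed (simp add: d_def A_def)
  have d_sums: "(\<lambda>k. d k z) sums f z" if "Im z > 0" for z
  proof -
    have "(\<lambda>n. hardy_block p b {0..<n} z) \<longlonglongrightarrow> f z"
      using f[OF that] by (simp add: sums_def hardy_block_def lessThan_atLeast0)
    hence "(\<lambda>K. hardy_block p b {0..<N K} z) \<longlonglongrightarrow> f z"
      using LIMSEQ_subseq_LIMSEQ[OF _ N(1)] by (simp add: o_def)
    thus ?thesis unfolding sums_def_le partial .
  qed
  define \<Phi> where "\<Phi> = (\<lambda>x::real. \<Sum>k. ennreal (4 ^ k * (norm (d k (of_real x)))\<^sup>2))"
  have d_meas [measurable]: "(\<lambda>x::real. d k (of_real x)) \<in> borel_measurable borel" for k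
    unfolding d_def by (rule measurable_hardy_block[OF p])
  have \<Phi>_meas [measurable]: "\<Phi> \<in> borel_measurable borel" unfolding \<Phi>_def by measurable
  have d_le_\<Phi>: "ennreal (4 ^ k * (norm (d k (of_real x)))\<^sup>2) \<le> \<Phi> x" for k and x :: real
  proof -
    have "g k \<le> suminf g" for g :: "nat \<Rightarrow> ennreal" using sum_le_suminf[of g "{k}"] by simp
    from this[of "\<lambda>k. ennreal (4 ^ k * (norm (d k (of_real x)))\<^sup>2)"] show ?thesis unfolding \<Phi>_def .
  qed
  have \<Phi>_fin: "(\<integral>\<^sup>+x. \<Phi> x \<partial>lborel) < \<infinity>"
  proof -
    have "(\<integral>\<^sup>+x. \<Phi> x \<partial>lborel) = (\<Sum>k. \<integral>\<^sup>+x. ennreal (4 ^ k * (norm (d k (of_real x)))\<^sup>2) \<partial>lborel)"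
      unfolding \<Phi>_def by (rule nn_integral_suminf) measurable
    also have "\<dots> \<le> (\<Sum>k. ennreal (C * (1 / 4) ^ k))"
    proof (rule suminf_le)
      fix k
      have "has_bochner_integral lborel (\<lambda>x. 4 ^ k * (norm (d k (of_real x)))\<^sup>2) (4 ^ k * (pi / Im p * (\<Sum>n\<in>A k. (norm (b n))\<^sup>2)))"
        by (rule has_bochner_integral_mult_right[OF norm_d])
      hence "(\<integral>\<^sup>+x. ennreal (4 ^ k * (norm (d k (of_real x)))\<^sup>2) \<partial>lborel) = ennreal (4 ^ k * (pi / Im p * (\<Sum>n\<in>A k. (norm (b n))\<^sup>2)))"
        by (subst nn_integral_eq_integral) (auto simp: has_bochner_integral_iff)
      also have "\<dots> \<le> ennreal (4 ^ k * (C * (1 / 16) ^ k))"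
        by (intro ennreal_leI mult_left_mono le_d) auto
      also have "4 ^ k * (C * (1 / 16) ^ k) = C * (1 / 4) ^ k"
        by (simp add: mult.left_commute flip: power_mult_distrib)
      finally show "(\<integral>\<^sup>+x. ennreal (4 ^ k * (norm (d k (of_real x)))\<^sup>2) \<partial>lborel) \<le> ennreal (C * (1 / 4) ^ k)" .
    qed auto
    also have "\<dots> = ennreal (\<Sum>k. C * (1 / 4) ^ k)"
      using C by (intro suminf_ennreal2) (auto intro!: summable_mult)
    finally show ?thesis by (simp add: order_le_less_trans)
  qed
  have \<Phi>_AE: "AE x in lborel. \<Phi> x \<noteq> \<infinity>"
    using \<Phi>_fin by (intro nn_integral_PInf_AE) (auto simp: less_top)
  have four: "(2 ^ k * t)\<^sup>2 = 4 ^ k * t\<^sup>2" for k and t :: real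
    by (simp add: power_mult_distrib power2_eq_square flip: power_mult_distrib[of _ _ k])
  have d_bound: "norm (d k (of_real x)) \<le> sqrt (enn2real (\<Phi> x)) * (1 / 2) ^ k" if "\<Phi> x \<noteq> \<infinity>" for x :: real and k
  proof -
    have "4 ^ k * (norm (d k (of_real x)))\<^sup>2 \<le> enn2real (\<Phi> x)"
      using d_le_\<Phi>[of k x] that by (cases "\<Phi> x") auto
    hence "(2 ^ k * norm (d k (of_real x)))\<^sup>2 \<le> enn2real (\<Phi> x)"
      by (simp only: four)
    hence "2 ^ k * norm (d k (of_real x)) \<le> sqrt (enn2real (\<Phi> x))" by (rule real_le_rsqrt)
    thus ?thesis by (simp add: field_simps power_divide)
  qed
  define fs where "fs = (\<lambda>x::real. \<Sum>k. d k (of_real x))"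
  have fs_meas [measurable]: "fs \<in> borel_measurable borel" unfolding fs_def by measurable
  have geo: "summable (\<lambda>k. c * (1 / 2) ^ k :: real)" for c by (intro summable_mult) auto
  have fs_sums: "(\<lambda>k. d k (of_real x)) sums fs x" if "\<Phi> x \<noteq> \<infinity>" for x
    unfolding fs_def by (rule summable_sums, rule summable_comparison_test[OF _ geo]) (use d_bound[OF that] in auto)
  have nt: "has_nt_limit upper_half_plane f (of_real x) (fs x)"
    if x: "\<Phi> x \<noteq> \<infinity>" and L: "L \<ge> 0" "\<And>r. r > 0 \<Longrightarrow> (\<integral>\<^sup>+t. \<Phi> t * indicator (cball x r) t \<partial>lborel) \<le> ennreal (L * r)" for x L
    unfolding has_nt_limit_def
  proof (intro allI impI)
    fix a :: real assume a: "a > 0"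
    define R where "R = nt_region upper_half_plane (of_real x) a"
    have R: "Im z > 0" "norm (z - of_real x) < (1 + a) * Im z" if "z \<in> R" for z
      using that by (auto simp: R_def nt_region_upper_half_plane)
    define Q where "Q = 8 * (2 + a)\<^sup>2 * L"
    have Q: "Q \<ge> 0" using L(1) by (simp add: Q_def)
    have bd: "norm (d k z) \<le> sqrt (Q / pi) * (1 / 2) ^ k" if z: "z \<in> R" for k z
    proof -
      have "ennreal (4 ^ k * (pi * (norm (d k z))\<^sup>2)) = ennreal (4 ^ k) * ennreal (pi * (norm (d k z))\<^sup>2)"
        by (intro ennreal_mult) auto
      also have "\<dots> \<le> ennreal (4 ^ k) * (\<integral>\<^sup>+t. ennreal (Im z / (norm (of_real t - z))\<^sup>2) * ennreal ((norm (d k (of_real t)))\<^sup>2) \<partial>lborel)"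
        unfolding d_def by (intro mult_left_mono hardy_block_le_poisson p R z) auto
      also have "\<dots> = (\<integral>\<^sup>+t. ennreal (Im z / (norm (of_real t - z))\<^sup>2) * ennreal (4 ^ k * (norm (d k (of_real t)))\<^sup>2) \<partial>lborel)"
        by (subst nn_integral_cmult[symmetric]) (auto simp: ennreal_mult mult_ac)
      also have "\<dots> \<le> (\<integral>\<^sup>+t. ennreal (Im z / (norm (of_real t - z))\<^sup>2) * \<Phi> t \<partial>lborel)"
        by (intro nn_integral_mono mult_left_mono d_le_\<Phi>) auto
      also have "\<dots> \<le> ennreal Q"
        unfolding Q_def by (rule poisson_integral_le_maximal[OF \<Phi>_meas L R(1)[OF z] R(2)[OF z] a])
      finally have "4 ^ k * (pi * (norm (d k z))\<^sup>2) \<le> Q" using Q by simp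
      hence "(2 ^ k * norm (d k z))\<^sup>2 \<le> Q / pi"
        unfolding four by (simp add: field_simps)
      hence "2 ^ k * norm (d k z) \<le> sqrt (Q / pi)" by (rule real_le_rsqrt)
      thus ?thesis by (simp add: field_simps power_divide)
    qed
    have "uniform_limit R (\<lambda>K z. \<Sum>k<K. d k z) (\<lambda>z. \<Sum>k. d k z) sequentially"
      by (rule Weierstrass_m_test[OF bd geo])
    hence u: "uniform_limit R (\<lambda>K z. \<Sum>k<K. d k z) f sequentially"
      unfolding uniform_limit_iff using d_sums R(1) by (simp add: sums_iff cong: ball_cong)
    have t: "((\<lambda>z. \<Sum>k<K. d k z) \<longlongrightarrow> (\<Sum>k<K. d k (of_real x))) (at (of_real x) within R)" for K
    proof (intro tendsto_sum)
      fix k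
      have "continuous_on {z. Im z > - Im p} (d k)"
        unfolding d_def by (rule holomorphic_on_imp_continuous_on[OF holomorphic_hardy_block])
      hence "isCont (d k) (of_real x)"
        using p by (subst (asm) continuous_on_eq_continuous_at) (auto simp: open_halfspace_Im_gt)
      thus "(d k \<longlongrightarrow> d k (of_real x)) (at (of_real x) within R)"
        unfolding isCont_def by (rule tendsto_within_subset) auto
    qed
    show "(f \<longlongrightarrow> fs x) (at (of_real x) within nt_region upper_half_plane (of_real x) a)"
      unfolding R_def[symmetric]
      by (rule swap_uniform_limit[OF _ _ u, of "\<lambda>K. \<Sum>k<K. d k (of_real x)"])
         (use t fs_sums[OF x] in \<open>auto simp: sums_def\<close>)
  qed
  have 1: "AE x in lborel. has_nt_limit upper_half_plane f (of_real x) (fs x)"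
    using AE_maximal_function_finite[OF \<Phi>_meas \<Phi>_fin] \<Phi>_AE
    by eventually_elim (use nt in blast)
  have 2: "has_bochner_integral lborel (\<lambda>x. fs x / (of_real x - w)) (2 * of_real pi * \<i> * f w)" if w: "Im w > 0" for w
  proof -
    let ?s = "\<lambda>K x. (\<Sum>k<K. d k (of_real x)) / (of_real x - w)"
    have s: "has_bochner_integral lborel (?s K) (2 * of_real pi * \<i> * (\<Sum>k<K. d k w))" for K
      unfolding sum_divide_distrib sum_distrib_left
      unfolding d_def by (intro has_bochner_integral_sum hardy_block_cauchy p w)
    have int\<Phi>: "integrable lborel (\<lambda>x. enn2real (\<Phi> x))"
    proof (rule integrableI_bounded)
      have "(\<integral>\<^sup>+x. ennreal (norm (enn2real (\<Phi> x))) \<partial>lborel) \<le> (\<integral>\<^sup>+x. \<Phi> x \<partial>lborel)"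
        by (intro nn_integral_mono) (simp add: ennreal_enn2real_if)
      thus "(\<integral>\<^sup>+x. ennreal (norm (enn2real (\<Phi> x))) \<partial>lborel) < \<infinity>" using \<Phi>_fin by (rule order_le_less_trans)
    qed measurable
    have dom: "integrable lborel (\<lambda>x. enn2real (\<Phi> x) + 1 / (norm (of_real x - w))\<^sup>2)"
      using has_bochner_integral_inverse_norm[OF w] int\<Phi> by (intro Bochner_Integration.integrable_add) (auto simp: has_bochner_integral_iff)
    have lim: "AE x in lborel. (\<lambda>K. ?s K x) \<longlonglongrightarrow> fs x / (of_real x - w)"
      using \<Phi>_AE
    proof eventually_elim
      case (elim x)
      have "of_real x - w \<noteq> 0" using norm_of_real_minus_pos[OF w, of x] by auto
      thus ?case using fs_sums[OF elim] by (intro tendsto_divide tendsto_const) (auto simp: sums_def)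
    qed
    \<comment> \<open>2 q v \<le> q^2 + v^2 replaces the product of two square integrable functions by an integrable sum.\<close>
    have bnd: "AE x in lborel. norm (?s K x) \<le> enn2real (\<Phi> x) + 1 / (norm (of_real x - w))\<^sup>2" for K
      using \<Phi>_AE
    proof eventually_elim
      case (elim x)
      define q where "q = sqrt (enn2real (\<Phi> x))"
      define v where "v = 1 / norm (of_real x - w)"
      have "norm (\<Sum>k<K. d k (of_real x)) \<le> (\<Sum>k<K. q * (1 / 2) ^ k)"
        unfolding q_def by (intro sum_norm_le d_bound elim)
      also have "\<dots> \<le> (\<Sum>k. q * (1 / 2) ^ k)"
        by (intro sum_le_suminf geo) (auto simp: q_def)
      also have "\<dots> = 2 * q" by (subst suminf_mult) (auto simp: suminf_geometric)
      finally have "norm (?s K x) \<le> 2 * q * v"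
        by (simp add: norm_divide v_def divide_right_mono)
      also have "\<dots> \<le> q\<^sup>2 + v\<^sup>2" by (rule sum_squares_bound)
      finally show ?case by (simp add: q_def v_def power_divide)
    qed
    have m: "(\<lambda>x. fs x / (of_real x - w)) \<in> borel_measurable lborel" "?s K \<in> borel_measurable lborel" for K
      by measurable
    note DC = integral_dominated_convergence[OF m(1) m(2) dom lim bnd]
    note DI = integrable_dominated_convergence[OF m(1) m(2) dom lim bnd]
    have "(\<lambda>K. 2 * of_real pi * \<i> * (\<Sum>k<K. d k w)) \<longlonglongrightarrow> 2 * of_real pi * \<i> * f w"
      using d_sums[OF w] by (intro tendsto_intros) (simp add: sums_def)
    moreover have "(LINT x|lborel. ?s K x) = 2 * of_real pi * \<i> * (\<Sum>k<K. d k w)" for K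
      using s[of K] by (simp add: has_bochner_integral_iff)
    ultimately have "(LINT x|lborel. fs x / (of_real x - w)) = 2 * of_real pi * \<i> * f w"
      using LIMSEQ_unique[OF DC] by simp
    thus ?thesis using DI by (simp add: has_bochner_integral_iff)
  qed
  show ?thesis by (rule that[OF fs_meas 1 2])
qed

section \<open>Hardy spaces and conformal maps\<close>

lemma has_integral_cis_int:
  "((\<lambda>t. cis (of_int k * t)) has_integral (if k = 0 then 2 * of_real pi else 0)) {0..2*pi}"
proof (cases "k = 0")
  case True
  thus ?thesis using has_integral_const_real[of "1::complex" 0 "2 * pi"] by (simp add: scaleR_conv_of_real)
next
  case False
  have "((\<lambda>t. cis (of_int k * t)) has_integral cis (of_int k * (2 * pi)) / (\<i> * of_int k) - cis (of_int k * 0) / (\<i> * of_int k)) {0..2*pi}"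
  proof (rule fundamental_theorem_of_calculus)
    fix t :: real
    show "((\<lambda>t. cis (of_int k * t) / (\<i> * of_int k)) has_vector_derivative cis (of_int k * t)) (at t within {0..2*pi})"
    proof -
      have "((\<lambda>u. exp (\<i> * (of_int k * u)) / (\<i> * of_int k)) has_field_derivative exp (\<i> * (of_int k * of_real t))) (at (of_real t))"
        using False by (auto intro!: derivative_eq_intros simp: mult_ac)
      from has_vector_derivative_real_field[OF this] show ?thesis by (simp add: cis_conv_exp)
    qed
  qed auto
  moreover have "cis (of_int k * (2 * pi)) = 1" using cis_multiple_2pi[of "of_int k"] by (simp add: mult_ac)
  ultimately show ?thesis using False by simp
qed

lemma has_integral_norm_trig_poly:
  fixes c :: "nat \<Rightarrow> complex"
  shows "((\<lambda>t. (norm (\<Sum>n<M. c n * cis (of_nat n * t)))\<^sup>2) has_integral 2 * pi * (\<Sum>n<M. (norm (c n))\<^sup>2)) {0..2*pi}"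
proof -
  have "((\<lambda>t. \<Sum>n<M. \<Sum>m<M. (c n * cnj (c m)) * cis (of_int (int n - int m) * t)) has_integral
          (\<Sum>n<M. \<Sum>m<M. (c n * cnj (c m)) * (if int n - int m = 0 then 2 * of_real pi else 0))) {0..2*pi}"
    by (intro has_integral_sum has_integral_mult_right has_integral_cis_int) auto
  moreover have "(\<Sum>n<M. \<Sum>m<M. (c n * cnj (c m)) * cis (of_int (int n - int m) * t)) = of_real ((norm (\<Sum>n<M. c n * cis (of_nat n * t)))\<^sup>2)" for t
    unfolding complex_norm_square cnj_sum sum_product
  proof (intro sum.cong refl)
    fix n m
    have "cis (of_int (int n - int m) * t) = cis (of_nat n * t) * cnj (cis (of_nat m * t))"
      by (simp add: cis_cnj cis_mult left_diff_distrib)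
    thus "c n * cnj (c m) * cis (of_int (int n - int m) * t)
        = c n * cis (of_nat n * t) * cnj (c m * cis (of_nat m * t))" by simp
  qed
  moreover have "(\<Sum>n<M. \<Sum>m<M. (c n * cnj (c m)) * (if int n - int m = 0 then 2 * of_real pi else 0))
       = complex_of_real (2 * pi * (\<Sum>n<M. (norm (c n))\<^sup>2))"
    by (simp add: if_distrib[of "\<lambda>x. _ * x"] sum.delta sum_distrib_left mult_ac
       flip: complex_norm_square cong: if_cong)
  ultimately have "((\<lambda>t. complex_of_real ((norm (\<Sum>n<M. c n * cis (of_nat n * t)))\<^sup>2)) has_integral
     complex_of_real (2 * pi * (\<Sum>n<M. (norm (c n))\<^sup>2))) {0..2*pi}" by simp
  from has_integral_Re[OF this] show ?thesis by simp
qed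

text \<open>Parseval's identity for the Taylor polynomials on the circle of radius r bounds the weighted
  coefficient sums; first the degree tends to infinity, then r to 1.\<close>
lemma hardy_disc_summable:
  assumes "g \<in> hardy_disc"
  shows "summable (\<lambda>n. (norm ((deriv ^^ n) g 0 / fact n))\<^sup>2)"
proof -
  from assms obtain C where hol: "g holomorphic_on ball 0 1"
    and C': "\<forall>r\<in>{0..<1}. integral {0..2*pi} (\<lambda>t. (norm (g (of_real r * cis t)))\<^sup>2) \<le> C"
    unfolding hardy_disc_def by blast
  have C: "integral {0..2*pi} (\<lambda>t. (norm (g (of_real r * cis t)))\<^sup>2) \<le> C" if "0 \<le> r" "r < 1" for r
    using C' that by auto
  define a where "a = (\<lambda>n. (deriv ^^ n) g 0 / fact n)"
  have sums: "(\<lambda>n. a n * z ^ n) sums g z" if "norm z < 1" for z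
    using holomorphic_power_series[OF hol, of z] that by (simp add: a_def)
  have le: "2 * pi * (\<Sum>n<N. (norm (a n))\<^sup>2 * r ^ (2 * n)) \<le> C" if r: "0 < r" "r < 1" for r N
  proof -
    define S where "S = (\<lambda>M t. (norm (\<Sum>n<M. (a n * of_real r ^ n) * cis (of_nat n * t)))\<^sup>2)"
    obtain r' where r': "r < r'" "r' < 1" using r dense by blast
    have "summable (\<lambda>n. norm (a n * of_real r ^ n))"
      by (rule powser_insidea[OF sums_summable[OF sums[of "of_real r'"]]]) (use r r' in auto)
    hence sm: "summable (\<lambda>n. norm (a n) * r ^ n)" using r by (simp add: norm_mult norm_power)
    have S: "(S M has_integral 2 * pi * (\<Sum>n<M. (norm (a n))\<^sup>2 * r ^ (2 * n))) {0..2*pi}" for M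
      using has_integral_norm_trig_poly[where c = "\<lambda>n. a n * of_real r ^ n" and M = M] r
      by (simp add: S_def norm_mult norm_power power_mult_distrib power_mult[symmetric] mult.commute)
    have "(\<lambda>M. integral {0..2*pi} (S M)) \<longlonglongrightarrow> integral {0..2*pi} (\<lambda>t. (norm (g (of_real r * cis t)))\<^sup>2)"
    proof (rule dominated_convergence)
      show "S M integrable_on {0..2*pi}" for M using S by (rule has_integral_integrable)
      show "(\<lambda>_. (\<Sum>n. norm (a n) * r ^ n)\<^sup>2) integrable_on {0..2*pi}" by (rule integrable_const_ivl)
      show "norm (S M t) \<le> (\<Sum>n. norm (a n) * r ^ n)\<^sup>2" for M t
      proof -
        have "norm (\<Sum>n<M. (a n * of_real r ^ n) * cis (of_nat n * t)) \<le> (\<Sum>n<M. norm (a n) * r ^ n)"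
          using r by (intro sum_norm_le) (simp add: norm_mult norm_power)
        also have "\<dots> \<le> (\<Sum>n. norm (a n) * r ^ n)" using r by (intro sum_le_suminf sm) auto
        finally show ?thesis unfolding S_def by (simp add: power_mono)
      qed
      show "(\<lambda>M. S M t) \<longlonglongrightarrow> (norm (g (of_real r * cis t)))\<^sup>2" for t
      proof -
        have "(\<lambda>M. \<Sum>n<M. a n * (of_real r * cis t) ^ n) \<longlonglongrightarrow> g (of_real r * cis t)"
          using sums[of "of_real r * cis t"] r by (simp add: sums_def norm_mult)
        thus ?thesis unfolding S_def
          by (intro tendsto_intros) (simp add: power_mult_distrib Complex.DeMoivre mult_ac)
      qed
    qed
    moreover have "2 * pi * (\<Sum>n<N. (norm (a n))\<^sup>2 * r ^ (2 * n)) \<le> integral {0..2*pi} (S M)" if "M \<ge> N" for M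
      unfolding integral_unique[OF S] using that r by (intro mult_left_mono sum_mono2) auto
    hence "\<exists>N0. \<forall>M\<ge>N0. 2 * pi * (\<Sum>n<N. (norm (a n))\<^sup>2 * r ^ (2 * n)) \<le> integral {0..2*pi} (S M)" by blast
    ultimately have "2 * pi * (\<Sum>n<N. (norm (a n))\<^sup>2 * r ^ (2 * n)) \<le> integral {0..2*pi} (\<lambda>t. (norm (g (of_real r * cis t)))\<^sup>2)"
      by (rule LIMSEQ_le_const)
    also have "\<dots> \<le> C" using r by (intro C) auto
    finally show ?thesis .
  qed
  have "(\<Sum>n<N. (norm (a n))\<^sup>2) \<le> C / (2 * pi)" for N
  proof -
    define r where "r = (\<lambda>n::nat. 1 - 1 / (real n + 2))"
    have r: "0 < r n" "r n < 1" for n by (auto simp: r_def field_simps)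
    have rl: "r \<longlonglongrightarrow> 1" unfolding r_def by real_asymp
    have "(\<lambda>k. 2 * pi * (\<Sum>n<N. (norm (a n))\<^sup>2 * r k ^ (2 * n))) \<longlonglongrightarrow> 2 * pi * (\<Sum>n<N. (norm (a n))\<^sup>2 * 1 ^ (2 * n))"
      by (intro tendsto_intros rl)
    hence "2 * pi * (\<Sum>n<N. (norm (a n))\<^sup>2 * 1 ^ (2 * n)) \<le> C"
      by (rule LIMSEQ_le_const2) (use le r in blast)
    thus ?thesis by (simp add: field_simps)
  qed
  hence "summable (\<lambda>n. (norm (a n))\<^sup>2)"
    by (intro summableI_nonneg_bounded) auto
  thus ?thesis by (simp add: a_def)
qed

text \<open>The branch h of the square root satisfies (h z (z - cnj p))^2 = const, so h z (z - cnj p) takes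
  at most two values and is constant on the connected half-plane.  The series is the power series
  of g at \<open>\<psi> z\<close>.\<close>
lemma hardy_space_upper_half_plane_series:
  assumes "f \<in> hardy_space upper_half_plane"
  obtains p b where "Im p > 0" "summable (\<lambda>n. (norm (b n))\<^sup>2)"
    "\<And>z. Im z > 0 \<Longrightarrow> (\<lambda>n. b n * ((z - p) ^ n / (z - cnj p) ^ Suc n)) sums f z"
proof -
  obtain \<psi> h g where \<psi>: "biholomorphic_map \<psi> upper_half_plane (ball 0 1)"
    and h: "h holomorphic_on upper_half_plane" "\<And>z. z \<in> upper_half_plane \<Longrightarrow> (h z)\<^sup>2 = deriv \<psi> z"
    and g: "g \<in> hardy_disc" and f: "\<And>z. z \<in> upper_half_plane \<Longrightarrow> f z = h z * g (\<psi> z)"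
    using assms by (auto simp: hardy_space_def)
  obtain p \<alpha> where p: "p \<in> upper_half_plane" and \<alpha>: "norm \<alpha> = 1"
    and \<psi>_eq: "\<And>z. z \<in> upper_half_plane \<Longrightarrow> \<psi> z = \<alpha> * ((z - p) / (z - cnj p))"
    using biholomorphic_map_upper_half_plane[OF \<psi>] by blast
  have Imp: "Im p > 0" using p by (simp add: upper_half_plane_def)
  have nz: "z - cnj p \<noteq> 0" if "z \<in> upper_half_plane" for z
    using that Imp by (auto simp: upper_half_plane_def complex_eq_iff)
  define \<kappa> where "\<kappa> = \<alpha> * (p - cnj p)"
  have der: "deriv \<psi> z = \<kappa> / (z - cnj p)\<^sup>2" if "z \<in> upper_half_plane" for z
  proof -
    have "deriv \<psi> z = deriv (\<lambda>z. \<alpha> * ((z - p) / (z - cnj p))) z"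
      using that \<psi>_eq by (intro deriv_cong_ev eventually_mono[OF eventually_nhds_in_open[OF open_upper_half_plane]]) auto
    also have "\<dots> = \<alpha> * deriv (\<lambda>z. (z - p) / (z - cnj p)) z"
      using nz[OF that] by (intro deriv_cmult) (auto intro!: derivative_intros)
    finally show ?thesis by (simp add: deriv_cayley[OF p that] \<kappa>_def)
  qed
  define k where "k = (\<lambda>z. h z * (z - cnj p))"
  have k2: "(k z)\<^sup>2 = \<kappa>" if "z \<in> upper_half_plane" for z
    using h(2)[OF that] der[OF that] nz[OF that] by (simp add: k_def power_mult_distrib)
  have "k constant_on upper_half_plane"
  proof (rule continuous_finite_range_constant[OF connected_upper_half_plane])
    show "continuous_on upper_half_plane k"
      unfolding k_def by (intro continuous_intros holomorphic_on_imp_continuous_on h)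
    have "k ` upper_half_plane \<subseteq> {csqrt \<kappa>, - csqrt \<kappa>}"
    proof
      fix u assume "u \<in> k ` upper_half_plane"
      then obtain z where "u = k z" "z \<in> upper_half_plane" by auto
      thus "u \<in> {csqrt \<kappa>, - csqrt \<kappa>}" using k2[of z] power2_eq_iff[of "k z" "csqrt \<kappa>"] by simp
    qed
    thus "finite (k ` upper_half_plane)" by (rule finite_subset) auto
  qed
  then obtain k0 where k0: "\<And>z. z \<in> upper_half_plane \<Longrightarrow> k z = k0" by (auto simp: constant_on_def)
  define a where "a = (\<lambda>n. (deriv ^^ n) g 0 / fact n)"
  define b where "b = (\<lambda>n. k0 * a n * \<alpha> ^ n)"
  have "summable (\<lambda>n. (norm k0)\<^sup>2 * (norm (a n))\<^sup>2)"
    unfolding a_def by (intro summable_mult hardy_disc_summable g)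
  hence sb: "summable (\<lambda>n. (norm (b n))\<^sup>2)"
    using \<alpha> by (simp add: b_def norm_mult norm_power power_mult_distrib)
  have "(\<lambda>n. b n * ((z - p) ^ n / (z - cnj p) ^ Suc n)) sums f z" if "Im z > 0" for z
  proof -
    have z: "z \<in> upper_half_plane" using that by (simp add: upper_half_plane_def)
    have "\<psi> z \<in> ball 0 1" using biholomorphic_map_inverse(1)[OF \<psi> z] .
    moreover have "g holomorphic_on ball 0 1" using g by (simp add: hardy_disc_def)
    ultimately have "(\<lambda>n. a n * (\<psi> z - 0) ^ n) sums g (\<psi> z)"
      unfolding a_def by (intro holomorphic_power_series)
    hence "(\<lambda>n. h z * (a n * (\<psi> z) ^ n)) sums (h z * g (\<psi> z))" by (intro sums_mult) simp
    moreover have "h z = k0 / (z - cnj p)" using k0[OF z] nz[OF z] by (simp add: k_def field_simps)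
    ultimately show ?thesis
      unfolding f[OF z] \<psi>_eq[OF z] by (simp add: b_def power_mult_distrib power_divide mult_ac)
  qed
  thus ?thesis using that Imp sb by blast
qed

text \<open>If \<open>\<psi>\<close> maps B to the disc, then \<open>\<psi> \<circ> \<phi>\<close> maps A to the disc, and by the chain rule the square
  roots of the derivatives multiply.\<close>
lemma hardy_space_transfer:
  assumes \<phi>: "biholomorphic_map \<phi> A B" and op: "open A" "open B"
    and k: "k holomorphic_on A" "\<And>z. z \<in> A \<Longrightarrow> (k z)\<^sup>2 = deriv \<phi> z"
    and f: "f \<in> hardy_space B"
  shows "(\<lambda>z. k z * f (\<phi> z)) \<in> hardy_space A"
proof -
  obtain \<psi> h g where \<psi>: "biholomorphic_map \<psi> B (ball 0 1)"
    and h: "h holomorphic_on B" "\<And>z. z \<in> B \<Longrightarrow> (h z)\<^sup>2 = deriv \<psi> z"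
    and g: "g \<in> hardy_disc" and f: "\<And>z. z \<in> B \<Longrightarrow> f z = h z * g (\<psi> z)"
    using f by (auto simp: hardy_space_def)
  note inv = biholomorphic_map_inverse[OF \<phi>]
  have hol: "\<phi> holomorphic_on A" "\<psi> holomorphic_on B" using \<phi> \<psi> by (auto simp: biholomorphic_map_def)
  have "biholomorphic_map (\<lambda>z. \<psi> (\<phi> z)) A (ball 0 1)" by (rule biholomorphic_map_comp[OF \<phi> \<psi>])
  moreover have "(\<lambda>z. k z * h (\<phi> z)) holomorphic_on A"
    using holomorphic_on_compose_gen[OF hol(1) h(1)] inv by (intro holomorphic_intros k) (auto simp: o_def)
  moreover have "(k z * h (\<phi> z))\<^sup>2 = deriv (\<lambda>z. \<psi> (\<phi> z)) z" if z: "z \<in> A" for z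
  proof -
    have "((\<lambda>z. \<psi> (\<phi> z)) has_field_derivative deriv \<psi> (\<phi> z) * deriv \<phi> z) (at z)"
      by (rule DERIV_chain2[OF holomorphic_derivI[OF hol(2)] holomorphic_derivI[OF hol(1)]]) (use z op inv in auto)
    thus ?thesis using k(2)[OF z] h(2)[OF inv(1)[OF z]] by (simp add: power_mult_distrib DERIV_imp_deriv)
  qed
  ultimately show ?thesis
    unfolding hardy_space_def mem_Collect_eq
    by (intro exI[of _ "\<lambda>z. \<psi> (\<phi> z)"] exI[of _ "\<lambda>z. k z * h (\<phi> z)"] exI[of _ g] conjI g)
       (use f inv in auto)
qed

lemma hardy_space_transfer_inv:
  assumes \<phi>: "biholomorphic_map \<phi> A B" and op: "open A" "open B"
    and k: "k holomorphic_on A" "\<And>z. z \<in> A \<Longrightarrow> (k z)\<^sup>2 = deriv \<phi> z" "\<And>z. z \<in> A \<Longrightarrow> k z \<noteq> 0"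
    and f: "f \<in> hardy_space A"
  shows "(\<lambda>u. f (inv_into A \<phi> u) / k (inv_into A \<phi> u)) \<in> hardy_space B"
proof -
  note inv = biholomorphic_map_inverse[OF \<phi>]
  have hol: "inv_into A \<phi> holomorphic_on B" using \<phi> by (auto simp: biholomorphic_map_def)
  have "(\<lambda>u. (1 / k (inv_into A \<phi> u)) * f (inv_into A \<phi> u)) \<in> hardy_space B"
  proof (rule hardy_space_transfer[OF biholomorphic_map_inv[OF \<phi>] op(2,1) _ _ f])
    show "(\<lambda>u. 1 / k (inv_into A \<phi> u)) holomorphic_on B"
      using holomorphic_on_compose_gen[OF hol k(1)] inv k(3) by (intro holomorphic_intros) (auto simp: o_def)
    show "(1 / k (inv_into A \<phi> u))\<^sup>2 = deriv (inv_into A \<phi>) u" if u: "u \<in> B" for u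
    proof -
      have "deriv \<phi> (inv_into A \<phi> u) \<noteq> 0" using k(2,3)[OF inv(3)[OF u]] by (metis power_not_zero)
      thus ?thesis
        using deriv_inv_into[OF \<phi> op u] k(2)[OF inv(3)[OF u]] by (simp add: power_divide field_simps)
    qed
  qed
  thus ?thesis by simp
qed

section \<open>The Szego kernel of the half-plane\<close>

lemma cauchy_kernel_in_hardy_space:
  assumes w: "w \<in> upper_half_plane"
  shows "(\<lambda>z. C / (z - cnj w)) \<in> hardy_space upper_half_plane"
proof -
  define s where "s = csqrt (w - cnj w)"
  have s: "s\<^sup>2 = w - cnj w" "s \<noteq> 0" using w by (auto simp: s_def upper_half_plane_def complex_eq_iff)
  have nz: "z - cnj w \<noteq> 0" if "z \<in> upper_half_plane" for z
    using that w by (auto simp: upper_half_plane_def complex_eq_iff)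
  have "(\<lambda>_. C / s) \<in> hardy_disc"
    unfolding hardy_disc_def by auto
  moreover have "(\<lambda>z. s / (z - cnj w)) holomorphic_on upper_half_plane"
    using nz by (intro holomorphic_intros) auto
  moreover have "\<forall>z\<in>upper_half_plane. (s / (z - cnj w))\<^sup>2 = deriv (\<lambda>z. (z - w) / (z - cnj w)) z"
    using s deriv_cayley[OF w] by (simp add: power_divide)
  ultimately show ?thesis
    unfolding hardy_space_def mem_Collect_eq using biholomorphic_cayley[OF w] s(2)
    by (intro exI[of _ "\<lambda>z. (z - w) / (z - cnj w)"] exI[of _ "\<lambda>z. s / (z - cnj w)"] exI[of _ "\<lambda>_. C / s"]) simp
qed

lemma hardy_inner_commute: "hardy_inner \<Omega> f g = cnj (hardy_inner \<Omega> g f)"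
proof -
  have "(LINT x|lebesgue. cnj (nt_boundary_value \<Omega> f (Complex x y)) * nt_boundary_value \<Omega> g (Complex x y))
     = (LINT x|lebesgue. cnj (cnj (nt_boundary_value \<Omega> g (Complex x y)) * nt_boundary_value \<Omega> f (Complex x y)))" for y
    by (simp add: mult.commute)
  thus ?thesis unfolding hardy_inner_def by (simp only: Bochner_Integration.integral_cnj cnj_sum)
qed

text \<open>Boundary values are known only almost everywhere; this lemma replaces them by a Borel function.\<close>
lemma lebesgue_integral_AE_eq_lborel:
  fixes F G :: "real \<Rightarrow> complex"
  assumes "G \<in> borel_measurable borel" "AE x in lborel. F x = G x"
  shows "(LINT x|lebesgue. F x) = (LINT x|lborel. G x)"
proof -
  have G: "G \<in> borel_measurable lebesgue" using assms(1) by (simp add: measurable_completion)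
  have ae: "AE x in lebesgue. G x = F x" using AE_completion[OF assms(2)] by (simp add: eq_commute)
  have "F \<in> borel_measurable lebesgue" by (rule borel_measurable_AE[OF G ae])
  hence "(LINT x|lebesgue. F x) = (LINT x|lebesgue. G x)"
    using G ae by (intro integral_cong_AE) (auto simp: eq_commute)
  also have "\<dots> = (LINT x|lborel. G x)" using assms(1) by (intro integral_completion) simp
  finally show ?thesis .
qed

lemma nt_boundary_value_eqI:
  assumes "has_nt_limit \<Omega> f p L" "a > 0" "at p within nt_region \<Omega> p a \<noteq> bot"
  shows "nt_boundary_value \<Omega> f p = L"
  unfolding nt_boundary_value_def
proof (rule the_equality)
  show "has_nt_limit \<Omega> f p L" by fact
next
  fix L' assume "has_nt_limit \<Omega> f p L'"
  thus "L' = L" using assms tendsto_unique unfolding has_nt_limit_def by blast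
qed

lemma has_nt_limit_isCont: "isCont f p \<Longrightarrow> has_nt_limit \<Omega> f p (f p)"
  unfolding has_nt_limit_def isCont_def by (auto intro: tendsto_within_subset)

lemma has_nt_limit_cong:
  assumes "\<And>z. z \<in> \<Omega> \<Longrightarrow> f z = g z" "has_nt_limit \<Omega> f p L"
  shows "has_nt_limit \<Omega> g p L"
  unfolding has_nt_limit_def
proof (intro allI impI)
  fix a :: real assume "a > 0"
  hence "(f \<longlongrightarrow> L) (at p within nt_region \<Omega> p a)" using assms(2) by (simp add: has_nt_limit_def)
  moreover have "\<forall>\<^sub>F z in at p within nt_region \<Omega> p a. f z = g z"
    unfolding eventually_at_filter using assms(1) by (intro always_eventually) (auto simp: nt_region_def)
  ultimately show "(g \<longlongrightarrow> L) (at p within nt_region \<Omega> p a)" by (rule Lim_transform_eventually)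
qed

lemma nt_region_upper_half_plane_nontrivial:
  "at (of_real x) within nt_region upper_half_plane (of_real x) 1 \<noteq> bot"
  unfolding trivial_limit_within islimpt_approachable
proof (simp, intro allI impI)
  fix e :: real assume "e > 0"
  thus "\<exists>z\<in>nt_region upper_half_plane (of_real x) 1. z \<noteq> of_real x \<and> dist z (of_real x) < e"
    by (intro bexI[of _ "of_real x + \<i> * of_real (e / 2)"])
       (auto simp: nt_region_upper_half_plane complex_eq_iff dist_norm norm_mult)
qed

text \<open>The Szego kernel of the half-plane.  The conjugate of its restriction to the real line is the
  Cauchy kernel \<open>1 / (2 * pi * \<i> * (x - w))\<close>.\<close>
definition cauchy_kernel :: "complex \<Rightarrow> complex \<Rightarrow> complex" where
  "cauchy_kernel w z = \<i> / (2 * of_real pi) / (z - cnj w)"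

lemma cnj_cauchy_kernel: "cnj (cauchy_kernel w (of_real x)) = 1 / (2 * of_real pi * \<i>) * (1 / (of_real x - w))"
  by (simp add: cauchy_kernel_def divide_simps)

lemma hardy_space_boundary_function:
  assumes "f \<in> hardy_space upper_half_plane"
  obtains fs where "fs \<in> borel_measurable borel"
    "AE x in lborel. has_nt_limit upper_half_plane f (of_real x) (fs x)"
    "\<And>w. w \<in> upper_half_plane \<Longrightarrow> has_bochner_integral lborel (\<lambda>x. cnj (cauchy_kernel w (of_real x)) * fs x) (f w)"
proof -
  obtain p b where p: "Im p > 0" "summable (\<lambda>n. (norm (b n))\<^sup>2)"
    "\<And>z. Im z > 0 \<Longrightarrow> (\<lambda>n. b n * ((z - p) ^ n / (z - cnj p) ^ Suc n)) sums f z"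
    using hardy_space_upper_half_plane_series[OF assms] by blast
  obtain fs where fs: "fs \<in> borel_measurable borel"
    "AE x in lborel. has_nt_limit upper_half_plane f (of_real x) (fs x)"
    "\<And>w. Im w > 0 \<Longrightarrow> has_bochner_integral lborel (\<lambda>x. fs x / (of_real x - w)) (2 * of_real pi * \<i> * f w)"
    using hardy_boundary_values[OF p] by blast
  have "has_bochner_integral lborel (\<lambda>x. cnj (cauchy_kernel w (of_real x)) * fs x) (f w)" if "w \<in> upper_half_plane" for w
  proof -
    have "has_bochner_integral lborel (\<lambda>x. 1 / (2 * of_real pi * \<i>) * (fs x / (of_real x - w))) (1 / (2 * of_real pi * \<i>) * (2 * of_real pi * \<i> * f w))"
      by (rule has_bochner_integral_mult_right[OF fs(3)]) (use that in \<open>simp add: upper_half_plane_def\<close>)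
    thus ?thesis unfolding cnj_cauchy_kernel by (simp add: mult_ac)
  qed
  thus ?thesis using that fs by blast
qed

lemma cauchy_kernel_reproducing:
  assumes w: "w \<in> upper_half_plane" and f: "f \<in> hardy_space upper_half_plane"
  shows "f w = hardy_inner upper_half_plane (cauchy_kernel w) f"
proof -
  obtain fs where fs [measurable]: "fs \<in> borel_measurable borel"
    and nt: "AE x in lborel. has_nt_limit upper_half_plane f (of_real x) (fs x)"
    and int: "has_bochner_integral lborel (\<lambda>x. cnj (cauchy_kernel w (of_real x)) * fs x) (f w)"
    using hardy_space_boundary_function[OF f] w by metis
  have Im0: "Im ` frontier upper_half_plane = {0}"
    by (auto simp: frontier_upper_half_plane image_iff intro!: exI[of _ "0::complex"])
  have K: "nt_boundary_value upper_half_plane (cauchy_kernel w) (of_real x) = cauchy_kernel w (of_real x)" for x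
  proof (rule nt_boundary_value_eqI[OF has_nt_limit_isCont zero_less_one nt_region_upper_half_plane_nontrivial])
    have "of_real x - cnj w \<noteq> 0" using w by (auto simp: upper_half_plane_def complex_eq_iff)
    thus "isCont (cauchy_kernel w) (of_real x)"
      unfolding cauchy_kernel_def by (intro continuous_intros) auto
  qed
  have "AE x in lborel. cnj (nt_boundary_value upper_half_plane (cauchy_kernel w) (Complex x 0)) *
           nt_boundary_value upper_half_plane f (Complex x 0) = cnj (cauchy_kernel w (of_real x)) * fs x"
    using nt
  proof eventually_elim
    case (elim x)
    have "nt_boundary_value upper_half_plane f (of_real x) = fs x"
      by (rule nt_boundary_value_eqI[OF elim zero_less_one nt_region_upper_half_plane_nontrivial])
    thus ?case by (simp add: K flip: complex_of_real_def)
  qed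
  hence "hardy_inner upper_half_plane (cauchy_kernel w) f = (LINT x|lborel. cnj (cauchy_kernel w (of_real x)) * fs x)"
    unfolding hardy_inner_def Im0 using int
    by (simp, intro lebesgue_integral_AE_eq_lborel) (auto simp: has_bochner_integral_iff dest: borel_measurable_integrable)
  thus ?thesis using int by (simp add: has_bochner_integral_iff)
qed

lemma szego_kernel_upper_half_plane:
  assumes "w \<in> upper_half_plane" "z \<in> upper_half_plane"
  shows "szego_kernel upper_half_plane w z = cauchy_kernel w z"
  unfolding szego_kernel_def
proof (rule reproducing_kernel_unique[OF hardy_inner_commute, where K = cauchy_kernel])
  show "cauchy_kernel v \<in> hardy_space upper_half_plane" if "v \<in> upper_half_plane" for v
    unfolding cauchy_kernel_def[abs_def] by (rule cauchy_kernel_in_hardy_space[OF that])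
qed (use assms in \<open>auto intro: cauchy_kernel_reproducing\<close>)

section \<open>Boundary behaviour of the exponential map\<close>

lemma half_le_sin:
  fixes t :: real
  assumes "0 \<le> t" "t \<le> pi / 3"
  shows "t / 2 \<le> sin t"
proof -
  have "sin 0 - 0 / 2 \<le> sin t - t / 2"
  proof (rule DERIV_nonneg_imp_nondecreasing[OF assms(1)])
    fix x assume x: "0 \<le> x" "x \<le> t"
    have "cos (pi / 3) \<le> cos x" using x assms pi_gt_zero by (intro cos_monotone_0_pi_le) auto
    hence "0 \<le> cos x - 1 / 2" by (simp add: cos_60)
    moreover have "((\<lambda>x. sin x - x / 2) has_real_derivative cos x - 1 / 2) (at x)"
      by (auto intro!: derivative_eq_intros)
    ultimately show "\<exists>y. ((\<lambda>x. sin x - x / 2) has_real_derivative y) (at x) \<and> 0 \<le> y" by blast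
  qed
  thus ?thesis by simp
qed

lemma frontier_strip:
  assumes "\<beta> > 0"
  shows "frontier (strip \<beta>) = {z. Im z = 0 \<or> Im z = \<beta>}"
proof -
  have "closure (strip \<beta>) \<subseteq> {z. 0 \<le> Im z} \<inter> {z. Im z \<le> \<beta>}"
    by (rule closure_minimal) (auto simp: strip_def intro!: closed_Int closed_halfspace_Im_ge closed_halfspace_Im_le)
  moreover have "z \<in> closure (strip \<beta>)" if "Im z = 0 \<or> Im z = \<beta>" for z
    unfolding closure_approachable
  proof (intro allI impI)
    fix e :: real assume e: "e > 0"
    define t where "t = min (e / 2) (\<beta> / 2)"
    have t: "t > 0" "t < e" "t < \<beta>" using e assms by (auto simp: t_def)
    define u where "u = (if Im z = 0 then z + \<i> * of_real t else z - \<i> * of_real t)"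
    have "u \<in> strip \<beta>" using that t by (auto simp: u_def strip_def)
    moreover have "dist u z < e" using t by (auto simp: u_def dist_norm norm_mult)
    ultimately show "\<exists>y\<in>strip \<beta>. dist y z < e" by blast
  qed
  ultimately show ?thesis
    using assms by (auto simp: frontier_def interior_open[OF open_strip]) (auto simp: strip_def)
qed

lemma infdist_frontier_strip_le:
  assumes "\<beta> > 0" "z \<in> strip \<beta>"
  shows "infdist z (frontier (strip \<beta>)) \<le> Im z" "infdist z (frontier (strip \<beta>)) \<le> \<beta> - Im z"
proof -
  have "infdist z (frontier (strip \<beta>)) \<le> dist z (Complex (Re z) 0)"
    by (rule infdist_le) (simp add: frontier_strip[OF assms(1)])
  also have "\<dots> = Im z" using assms by (simp add: dist_complex_def cmod_def strip_def)
  finally show "infdist z (frontier (strip \<beta>)) \<le> Im z" .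
  have "infdist z (frontier (strip \<beta>)) \<le> dist z (Complex (Re z) \<beta>)"
    by (rule infdist_le) (simp add: frontier_strip[OF assms(1)])
  also have "\<dots> = \<beta> - Im z" using assms by (simp add: dist_complex_def cmod_def strip_def)
  finally show "infdist z (frontier (strip \<beta>)) \<le> \<beta> - Im z" .
qed

lemma nt_region_strip_nontrivial:
  assumes \<beta>: "\<beta> > 0" and p: "p \<in> frontier (strip \<beta>)"
  shows "at p within nt_region (strip \<beta>) p 1 \<noteq> bot"
  unfolding trivial_limit_within islimpt_approachable not_not
proof (intro allI impI)
  fix e :: real assume e: "e > 0"
  define t where "t = min (e / 2) (\<beta> / 2)"
  have t: "t > 0" "t < e" "t \<le> \<beta> / 2" using e \<beta> by (auto simp: t_def)
  have p': "Im p = 0 \<or> Im p = \<beta>" using p by (simp add: frontier_strip[OF \<beta>])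
  \<comment> \<open>A point at distance t vertically inside the strip, which is also its distance to the boundary.\<close>
  define z where "z = (if Im p = 0 then p + \<i> * of_real t else p - \<i> * of_real t)"
  have z: "z \<in> strip \<beta>" using p' t \<beta> by (auto simp: z_def strip_def)
  have d: "dist z p = t" using t by (auto simp: z_def dist_norm norm_mult)
  have Imz: "t \<le> Im z" "t \<le> \<beta> - Im z" using p' t by (auto simp: z_def)
  have "t \<le> infdist z (frontier (strip \<beta>))"
  proof -
    have ne: "frontier (strip \<beta>) \<noteq> {}" using p by auto
    have "t \<le> dist z u" if "u \<in> frontier (strip \<beta>)" for u
      using abs_Im_le_cmod[of "z - u"] that Imz by (auto simp: frontier_strip[OF \<beta>] dist_norm)
    thus ?thesis unfolding infdist_notempty[OF ne] by (intro cINF_greatest ne)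
  qed
  hence "z \<in> nt_region (strip \<beta>) p 1" using z d t by (simp add: nt_region_def)
  moreover have "z \<noteq> p" using d t by auto
  ultimately show "\<exists>z\<in>nt_region (strip \<beta>) p 1. z \<noteq> p \<and> dist z p < e" using d t by (intro bexI[of _ z]) auto
qed

definition strip_exp :: "real \<Rightarrow> complex \<Rightarrow> complex" where
  "strip_exp \<beta> z = exp (of_real (pi / \<beta>) * z)"

lemma has_field_derivative_strip_exp:
  "(strip_exp \<beta> has_field_derivative of_real (pi / \<beta>) * strip_exp \<beta> z) (at z within S)"
proof -
  have "((\<lambda>z. exp (c * z)) has_field_derivative c * exp (c * z)) (at z within S)" for c :: complex
    by (auto intro!: derivative_eq_intros)
  thus ?thesis unfolding strip_exp_def[abs_def] .
qed

lemma strip_exp_boundary: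
  assumes "\<beta> > 0"
  shows "strip_exp \<beta> (Complex x 0) = of_real (exp (pi / \<beta> * x))"
    and "strip_exp \<beta> (Complex x \<beta>) = of_real (- exp (pi / \<beta> * x))"
  using assms by (simp_all add: strip_exp_def exp_eq_polar complex_eq_iff Re_exp Im_exp)

text \<open>Near a boundary point p the map expands distances to p at most by a constant factor, and it
  shrinks distances to the boundary at most by a constant factor because sin t \<ge> t / 2 for small t.
  Hence a cone at p is mapped into a cone of larger aperture.\<close>
lemma strip_exp_nt_region:
  assumes \<beta>: "\<beta> > 0" and p: "p \<in> frontier (strip \<beta>)" and a: "a > 0"
  obtains a' where "a' > 0"
    "\<forall>\<^sub>F z in at p within nt_region (strip \<beta>) p a. strip_exp \<beta> z \<in> nt_region upper_half_plane (strip_exp \<beta> p) a'"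
proof -
  let ?E = "strip_exp \<beta>"
  define c where "c = pi / \<beta>"
  have c: "c > 0" using \<beta> by (simp add: c_def)
  have p': "Im p = 0 \<or> Im p = \<beta>" using p by (simp add: frontier_strip[OF \<beta>])
  define P where "P = norm (?E p)"
  have P: "P > 0" by (simp add: P_def strip_exp_def)
  have Ep: "?E p = of_real (if Im p = 0 then P else - P)"
    using strip_exp_boundary[OF \<beta>, of "Re p"] p' by (cases p) (auto simp: P_def)
  define D where "D = c * P + 1"
  have D: "D > 0" using c P by (simp add: D_def add_pos_pos)
  define a' where "a' = D * (1 + a) * 4 / (c * P)"
  have a': "a' > 0" using D a c P by (simp add: a'_def)
  have "((\<lambda>z. (?E z - ?E p) / (z - p)) \<longlongrightarrow> of_real (pi / \<beta>) * ?E p) (at p)"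
    using has_field_derivative_strip_exp[of \<beta> p UNIV] by (simp add: has_field_derivative_iff)
  hence "((\<lambda>z. norm ((?E z - ?E p) / (z - p))) \<longlongrightarrow> norm (of_real (pi / \<beta>) * ?E p)) (at p)"
    by (rule tendsto_norm)
  moreover have "norm (of_real (pi / \<beta>) * ?E p) < D" 
  proof -
    have "norm (of_real (pi / \<beta>) * ?E p) = c * P"
      unfolding norm_mult norm_of_real P_def using \<beta> by (simp add: c_def)
    thus ?thesis by (simp add: D_def)
  qed
  ultimately have ev1: "\<forall>\<^sub>F z in at p. norm ((?E z - ?E p) / (z - p)) < D"
    by (rule order_tendstoD(2))
  have "(?E \<longlongrightarrow> ?E p) (at p)"
    using DERIV_isCont[OF has_field_derivative_strip_exp[of \<beta> p UNIV]] by (simp add: isCont_def)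
  hence "((\<lambda>z. norm (?E z)) \<longlongrightarrow> P) (at p)" unfolding P_def by (rule tendsto_norm)
  hence ev2: "\<forall>\<^sub>F z in at p. norm (?E z) > P / 2"
    by (rule order_tendstoD(1)) (use P in simp)
  have ev3: "\<forall>\<^sub>F z in at p. dist z p < \<beta> / 3" using \<beta> by (intro eventually_at_topological[THEN iffD2] exI[of _ "ball p (\<beta> / 3)"]) (auto simp: dist_commute)
  have "\<forall>\<^sub>F z in at p within nt_region (strip \<beta>) p a. norm ((?E z - ?E p) / (z - p)) < D \<and> norm (?E z) > P / 2 \<and> dist z p < \<beta> / 3 \<and> z \<noteq> p \<and> z \<in> nt_region (strip \<beta>) p a"
    using ev1 ev2 ev3 unfolding eventually_at_filter by eventually_elim auto
  hence "\<forall>\<^sub>F z in at p within nt_region (strip \<beta>) p a. ?E z \<in> nt_region upper_half_plane (?E p) a'"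
  proof eventually_elim
    case (elim z)
    define \<delta> where "\<delta> = infdist z (frontier (strip \<beta>))"
    have z: "z \<in> strip \<beta>" "dist z p < (1 + a) * \<delta>" using elim by (auto simp: nt_region_def \<delta>_def)
    have \<delta>: "\<delta> \<le> Im z" "\<delta> \<le> \<beta> - Im z" using infdist_frontier_strip_le[OF \<beta> z(1)] by (auto simp: \<delta>_def)
    have "0 < dist z p" using elim by simp
    hence "0 < (1 + a) * \<delta>" using z(2) by (rule less_trans)
    hence "\<delta> > 0" using a by (simp add: zero_less_mult_iff)
    have ImE: "Im (?E z) = norm (?E z) * sin (c * Im z)"
      by (simp add: strip_exp_def Im_exp norm_exp_eq_Re c_def)
    \<comment> \<open>The distance to the boundary line through p; on either line sin (c s) = sin (c Im z).\<close>
    define s where "s = (if Im p = 0 then Im z else \<beta> - Im z)"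
    have sinI: "sin (c * Im z) = sin (c * s)"
    proof (cases "Im p = 0")
      case False
      have "c * \<beta> = pi" using \<beta> by (simp add: c_def)
      hence "c * s = pi - c * Im z" using False by (simp add: s_def right_diff_distrib)
      thus ?thesis by simp
    qed (simp add: s_def)
    have "s \<le> norm (z - p)" using abs_Im_le_cmod[of "z - p"] p' by (auto simp: s_def)
    hence "s \<le> \<beta> / 3" using elim by (simp add: dist_norm)
    hence "c * s \<le> pi / 3" using \<beta> by (simp add: c_def field_simps)
    moreover have "\<delta> \<le> s" using \<delta> by (simp add: s_def)
    ultimately have "c * s / 2 \<le> sin (c * s)" using c \<open>\<delta> > 0\<close> by (intro half_le_sin) auto
    hence "c * \<delta> / 2 \<le> sin (c * Im z)" using \<open>\<delta> \<le> s\<close> c unfolding sinI by (smt (verit) mult_left_mono divide_right_mono)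
    hence "P / 2 * (c * \<delta> / 2) \<le> Im (?E z)"
      unfolding ImE using elim P c \<open>\<delta> > 0\<close> by (intro mult_mono) auto
    hence low: "c * P / 4 * \<delta> \<le> Im (?E z)" by (simp add: mult_ac)
    moreover have "c * P / 4 * \<delta> > 0" using c P \<open>\<delta> > 0\<close> by simp
    ultimately have pos: "Im (?E z) > 0" by linarith
    have "norm (?E z - ?E p) < D * norm (z - p)"
      using elim \<open>0 < dist z p\<close> by (simp only: norm_divide dist_norm pos_divide_less_eq)
    also have "\<dots> \<le> D * ((1 + a) * \<delta>)" using z(2) D by (intro mult_left_mono) (auto simp: dist_norm)
    also have "\<dots> = a' * (c * P / 4 * \<delta>)" using c P by (simp add: a'_def)
    also have "\<dots> \<le> a' * Im (?E z)" using low a' by (intro mult_left_mono) auto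
    also have "\<dots> \<le> (1 + a') * Im (?E z)" using pos by (intro mult_right_mono) auto
    finally show ?case using pos by (simp add: nt_region_upper_half_plane)
  qed
  with a' show ?thesis by (rule that)
qed

lemma has_nt_limit_strip:
  assumes \<beta>: "\<beta> > 0" and p: "p \<in> frontier (strip \<beta>)"
    and lim: "has_nt_limit upper_half_plane F (strip_exp \<beta> p) L" and k: "isCont k p"
  shows "has_nt_limit (strip \<beta>) (\<lambda>z. k z * F (strip_exp \<beta> z)) p (k p * L)"
  unfolding has_nt_limit_def
proof (intro allI impI)
  fix a :: real assume a: "a > 0"
  let ?A = "at p within nt_region (strip \<beta>) p a"
  obtain a' where a': "a' > 0" "\<forall>\<^sub>F z in ?A. strip_exp \<beta> z \<in> nt_region upper_half_plane (strip_exp \<beta> p) a'"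
    using strip_exp_nt_region[OF \<beta> p a] by blast
  have notin: "strip_exp \<beta> p \<notin> upper_half_plane"
    using strip_exp_boundary[OF \<beta>, of "Re p"] p frontier_strip[OF \<beta>] by (cases p) (auto simp: upper_half_plane_def)
  have "isCont (strip_exp \<beta>) p" by (rule DERIV_isCont[OF has_field_derivative_strip_exp])
  hence "(strip_exp \<beta> \<longlongrightarrow> strip_exp \<beta> p) ?A" unfolding isCont_def by (rule tendsto_within_subset) auto
  moreover have "\<forall>\<^sub>F z in ?A. strip_exp \<beta> z \<in> nt_region upper_half_plane (strip_exp \<beta> p) a' \<and> strip_exp \<beta> z \<noteq> strip_exp \<beta> p"
    using a'(2) by eventually_elim (use notin in \<open>auto simp: nt_region_def\<close>)
  ultimately have "filterlim (strip_exp \<beta>) (at (strip_exp \<beta> p) within nt_region upper_half_plane (strip_exp \<beta> p) a') ?A"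
    unfolding filterlim_at by auto
  moreover have "(F \<longlongrightarrow> L) (at (strip_exp \<beta> p) within nt_region upper_half_plane (strip_exp \<beta> p) a')"
    using lim a'(1) by (simp add: has_nt_limit_def)
  ultimately have "((\<lambda>z. F (strip_exp \<beta> z)) \<longlongrightarrow> L) ?A" by (rule filterlim_compose[rotated])
  moreover have "(k \<longlongrightarrow> k p) ?A" using k unfolding isCont_def by (rule tendsto_within_subset) auto
  ultimately show "((\<lambda>z. k z * F (strip_exp \<beta> z)) \<longlongrightarrow> k p * L) ?A" by (intro tendsto_mult)
qed

text \<open>The exceptional set is the image of a null set under a logarithm, which is differentiable and so
  preserves null sets.\<close>
lemma AE_exp:
  fixes c :: real and s :: real
  assumes "c > 0" "s \<noteq> 0" and ae: "AE u in lborel. P u"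
  shows "AE x in lborel. P (s * exp (c * x))"
proof -
  have "\<exists>N\<in>null_sets lborel. {u\<in>space lborel. \<not> P u} \<subseteq> N"
    using ae unfolding eventually_ae_filter .
  then obtain N where N: "N \<in> null_sets lborel" "{u. \<not> P u} \<subseteq> N" by auto
  \<comment> \<open>Only points of the half-line of sign s are values of \<open>s * exp (c * x)\<close>, and l inverts that map there.\<close>
  define M where "M = N \<inter> {u. u / s > 0}"
  define l where "l = (\<lambda>u. ln (u / s) / c)"
  have "negligible N" using N(1) by (simp add: negligible_iff_null_sets null_sets_completionI)
  hence "negligible M" unfolding M_def by (rule negligible_subset) auto
  moreover have "l differentiable_on M"
  proof -
    have "(l has_real_derivative 1 / s * inverse (u / s) / c) (at u)" if "u / s > 0" for u
      unfolding l_def using that assms by (auto intro!: derivative_eq_intros simp: field_simps)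
    hence "l differentiable at u" if "u / s > 0" for u
      using that by (meson differentiableI has_field_derivative_imp_has_derivative)
    thus ?thesis unfolding differentiable_on_def M_def
      by (auto intro: differentiable_at_withinI[where s = M, unfolded M_def])
  qed
  ultimately have "negligible (l ` M)" by (intro negligible_differentiable_image_negligible) auto
  hence "l ` M \<in> null_sets lebesgue" by (simp add: negligible_iff_null_sets)
  hence "AE x in lebesgue. x \<notin> l ` M" by (rule AE_not_in)
  hence "AE x in lborel. x \<notin> l ` M" by (simp add: AE_completion_iff)
  thus ?thesis
  proof eventually_elim
    case (elim x)
    show ?case
    proof (rule ccontr)
      assume "\<not> P (s * exp (c * x))"
      hence "s * exp (c * x) \<in> M" using N(2) assms by (auto simp: M_def)
      moreover have "l (s * exp (c * x)) = x" using assms by (simp add: l_def)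
      ultimately show False using elim by force
    qed
  qed
qed

text \<open>The sign s selects the half-line: 1 belongs to the lower boundary line of the strip, -1 to the
  upper one.\<close>
lemma integral_exp_substitution:
  fixes G :: "real \<Rightarrow> complex" and c s :: real
  assumes c: "c > 0" and s: "s \<noteq> 0" and G: "integrable lborel G"
  shows "has_bochner_integral lborel (\<lambda>x. \<bar>s * c * exp (c * x)\<bar> *\<^sub>R G (s * exp (c * x)))
           (LINT u:{u. u / s > 0}|lborel. G u)"
proof -
  let ?g = "\<lambda>x. s * exp (c * x)"
  have [measurable]: "G \<in> borel_measurable borel" using borel_measurable_integrable[OF G] by simp
  have m: "(\<lambda>x. \<bar>s * c * exp (c * x)\<bar> *\<^sub>R G (s * exp (c * x))) \<in> borel_measurable borel" by measurable
  have img: "range ?g = {u. u / s > 0}"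
  proof -
    have "u \<in> range ?g" if "u / s > 0" for u
      by (rule range_eqI[of _ _ "ln (u / s) / c"]) (use that c s in simp)
    thus ?thesis using s by auto
  qed
  have set: "{u. u / s > 0} \<in> sets borel" by measurable
  have si: "set_integrable lborel {u. u / s > 0} G"
    unfolding set_integrable_def using G set by (intro integrable_mult_indicator) auto
  hence sl: "G absolutely_integrable_on {u. u / s > 0}"
    unfolding set_integrable_def by (subst integrable_completion) (use set in auto)
  have LL: "(LINT u:{u. u / s > 0}|lborel. G u) = integral {u. u / s > 0} G"
    by (rule set_borel_integral_eq_integral(2)[OF si])
  have cov: "(\<lambda>x. \<bar>s * c * exp (c * x)\<bar> *\<^sub>R G (?g x)) absolutely_integrable_on UNIV \<and>
     integral UNIV (\<lambda>x. \<bar>s * c * exp (c * x)\<bar> *\<^sub>R G (?g x)) = integral {u. u / s > 0} G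
     \<longleftrightarrow> G absolutely_integrable_on ?g ` UNIV \<and> integral (?g ` UNIV) G = integral {u. u / s > 0} G"
    by (rule has_absolute_integral_change_of_variables_real)
       (use c s in \<open>auto intro!: derivative_eq_intros simp: inj_on_def\<close>)
  have abs: "(\<lambda>x. \<bar>s * c * exp (c * x)\<bar> *\<^sub>R G (?g x)) absolutely_integrable_on UNIV"
    and eq: "integral UNIV (\<lambda>x. \<bar>s * c * exp (c * x)\<bar> *\<^sub>R G (?g x)) = integral {u. u / s > 0} G"
    using cov sl img by auto
  have "integrable lborel (\<lambda>x. \<bar>s * c * exp (c * x)\<bar> *\<^sub>R G (?g x))"
    using abs m unfolding set_integrable_def by (subst (asm) integrable_completion) auto
  moreover from this have "(LINT x|lborel. \<bar>s * c * exp (c * x)\<bar> *\<^sub>R G (?g x)) = integral UNIV (\<lambda>x. \<bar>s * c * exp (c * x)\<bar> *\<^sub>R G (?g x))"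
    using set_borel_integral_eq_integral(2)[of UNIV "\<lambda>x. \<bar>s * c * exp (c * x)\<bar> *\<^sub>R G (?g x)"]
    by (simp add: set_integrable_def set_lebesgue_integral_def)
  ultimately show ?thesis using LL eq by (simp add: has_bochner_integral_iff)
qed

lemma integral_split_at_0:
  fixes G :: "real \<Rightarrow> complex"
  assumes "integrable lborel G"
  shows "(LINT u:{u. u / 1 > 0}|lborel. G u) + (LINT u:{u. u / (-1) > 0}|lborel. G u) = (LINT u|lborel. G u)"
proof -
  have A: "{u::real. u / 1 > 0} = {0<..}" "{u::real. u / (-1) > 0} = {..<0}" by auto
  have si: "set_integrable lborel A G" if "A \<in> sets borel" for A
    unfolding set_integrable_def using assms that by (intro integrable_mult_indicator) auto
  have "(LINT u|lborel. G u) = (LINT u|lborel. indicator {0<..} u *\<^sub>R G u + indicator {..<0} u *\<^sub>R G u)"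
  proof (rule integral_cong_AE)
    have "AE u in lborel. u \<noteq> (0::real)" by (rule AE_lborel_singleton)
    thus "AE u in lborel. G u = indicator {0<..} u *\<^sub>R G u + indicator {..<0} u *\<^sub>R G u"
      by eventually_elim (auto simp: indicator_def)
  qed (use assms in auto)
  also have "\<dots> = (LINT u:{0<..}|lborel. G u) + (LINT u:{..<0}|lborel. G u)"
    unfolding set_lebesgue_integral_def using si[of "{0<..}"] si[of "{..<0}"]
    by (intro Bochner_Integration.integral_add) (auto simp: set_integrable_def)
  finally show ?thesis unfolding A ..
qed

section \<open>The Szego kernel of the strip\<close>

text \<open>The Szego kernel of the strip, in the form 1 / (4 \<beta> sin (pi s)) in which it appears as the sum
  of the alternating series.\<close>
definition strip_szego :: "real \<Rightarrow> complex \<Rightarrow> complex \<Rightarrow> complex" where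
  "strip_szego \<beta> w z = 1 / (4 * of_real \<beta> * sin (of_real pi * ((z - cnj w) / (2 * \<i> * of_real \<beta>))))"

text \<open>A holomorphic square root of the derivative of the conformal map \<open>strip_exp \<beta>\<close>.\<close>
definition strip_weight :: "real \<Rightarrow> complex \<Rightarrow> complex" where
  "strip_weight \<beta> z = of_real (sqrt (pi / \<beta>)) * exp (of_real (pi / (2 * \<beta>)) * z)"

lemma strip_weight_power2:
  assumes "\<beta> > 0"
  shows "(strip_weight \<beta> z)\<^sup>2 = of_real (pi / \<beta>) * strip_exp \<beta> z"
proof -
  have "(of_real (sqrt (pi / \<beta>)) :: complex)\<^sup>2 = of_real (pi / \<beta>)"
    using assms by (simp flip: of_real_power)
  moreover have "(exp (of_real (pi / (2 * \<beta>)) * z))\<^sup>2 = strip_exp \<beta> z"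
    using assms by (simp add: strip_exp_def flip: exp_double)
  ultimately show ?thesis unfolding strip_weight_def power_mult_distrib by simp
qed

lemma strip_szego_eq:
  assumes "\<beta> > 0"
  shows "strip_szego \<beta> w z = strip_weight \<beta> z * (cnj (strip_weight \<beta> w) * cauchy_kernel (strip_exp \<beta> w) (strip_exp \<beta> z))"
proof -
  define e where "e = exp (of_real (pi / (2 * \<beta>)) * z)"
  define e' where "e' = cnj (exp (of_real (pi / (2 * \<beta>)) * w))"
  define S where "S = sin (of_real pi * ((z - cnj w) / (2 * \<i> * of_real \<beta>)))"
  have nz: "e \<noteq> 0" "e' \<noteq> 0" by (auto simp: e_def e'_def)
  have d: "strip_exp \<beta> z - cnj (strip_exp \<beta> w) = e * e' * (2 * \<i> * S)"
    unfolding strip_exp_def e_def e'_def S_def by (rule exp_strip_diff[OF assms])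
  have sq: "of_real (sqrt (pi / \<beta>)) * of_real (sqrt (pi / \<beta>)) = (of_real pi / of_real \<beta> :: complex)"
    using assms by (simp flip: of_real_mult)
  have "strip_weight \<beta> z * (cnj (strip_weight \<beta> w) * cauchy_kernel (strip_exp \<beta> w) (strip_exp \<beta> z))
      = (of_real (sqrt (pi / \<beta>)) * of_real (sqrt (pi / \<beta>))) * (e * e' * (\<i> / (2 * of_real pi) / (e * e' * (2 * \<i> * S))))"
    unfolding strip_weight_def cauchy_kernel_def d by (simp add: e_def e'_def mult_ac)
  also have "\<dots> = 1 / (4 * of_real \<beta> * S)"
    unfolding sq using nz by simp
  finally show ?thesis by (simp add: strip_szego_def S_def)
qed

lemma strip_biholomorphic:
  assumes "\<beta> > 0"
  shows "biholomorphic_map (strip_exp \<beta>) (strip \<beta>) upper_half_plane"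
  unfolding strip_exp_def[abs_def] by (rule biholomorphic_strip_exp[OF assms])

lemma strip_weight_conformal:
  assumes "\<beta> > 0"
  shows "strip_weight \<beta> holomorphic_on S" "(strip_weight \<beta> z)\<^sup>2 = deriv (strip_exp \<beta>) z" "strip_weight \<beta> z \<noteq> 0"
proof -
  show "strip_weight \<beta> holomorphic_on S"
    unfolding strip_weight_def[abs_def] by (intro holomorphic_intros)
  show "(strip_weight \<beta> z)\<^sup>2 = deriv (strip_exp \<beta>) z"
    using strip_weight_power2[OF assms] DERIV_imp_deriv[OF has_field_derivative_strip_exp] by simp
  show "strip_weight \<beta> z \<noteq> 0" using assms by (simp add: strip_weight_def)
qed

lemma strip_szego_in_hardy_space:
  assumes \<beta>: "\<beta> > 0" and w: "w \<in> strip \<beta>"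
  shows "strip_szego \<beta> w \<in> hardy_space (strip \<beta>)"
proof -
  have "strip_exp \<beta> w \<in> upper_half_plane"
    by (rule biholomorphic_map_inverse(1)[OF strip_biholomorphic[OF \<beta>] w])
  hence "(\<lambda>u. (cnj (strip_weight \<beta> w) * (\<i> / (2 * of_real pi))) / (u - cnj (strip_exp \<beta> w))) \<in> hardy_space upper_half_plane"
    by (rule cauchy_kernel_in_hardy_space)
  from hardy_space_transfer[OF strip_biholomorphic[OF \<beta>] open_strip open_upper_half_plane strip_weight_conformal(1,2)[OF \<beta>] this]
  show ?thesis
    unfolding strip_szego_eq[OF \<beta>, abs_def] cauchy_kernel_def by simp
qed

text \<open>Write \<open>f z = k z * F (E z)\<close> with F in the Hardy space of the half-plane.  On each boundary line the
  integrand is \<open>k w\<close> times |k|^2 times the integrand for F at the image point, and |k|^2 is the Jacobian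
  of the substitution.  So the two lines contribute the integrals over the two half-lines.\<close>
lemma strip_szego_reproducing:
  assumes \<beta>: "\<beta> > 0" and w: "w \<in> strip \<beta>" and f: "f \<in> hardy_space (strip \<beta>)"
  shows "f w = hardy_inner (strip \<beta>) (strip_szego \<beta> w) f"
proof -
  let ?E = "strip_exp \<beta>" and ?k = "strip_weight \<beta>" and ?K = "cauchy_kernel (strip_exp \<beta> w)"
  define c where "c = pi / \<beta>"
  have c: "c > 0" using \<beta> by (simp add: c_def)
  note bih = strip_biholomorphic[OF \<beta>]
  note inv = biholomorphic_map_inverse[OF bih]
  define F where "F = (\<lambda>u. f (inv_into (strip \<beta>) ?E u) / ?k (inv_into (strip \<beta>) ?E u))"
  have F: "F \<in> hardy_space upper_half_plane"
    unfolding F_def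
    by (rule hardy_space_transfer_inv[OF bih open_strip open_upper_half_plane strip_weight_conformal[OF \<beta>] f])
  have fF: "?k z * F (?E z) = f z" if "z \<in> strip \<beta>" for z
    using inv(2)[OF that] strip_weight_conformal(3)[OF \<beta>] by (simp add: F_def)
  have Ew: "?E w \<in> upper_half_plane" by (rule inv(1)[OF w])
  obtain fs where fs [measurable]: "fs \<in> borel_measurable borel"
    and nt: "AE x in lborel. has_nt_limit upper_half_plane F (of_real x) (fs x)"
    and int: "has_bochner_integral lborel (\<lambda>x. cnj (?K (of_real x)) * fs x) (F (?E w))"
    using hardy_space_boundary_function[OF F] Ew by metis
  define G where "G = (\<lambda>x. cnj (?K (of_real x)) * fs x)"
  have G: "integrable lborel G" "(LINT x|lborel. G x) = F (?E w)"
    using int by (auto simp: has_bochner_integral_iff G_def)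
  have side: "(LINT x|lebesgue. cnj (nt_boundary_value (strip \<beta>) (strip_szego \<beta> w) (Complex x y)) * nt_boundary_value (strip \<beta>) f (Complex x y))
      = ?k w * (LINT u:{u. u / s > 0}|lborel. G u)"
    if y: "(y = 0 \<and> s = 1) \<or> (y = \<beta> \<and> s = -1)" for y s
  proof -
    have s: "s \<noteq> 0" "\<bar>s\<bar> = 1" using y by auto
    have Ep: "?E (Complex x y) = of_real (s * exp (c * x))" for x
      using y strip_exp_boundary[OF \<beta>, of x] by (auto simp: c_def)
    have p: "Complex x y \<in> frontier (strip \<beta>)" for x using y by (auto simp: frontier_strip[OF \<beta>])
    have kk: "(norm (?k (Complex x y)))\<^sup>2 = \<bar>s * c * exp (c * x)\<bar>" for x
    proof -
      have "(norm (?k (Complex x y)))\<^sup>2 = norm (of_real (pi / \<beta>) * ?E (Complex x y))"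
        unfolding norm_power[symmetric] strip_weight_power2[OF \<beta>] ..
      also have "\<dots> = \<bar>s * c * exp (c * x)\<bar>"
        unfolding Ep norm_mult norm_of_real using s(2) by (simp add: c_def abs_mult)
      finally show ?thesis .
    qed
    have Q: "nt_boundary_value (strip \<beta>) (strip_szego \<beta> w) (Complex x y) = ?k (Complex x y) * (cnj (?k w) * ?K (of_real (s * exp (c * x))))" for x
    proof -
      have "?E (Complex x y) - cnj (?E w) \<noteq> 0"
        using Ew unfolding Ep by (auto simp: upper_half_plane_def complex_eq_iff)
      moreover have "isCont ?E (Complex x y)" "isCont ?k (Complex x y)"
        using \<beta> unfolding strip_exp_def[abs_def] strip_weight_def[abs_def] by (auto intro!: continuous_intros)
      ultimately have "isCont (strip_szego \<beta> w) (Complex x y)"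
        unfolding strip_szego_eq[OF \<beta>, abs_def] cauchy_kernel_def by (intro continuous_intros) auto
      hence "nt_boundary_value (strip \<beta>) (strip_szego \<beta> w) (Complex x y) = strip_szego \<beta> w (Complex x y)"
        by (rule nt_boundary_value_eqI[OF has_nt_limit_isCont zero_less_one nt_region_strip_nontrivial[OF \<beta> p]])
      thus ?thesis by (simp add: strip_szego_eq[OF \<beta>] Ep)
    qed
    have "AE x in lborel. has_nt_limit upper_half_plane F (of_real (s * exp (c * x))) (fs (s * exp (c * x)))"
      by (rule AE_exp[OF c s(1) nt])
    hence "AE x in lborel. cnj (nt_boundary_value (strip \<beta>) (strip_szego \<beta> w) (Complex x y)) * nt_boundary_value (strip \<beta>) f (Complex x y)
        = ?k w * (\<bar>s * c * exp (c * x)\<bar> *\<^sub>R G (s * exp (c * x)))"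
    proof eventually_elim
      case (elim x)
      have "isCont ?k (Complex x y)"
        using \<beta> unfolding strip_weight_def[abs_def] by (auto intro!: continuous_intros)
      hence "has_nt_limit (strip \<beta>) (\<lambda>z. ?k z * F (?E z)) (Complex x y) (?k (Complex x y) * fs (s * exp (c * x)))"
        using elim Ep[of x] by (intro has_nt_limit_strip[OF \<beta> p]) auto
      hence "has_nt_limit (strip \<beta>) f (Complex x y) (?k (Complex x y) * fs (s * exp (c * x)))"
        using fF by (rule has_nt_limit_cong[rotated])
      hence "nt_boundary_value (strip \<beta>) f (Complex x y) = ?k (Complex x y) * fs (s * exp (c * x))"
        by (rule nt_boundary_value_eqI[OF _ zero_less_one nt_region_strip_nontrivial[OF \<beta> p]])
      moreover have "cnj (?k (Complex x y)) * ?k (Complex x y) = of_real \<bar>s * c * exp (c * x)\<bar>"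
        unfolding kk[symmetric] complex_norm_square by (rule mult.commute)
      moreover have "cnj (a * (b * d)) * (a * t) = cnj b * ((a * cnj a) * (cnj d * t))" for a b d t :: complex
        by simp
      ultimately show ?case unfolding Q G_def scaleR_conv_of_real by simp
    qed
    hence "(LINT x|lebesgue. cnj (nt_boundary_value (strip \<beta>) (strip_szego \<beta> w) (Complex x y)) * nt_boundary_value (strip \<beta>) f (Complex x y))
        = (LINT x|lborel. ?k w * (\<bar>s * c * exp (c * x)\<bar> *\<^sub>R G (s * exp (c * x))))"
    proof (rule lebesgue_integral_AE_eq_lborel[rotated])
      have [measurable]: "G \<in> borel_measurable borel" using borel_measurable_integrable[OF G(1)] by simp
      show "(\<lambda>x. ?k w * (\<bar>s * c * exp (c * x)\<bar> *\<^sub>R G (s * exp (c * x)))) \<in> borel_measurable borel"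
        by measurable
    qed
    also have "\<dots> = ?k w * (LINT u:{u. u / s > 0}|lborel. G u)"
      using has_bochner_integral_mult_right[OF integral_exp_substitution[OF c s(1) G(1)], of "?k w"]
      by (simp only: has_bochner_integral_iff)
    finally show ?thesis .
  qed
  have Im: "Im ` frontier (strip \<beta>) = {0, \<beta>}"
  proof -
    have "Complex 0 y \<in> frontier (strip \<beta>)" if "y \<in> {0, \<beta>}" for y
      using that by (auto simp: frontier_strip[OF \<beta>])
    hence "{0, \<beta>} \<subseteq> Im ` frontier (strip \<beta>)" by (force intro: image_eqI[where x = "Complex 0 _"])
    moreover have "Im ` frontier (strip \<beta>) \<subseteq> {0, \<beta>}" by (auto simp: frontier_strip[OF \<beta>])
    ultimately show ?thesis by (rule antisym[rotated])
  qed
  have "hardy_inner (strip \<beta>) (strip_szego \<beta> w) f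
      = ?k w * (LINT u:{u. u / 1 > 0}|lborel. G u) + ?k w * (LINT u:{u. u / (-1) > 0}|lborel. G u)"
    unfolding hardy_inner_def Im using \<beta> side[of 0 1] side[of \<beta> "-1"] by simp
  also have "\<dots> = ?k w * F (?E w)"
    unfolding distrib_left[symmetric] integral_split_at_0[OF G(1)] G(2) ..
  also have "\<dots> = f w" by (rule fF[OF w])
  finally show ?thesis ..
qed

lemma szego_kernel_strip:
  assumes "\<beta> > 0" "w \<in> strip \<beta>" "z \<in> strip \<beta>"
  shows "szego_kernel (strip \<beta>) w z = strip_szego \<beta> w z"
  unfolding szego_kernel_def
proof (rule reproducing_kernel_unique[OF hardy_inner_commute, where K = "strip_szego \<beta>"])
  show "strip_szego \<beta> v \<in> hardy_space (strip \<beta>)" if "v \<in> strip \<beta>" for v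
    by (rule strip_szego_in_hardy_space[OF assms(1) that])
  show "f v = hardy_inner (strip \<beta>) (strip_szego \<beta> v) f"
    if "v \<in> strip \<beta>" "f \<in> hardy_space (strip \<beta>)" for v f
    by (rule strip_szego_reproducing[OF assms(1) that])
qed (use assms in auto)

section \<open>Summing the translates\<close>

text \<open>The convention \<open>inverse 0 = 0\<close> provides exactly the value that is required at the poles.\<close>
lemma nicely_meromorphic_inverse_entire:
  assumes "g holomorphic_on UNIV"
  shows "(\<lambda>z. C * inverse (g z)) nicely_meromorphic_on UNIV"
  using assms
  by (intro nicely_meromorphic_on_cmult_left nicely_meromorphic_on_inverse analytic_on_imp_nicely_meromorphic_on)
     (simp add: analytic_on_open)

lemma cauchy_kernel_nicely_meromorphic: "cauchy_kernel w nicely_meromorphic_on UNIV"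
proof -
  have eq: "cauchy_kernel w = (\<lambda>z. \<i> / (2 * of_real pi) * inverse (z - cnj w))"
    by (rule ext) (simp only: cauchy_kernel_def divide_inverse)
  show ?thesis
    unfolding eq by (rule nicely_meromorphic_inverse_entire) (intro holomorphic_intros)
qed

lemma strip_szego_nicely_meromorphic: "strip_szego \<beta> w nicely_meromorphic_on UNIV"
proof (cases "\<beta> = 0")
  case False
  have eq: "strip_szego \<beta> w = (\<lambda>z. 1 / (4 * of_real \<beta>) * inverse (sin (of_real pi * ((z - cnj w) / (2 * \<i> * of_real \<beta>)))))"
    by (rule ext) (simp only: strip_szego_def divide_inverse inverse_mult_distrib mult_1_left)
  show ?thesis
    unfolding eq by (rule nicely_meromorphic_inverse_entire) (use False in \<open>auto intro!: holomorphic_intros\<close>)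
qed (simp add: strip_szego_def[abs_def] nicely_meromorphic_on_const)

lemma sum_int_interval_split:
  fixes f :: "int \<Rightarrow> 'a :: comm_monoid_add"
  shows "(\<Sum>k\<in>{- int M..int N}. f k) = (\<Sum>n<Suc N. f (int n)) + (\<Sum>n<M. f (- int n - 1))"
proof -
  have "{- int M..int N} = int ` {..<Suc N} \<union> (\<lambda>n. - int n - 1) ` {..<M}"
  proof (intro equalityI subsetI)
    fix k assume k: "k \<in> {- int M..int N}"
    show "k \<in> int ` {..<Suc N} \<union> (\<lambda>n. - int n - 1) ` {..<M}"
    proof (cases "k \<ge> 0")
      case True
      thus ?thesis using k by (intro UnI1 image_eqI[of _ _ "nat k"]) auto
    next
      case False
      thus ?thesis using k by (intro UnI2 image_eqI[of _ _ "nat (- k - 1)"]) auto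
    qed
  qed auto
  hence "(\<Sum>k\<in>{- int M..int N}. f k) = sum f (int ` {..<Suc N} \<union> (\<lambda>n. - int n - 1) ` {..<M})" by simp
  also have "\<dots> = sum f (int ` {..<Suc N}) + sum f ((\<lambda>n. - int n - 1) ` {..<M})"
    by (rule sum.union_disjoint) auto
  also have "sum f (int ` {..<Suc N}) = (\<Sum>n<Suc N. f (int n))" by (subst sum.reindex) (auto simp: o_def)
  also have "sum f ((\<lambda>n. - int n - 1) ` {..<M}) = (\<Sum>n<M. f (- int n - 1))"
    by (subst sum.reindex) (auto simp: o_def inj_on_def)
  finally show ?thesis .
qed

text \<open>Away from the poles s is never an integer.  The terms with \<open>k \<ge> 0\<close> are the alternating series
  at s and the terms with \<open>k < 0\<close> are the alternating series at \<open>1 - s\<close>.  Each converges uniformly on its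
  own, so the two ends of the summation range may tend to infinity independently.\<close>
lemma strip_szego_series:
  assumes \<beta>: "\<beta> > 0"
  shows "has_meromorphic_sum (\<lambda>k z. (-1) powi k * cauchy_kernel w (z + 2 * of_int k * \<i> * of_real \<beta>)) (strip_szego \<beta> w)"
  unfolding has_meromorphic_sum_def
proof (intro allI impI, elim conjE)
  fix K :: "complex set"
  assume K: "compact K"
    and np: "\<forall>k. \<forall>z\<in>K. \<not> is_pole (\<lambda>z. (-1) powi k * cauchy_kernel w (z + 2 * of_int k * \<i> * of_real \<beta>)) z"
  define s where "s = (\<lambda>z. (z - cnj w) / (2 * \<i> * of_real \<beta>))"
  define A where "A = (\<lambda>N s. \<Sum>n<N. (-1) ^ n / (s + of_nat n) :: complex)"
  define L where "L = (\<lambda>s::complex. (Digamma ((s + 1) / 2) - Digamma (s / 2)) / 2)"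
  have shift: "z + 2 * of_int k * \<i> * of_real \<beta> - cnj w = 2 * \<i> * of_real \<beta> * (s z + of_int k)" for z k
    using \<beta> by (simp add: s_def field_simps)
  have nz: "s z + of_int k \<noteq> 0" if "z \<in> K" for z k
  proof
    assume "s z + of_int k = 0"
    hence z: "2 * of_int k * \<i> * of_real \<beta> - cnj w = - z" using shift[of z k] by (simp add: algebra_simps add_eq_0_iff)
    have "is_pole (\<lambda>v. ((-1) powi k * (\<i> / (2 * of_real pi))) * (1 / (v - z))) z"
      by (subst is_pole_cmult_iff) (auto intro: is_pole_inverse)
    moreover have "((-1) powi k * (\<i> / (2 * of_real pi))) * (1 / (v - z)) = (-1) powi k * cauchy_kernel w (v + 2 * of_int k * \<i> * of_real \<beta>)" for v
    proof -
      have "v + 2 * of_int k * \<i> * of_real \<beta> - cnj w = v - z" using z by (simp add: algebra_simps)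
      thus ?thesis unfolding cauchy_kernel_def by simp
    qed
    ultimately show False using np that by auto
  qed
  have sK: "compact (s ` K)" "compact ((\<lambda>z. 1 - s z) ` K)"
    unfolding s_def using \<beta> by (intro compact_continuous_image K continuous_intros; simp)+
  have "uniform_limit (s ` K) A L at_top"
    unfolding A_def L_def
    by (rule uniform_limit_alternating[OF compact_imp_bounded[OF sK(1)]]) (use nz[of _ "int _"] in auto)
  hence u1: "uniform_limit K (\<lambda>N z. A N (s z)) (\<lambda>z. L (s z)) at_top"
    by (rule uniform_limit_compose') auto
  have "uniform_limit ((\<lambda>z. 1 - s z) ` K) A L at_top"
    unfolding A_def L_def
  proof (rule uniform_limit_alternating[OF compact_imp_bounded[OF sK(2)]])
    fix t n assume "t \<in> (\<lambda>z. 1 - s z) ` K"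
    then obtain z where "z \<in> K" "t = 1 - s z" by auto
    moreover from this have "t + of_nat n = - (s z + of_int (- int n - 1))" by simp
    ultimately show "t + of_nat n \<noteq> 0" using nz[of z "- int n - 1"] by (simp only: neg_equal_0_iff_equal not_False_eq_True)
  qed
  hence u2: "uniform_limit K (\<lambda>M z. A M (1 - s z)) (\<lambda>z. L (1 - s z)) at_top"
    by (rule uniform_limit_compose'[where h = "\<lambda>z. 1 - s z"]) auto
  have "filterlim (\<lambda>(M, N). Suc N) at_top (at_top \<times>\<^sub>F at_top :: (nat \<times> nat) filter)"
    using filterlim_compose[OF filterlim_Suc filterlim_snd] by (simp add: case_prod_unfold)
  from filterlim_compose[OF u1 this]
  have v1: "uniform_limit K (\<lambda>(M, N) z. A (Suc N) (s z)) (\<lambda>z. L (s z)) (at_top \<times>\<^sub>F at_top :: (nat \<times> nat) filter)"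
    by (simp add: case_prod_unfold)
  from filterlim_compose[OF u2 filterlim_fst]
  have v2: "uniform_limit K (\<lambda>(M, N) z. A M (1 - s z)) (\<lambda>z. L (1 - s z)) (at_top \<times>\<^sub>F at_top :: (nat \<times> nat) filter)"
    by (simp add: case_prod_unfold)
  define a where "a = 1 / (4 * of_real pi * of_real \<beta> :: complex)"
  have "uniform_limit K (\<lambda>x z. a * ((case x of (M, N) \<Rightarrow> \<lambda>z. A (Suc N) (s z)) z + (case x of (M, N) \<Rightarrow> \<lambda>z. A M (1 - s z)) z))
     (\<lambda>z. a * (L (s z) + L (1 - s z))) (at_top \<times>\<^sub>F at_top :: (nat \<times> nat) filter)"
    by (intro bounded_linear.uniform_limit[OF bounded_linear_mult_right] uniform_limit_add v1 v2)
  moreover have "a * (L (s z) + L (1 - s z)) = strip_szego \<beta> w z" if "z \<in> K" for z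
  proof -
    have "s z \<notin> \<int>"
    proof
      assume "s z \<in> \<int>"
      then obtain k where "s z = of_int k" by (auto elim: Ints_cases)
      thus False using nz[OF that, of "- k"] by simp
    qed
    from alternating_reflection[OF this] show ?thesis
      unfolding L_def by (simp add: a_def strip_szego_def s_def)
  qed
  moreover have "a * (A (Suc N) (s z) + A M (1 - s z)) = (\<Sum>k\<in>{- int M..int N}. (-1) powi k * cauchy_kernel w (z + 2 * of_int k * \<i> * of_real \<beta>))" for M N z
  proof -
    have F: "cauchy_kernel w (z + 2 * of_int k * \<i> * of_real \<beta>) = a / (s z + of_int k)" for k
      unfolding cauchy_kernel_def shift by (simp add: a_def mult_ac)
    have pos: "(-1) powi (int n) * (a / (s z + of_int (int n))) = a * ((-1) ^ n / (s z + of_nat n))" for n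
      by simp
    have neg: "(-1) powi (- int n - 1) * (a / (s z + of_int (- int n - 1))) = a * ((-1) ^ n / (1 - s z + of_nat n))" for n
    proof -
      have "(- int n - 1) = - int (Suc n)" by simp
      hence "(-1) powi (- int n - 1) = (- ((-1) ^ n) :: complex)"
        by (simp only: power_int_minus power_int_of_nat) (simp flip: power_inverse)
      moreover have "s z + of_int (- int n - 1) = - (1 - s z + of_nat n)" by simp
      ultimately show ?thesis by (simp only: divide_minus_right) simp
    qed
    show ?thesis unfolding sum_int_interval_split F pos neg A_def sum_distrib_left[symmetric] distrib_left[symmetric] ..
  qed
  ultimately show "uniform_limit K (\<lambda>(M, N) z. \<Sum>k\<in>{- int M..int N}. (-1) powi k * cauchy_kernel w (z + 2 * of_int k * \<i> * of_real \<beta>))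
      (strip_szego \<beta> w) (at_top \<times>\<^sub>F at_top)"
    by (simp add: uniform_limit_iff case_prod_unfold cong: ball_cong)
qed

lemma strip_bergman_series:
  assumes \<beta>: "\<beta> > 0" and wz: "w \<in> strip \<beta>" "z \<in> strip \<beta>"
  shows "((\<lambda>k::int. - 1 / (of_real pi * (z + 2 * of_int k * \<i> * of_real \<beta> - cnj w)\<^sup>2)) has_sum bergman_kernel (strip \<beta>) w z) UNIV"
proof -
  define s where "s = (z - cnj w) / (2 * \<i> * of_real \<beta>)"
  have shift: "z + 2 * of_int k * \<i> * of_real \<beta> - cnj w = 2 * \<i> * of_real \<beta> * (s + of_int k)" for k
    using \<beta> by (simp add: s_def field_simps)
  have "s \<notin> \<int>"
  proof
    assume "s \<in> \<int>"
    then obtain k where k: "s = of_int k" by (auto elim: Ints_cases)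
    have "z - cnj w = 2 * \<i> * of_real \<beta> * s" using \<beta> by (simp add: s_def)
    hence "Im (z - cnj w) = Im (2 * \<i> * of_real \<beta> * of_int k)" by (simp add: k)
    hence "Im z + Im w = 2 * \<beta> * of_int k" by simp
    moreover have "0 < Im z + Im w" "Im z + Im w < 2 * \<beta>" using wz by (auto simp: strip_def)
    ultimately have "0 < (of_int k :: real)" "(of_int k :: real) < 1" using \<beta> by (auto simp: zero_less_mult_iff)
    thus False by simp
  qed
  from has_sum_cmult_right[OF has_sum_inverse_square_int[OF this], of "1 / (4 * of_real pi * (of_real \<beta>)\<^sup>2)"]
  have "((\<lambda>k::int. 1 / (4 * of_real pi * (of_real \<beta>)\<^sup>2) * (1 / (s + of_int k)\<^sup>2)) has_sum
     1 / (4 * of_real pi * (of_real \<beta>)\<^sup>2) * ((of_real pi)\<^sup>2 / (sin (of_real pi * s))\<^sup>2)) UNIV" .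
  moreover have "1 / (4 * of_real pi * (of_real \<beta>)\<^sup>2) * (1 / (s + of_int k)\<^sup>2) = - 1 / (of_real pi * (z + 2 * of_int k * \<i> * of_real \<beta> - cnj w)\<^sup>2)" for k
    unfolding shift power_mult_distrib by (simp add: mult_ac)
  moreover have "1 / (4 * of_real pi * (of_real \<beta>)\<^sup>2) * ((of_real pi)\<^sup>2 / (sin (of_real pi * s))\<^sup>2) = bergman_kernel (strip \<beta>) w z"
    unfolding bergman_kernel_strip[OF \<beta> wz] s_def[symmetric] by (simp add: power2_eq_square)
  ultimately show ?thesis by simp
qed

theorem mainTheorem8:
  fixes \<beta> :: real
  assumes "\<beta> > 0"
  shows "(\<forall>w\<in>strip \<beta>. \<exists>F G.
            meromorphic_extension upper_half_plane (szego_kernel upper_half_plane w) F \<and>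
            meromorphic_extension (strip \<beta>) (szego_kernel (strip \<beta>) w) G \<and>
            has_meromorphic_sum
              (\<lambda>k z. (-1) powi k * F (z + 2 * of_int k * \<i> * of_real \<beta>)) G) \<and>
         (\<exists>c::complex. \<forall>w\<in>strip \<beta>. \<exists>F.
            meromorphic_extension upper_half_plane (bergman_kernel upper_half_plane w) F \<and>
            (\<forall>z\<in>strip \<beta>.
               (\<lambda>k::int. F (z + 2 * of_int k * \<i> * of_real \<beta>)) summable_on UNIV \<and>
               bergman_kernel (strip \<beta>) w z =
                 c * (\<Sum>\<^sub>\<infinity>k::int. F (z + 2 * of_int k * \<i> * of_real \<beta>))))"
proof (intro conjI ballI, goal_cases)
  case (1 w)
  note up = strip_subset_upper_half_plane[OF 1]
  show ?case
    using cauchy_kernel_nicely_meromorphic strip_szego_nicely_meromorphic strip_szego_series[OF assms]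
      szego_kernel_upper_half_plane[OF up] szego_kernel_strip[OF assms 1]
    by (intro exI[of _ "cauchy_kernel w"] exI[of _ "strip_szego \<beta> w"]) (simp add: meromorphic_extension_def)
next
  case 2
  show ?case
  proof (intro exI[of _ 1] ballI, goal_cases)
    case (1 w)
    let ?F = "\<lambda>z. - 1 / (of_real pi * (z - cnj w)\<^sup>2)"
    have eq: "?F = (\<lambda>z. - 1 / of_real pi * inverse ((z - cnj w)\<^sup>2))"
      by (simp only: divide_inverse inverse_mult_distrib mult.assoc)
    have "?F nicely_meromorphic_on UNIV"
      unfolding eq by (rule nicely_meromorphic_inverse_entire) (intro holomorphic_intros)
    hence "meromorphic_extension upper_half_plane (bergman_kernel upper_half_plane w) ?F"
      using bergman_kernel_upper_half_plane[OF strip_subset_upper_half_plane[OF 1]]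
      by (simp add: meromorphic_extension_def)
    moreover have "(\<lambda>k::int. ?F (z + 2 * of_int k * \<i> * of_real \<beta>)) summable_on UNIV \<and>
        bergman_kernel (strip \<beta>) w z = 1 * (\<Sum>\<^sub>\<infinity>k::int. ?F (z + 2 * of_int k * \<i> * of_real \<beta>))"
      if "z \<in> strip \<beta>" for z
      using strip_bergman_series[OF assms 1 that] by (auto simp: infsumI summable_on_def)
    ultimately show ?case by blast
  qed
qed

end
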